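(* Fix $n$ and let $G$ be a $k$-regular graph on $n$ vertices that is connected and aperiodic. Under the NBRW-Po$d$ scheme on $G$ described in the context, the Markov process $(\mathbf{Q}(t),\overline{\mathbf{W}}(t))_{t\ge 0}$ is irreducible and positive recurrent, and hence $\mathbf{Q}(t)$ converges weakly, as $t\to\infty$, to some random vector $\hat{\mathbf{Q}}$.
   Context: Model. Fix constants $0<\lambda<1$ and integers $d\ge 2$, $k\ge 3$. There are $n$ servers, identified with the vertices $[n]$ of a $k$-regular graph $G$; each server has its own queue. Jobs arrive according to a Poisson process of rate $\lambda n$. Service times are i.i.d. exponential with mean $1$; each server works whenever its queue is nonempty. $\mathbf{Q}(t)\in\mathbb{Z}_+^n$ is the vector of queue lengths at time $t$; $\mathbb{Z}_+=\{0,1,2,\dots\}$. NBRW-Po$d$ scheme. There are $d$ independent non-backtracking random walkers on $G$, independent of the arrivals and services. The state of a walker is a directed edge $(u,v)$ of $G$ (it is at $v$, having come from $u$); in one step it moves to $(v,w)$ with $w$ uniformly distributed over the $k-1$ neighbors of $v$ other than $u$. When a job arrives, it joins the shortest queue among the $d$ queues at the current positions of the walkers, and then each walker takes one step. Ties are broken arbitrarily, by a rule depending only on the current state and possibly independent randomness. $\overline{\mathbf{W}}(t)\in\vec{\mathcal{E}}^d$ is the vector of the $d$ directed edges describing the walkers at time $t$, where $\vec{\mathcal{E}}$ is the set of directed edges of $G$ (each undirected edge gives two directed edges). The state space is $\mathbb{Z}_+^n\times\vec{\mathcal{E}}^d$. A graph is aperiodic if the greatest common divisor of its cycle lengths (closed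 walk lengths) is $1$, i.e. a connected graph is aperiodic iff it is not bipartite. *)

theory Defs
  imports "HOL-Probability.Probability"
begin

section \<open>Graphs\<close>

text \<open>
  A simple graph on the finite vertex type \<^typ>\<open>'v\<close> is a symmetric, irreflexive adjacency relation.
\<close>

definition simple_graph :: "('v \<Rightarrow> 'v \<Rightarrow> bool) \<Rightarrow> bool" where
  "simple_graph adj \<longleftrightarrow> symp adj \<and> irreflp adj"

definition regular_graph :: "('v \<Rightarrow> 'v \<Rightarrow> bool) \<Rightarrow> nat \<Rightarrow> bool" where
  "regular_graph adj k \<longleftrightarrow> (\<forall>u. card {v. adj u v} = k)"

definition connected_graph :: "('v \<Rightarrow> 'v \<Rightarrow> bool) \<Rightarrow> bool" where
  "connected_graph adj \<longleftrightarrow> (\<forall>u v. adj\<^sup>*\<^sup>* u v)"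

definition aperiodic_graph :: "('v \<Rightarrow> 'v \<Rightarrow> bool) \<Rightarrow> bool" where
  "aperiodic_graph adj \<longleftrightarrow> Gcd {m::nat. 0 < m \<and> (\<exists>v. (adj ^^ m) v v)} = 1"

definition directed_edges :: "('v \<Rightarrow> 'v \<Rightarrow> bool) \<Rightarrow> ('v \<times> 'v) set" where
  "directed_edges adj = {(u, v). adj u v}"


section \<open>Irreducibility, positive recurrence, weak convergence\<close>

text \<open>
  A process with discrete state space is given by a family of laws \<open>P x\<close>, one for each
  starting state \<open>x\<close>, on a common sample space carrying the random variables \<open>X t\<close>, \<open>t \<ge> 0\<close>.
\<close>

definition irreducible_process ::
  "'s set \<Rightarrow> ('s \<Rightarrow> 'w measure) \<Rightarrow> (real \<Rightarrow> 'w \<Rightarrow> 's) \<Rightarrow> bool" where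
  "irreducible_process S P X \<longleftrightarrow>
     (\<forall>x\<in>S. \<forall>y\<in>S. \<exists>t\<ge>0. 0 < measure (P x) {\<omega> \<in> space (P x). X t \<omega> = y})"

text \<open>
  The first time at which the process is back in its initial state after having left it
  (\<^term>\<open>\<infinity>\<close> if this never happens).
\<close>

definition return_time :: "(real \<Rightarrow> 'w \<Rightarrow> 's) \<Rightarrow> 'w \<Rightarrow> ennreal" where
  "return_time X \<omega> =
     (INF t \<in> {t. X t \<omega> = X 0 \<omega> \<and> (\<exists>s. 0 \<le> s \<and> s < t \<and> X s \<omega> \<noteq> X 0 \<omega>)}. ennreal t)"

definition positive_recurrent_process ::
  "'s set \<Rightarrow> ('s \<Rightarrow> 'w measure) \<Rightarrow> (real \<Rightarrow> 'w \<Rightarrow> 's) \<Rightarrow> bool" where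
  "positive_recurrent_process S P X \<longleftrightarrow>
     (\<forall>x\<in>S. (\<integral>\<^sup>+ \<omega>. return_time X \<omega> \<partial>P x) < \<infinity>)"

text \<open>
  Weak convergence of measures on an arbitrary topological space; the notion
  \<^const>\<open>weak_conv_m\<close> is restricted to sequences of measures on the real line.
\<close>

definition converges_weakly ::
  "('i \<Rightarrow> 'a::topological_space measure) \<Rightarrow> 'a measure \<Rightarrow> 'i filter \<Rightarrow> bool" where
  "converges_weakly \<mu> \<nu> F \<longleftrightarrow>
     (\<forall>f::'a \<Rightarrow> real. continuous_on UNIV f \<and> bounded (range f) \<longrightarrow>
        ((\<lambda>t. \<integral>x. f x \<partial>\<mu> t) \<longlongrightarrow> (\<integral>x. f x \<partial>\<nu>)) F)"


section \<open>The queueing system\<close>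

text \<open>
  Servers are the elements of \<^typ>\<open>'v\<close>, so that there are \<^term>\<open>CARD('v::finite)\<close> of them, and
  walkers are the elements of \<^typ>\<open>'d\<close>. A state consists of the queue lengths and of the directed
  edge \<open>(u, v)\<close> of each walker, which is at \<open>v\<close> and came from \<open>u\<close>.
\<close>

type_synonym ('v, 'd) state = "('v \<Rightarrow> nat) \<times> ('d \<Rightarrow> 'v \<times> 'v)"

definition states :: "('v \<Rightarrow> 'v \<Rightarrow> bool) \<Rightarrow> ('v, 'd) state set" where
  "states adj = {(q, w). \<forall>i. w i \<in> directed_edges adj}"

definition positions :: "('v, 'd) state \<Rightarrow> 'v set" where
  "positions x = range (\<lambda>i. snd (snd x i))"

definition shortest_positions :: "('v, 'd) state \<Rightarrow> 'v set" where
  "shortest_positions x = {v \<in> positions x. \<forall>u \<in> positions x. fst x v \<le> fst x u}"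

text \<open>
  A tie-breaking rule gives, for each state, the distribution of the server that an arriving
  job joins.
\<close>

definition tie_breaking_rule ::
  "('v \<Rightarrow> 'v \<Rightarrow> bool) \<Rightarrow> (('v, 'd) state \<Rightarrow> 'v pmf) \<Rightarrow> bool" where
  "tie_breaking_rule adj tie \<longleftrightarrow> (\<forall>x \<in> states adj. set_pmf (tie x) \<subseteq> shortest_positions x)"

definition nbrw_step :: "('v \<Rightarrow> 'v \<Rightarrow> bool) \<Rightarrow> 'v \<times> 'v \<Rightarrow> ('v \<times> 'v) pmf" where
  "nbrw_step adj e = map_pmf (Pair (snd e)) (pmf_of_set {w. adj (snd e) w \<and> w \<noteq> fst e})"

text \<open>
  Events: \<^const>\<open>None\<close> is the arrival of a job, \<open>Some v\<close> is a service completion at server \<open>v\<close>.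
\<close>

definition event_step ::
  "('v \<Rightarrow> 'v \<Rightarrow> bool) \<Rightarrow> (('v, 'd::finite) state \<Rightarrow> 'v pmf) \<Rightarrow> ('v, 'd) state \<Rightarrow> 'v option
     \<Rightarrow> ('v, 'd) state pmf" where
  "event_step adj tie x e =
     (let (q, w) = x in
      case e of
        None \<Rightarrow>
          do {
            v \<leftarrow> tie (q, w);
            w' \<leftarrow> Pi_pmf UNIV undefined (\<lambda>i. nbrw_step adj (w i));
            return_pmf (q(v := q v + 1), w')
          }
      | Some v \<Rightarrow> return_pmf (q(v := q v - 1), w))"

text \<open>
  The system is observed at time 0 and at the successive events. Besides the state we record a
  clock for each kind of event: \<open>c None\<close> is the remaining time until the next arrival; \<open>c (Some v)\<close>
  is the remaining service time of the job in service at \<open>v\<close> or, if the queue of \<open>v\<close> is empty, the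
  service time of the next job to be served there. The clock of an idle server does not run. When
  a clock rings, only this clock is renewed, with an independent exponential value: interarrival
  times have rate \<open>\<lambda>n\<close> (Poisson arrivals) and service times have mean 1. At time 0 all clocks are
  independent and exponential.
\<close>

type_synonym ('v, 'd) config = "('v, 'd) state \<times> ('v option \<Rightarrow> real)"

definition config_space :: "('v, 'd) config measure" where
  "config_space = count_space UNIV \<Otimes>\<^sub>M Pi\<^sub>M UNIV (\<lambda>_. borel)"

definition clock_law :: "real \<Rightarrow> 'v::finite option \<Rightarrow> real measure" where
  "clock_law lam e =
     density lborel
       (exponential_density (case e of None \<Rightarrow> lam * real CARD('v) | Some v \<Rightarrow> 1))"

definition running :: "('v, 'd) state \<Rightarrow> 'v option set" where
  "running x = insert None (Some ` {v. 0 < fst x v})"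

text \<open>Simultaneous events have probability 0, so the choice made by \<^const>\<open>arg_min_on\<close> is irrelevant.\<close>

definition next_event :: "('v, 'd) config \<Rightarrow> 'v option" where
  "next_event z = arg_min_on (snd z) (running (fst z))"

definition waiting_time :: "('v, 'd) config \<Rightarrow> real" where
  "waiting_time z = snd z (next_event z)"

definition renew_clocks :: "('v, 'd) config \<Rightarrow> real \<Rightarrow> 'v option \<Rightarrow> real" where
  "renew_clocks z r =
     (\<lambda>i. if i = next_event z then r
          else if i \<in> running (fst z) then snd z i - waiting_time z
          else snd z i)"

definition config_step ::
  "('v::finite \<Rightarrow> 'v \<Rightarrow> bool) \<Rightarrow> real \<Rightarrow> (('v, 'd::finite) state \<Rightarrow> 'v pmf) \<Rightarrow> ('v, 'd) config
     \<Rightarrow> ('v, 'd) config measure" where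
  "config_step adj lam tie z =
     measure_pmf (event_step adj tie (fst z) (next_event z)) \<bind>
       (\<lambda>y. distr (clock_law lam (next_event z)) config_space (\<lambda>r. (y, renew_clocks z r)))"

definition initial_config ::
  "real \<Rightarrow> ('v::finite, 'd::finite) state pmf \<Rightarrow> ('v, 'd) config measure" where
  "initial_config lam \<mu> = measure_pmf \<mu> \<Otimes>\<^sub>M Pi\<^sub>M UNIV (clock_law lam)"

definition config_kernel ::
  "('v::finite \<Rightarrow> 'v \<Rightarrow> bool) \<Rightarrow> real \<Rightarrow> (('v, 'd::finite) state \<Rightarrow> 'v pmf) \<Rightarrow> ('v, 'd) state pmf
     \<Rightarrow> nat \<Rightarrow> (nat \<Rightarrow> ('v, 'd) config) \<Rightarrow> ('v, 'd) config measure" where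
  "config_kernel adj lam tie \<mu> m \<omega> =
     (case m of 0 \<Rightarrow> initial_config lam \<mu> | Suc l \<Rightarrow> config_step adj lam tie (\<omega> l))"

text \<open>
  The law of the sequence of configurations when the initial state has distribution \<open>\<mu>\<close>, from the
  Ionescu-Tulcea theorem; its assumptions are verified in \<open>Ionescu_Tulcea_config_kernel\<close> below.
\<close>

definition path_measure ::
  "('v::finite \<Rightarrow> 'v \<Rightarrow> bool) \<Rightarrow> real \<Rightarrow> (('v, 'd::finite) state \<Rightarrow> 'v pmf) \<Rightarrow> ('v, 'd) state pmf
     \<Rightarrow> (nat \<Rightarrow> ('v, 'd) config) measure" where
  "path_measure adj lam tie \<mu> =
     projective_family.lim UNIV
       (Ionescu_Tulcea.CI (config_kernel adj lam tie \<mu>) (\<lambda>_. config_space)) (\<lambda>_. config_space)"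

definition event_time :: "nat \<Rightarrow> (nat \<Rightarrow> ('v, 'd) config) \<Rightarrow> real" where
  "event_time m \<omega> = (\<Sum>i<m. waiting_time (\<omega> i))"

text \<open>The process at time \<open>t\<close>: the \<open>m\<close>-th configuration is valid in \<open>[event_time m, event_time (m + 1))\<close>.\<close>

definition state_at :: "real \<Rightarrow> (nat \<Rightarrow> ('v, 'd) config) \<Rightarrow> ('v, 'd) state" where
  "state_at t \<omega> = fst (\<omega> (LEAST m. t < event_time (Suc m) \<omega>))"

definition queues_at :: "real \<Rightarrow> (nat \<Rightarrow> ('v, 'd) config) \<Rightarrow> 'v \<Rightarrow> nat" where
  "queues_at t \<omega> = fst (state_at t \<omega>)"


subsection \<open>The path measure is well defined\<close>

lemma space_config_space [simp]: "space config_space = UNIV"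
  by (simp add: config_space_def space_pair_measure space_PiM)

lemma sets_clock_law [measurable_cong, simp]: "sets (clock_law lam e) = sets borel"
  by (simp add: clock_law_def)

lemma prob_space_clock_law:
  "0 < lam \<Longrightarrow> prob_space (clock_law lam (e :: 'v::finite option))"
  unfolding clock_law_def by (intro prob_space_exponential_density) (auto split: option.split)

lemma sets_initial_config: "sets (initial_config lam \<mu>) = sets config_space"
  unfolding initial_config_def config_space_def
  by (intro sets_pair_measure_cong sets_PiM_cong) auto

lemma prob_space_initial_config:
  "0 < lam \<Longrightarrow> prob_space (initial_config lam \<mu>)"
  unfolding initial_config_def
  by (intro prob_space_pair prob_space_PiM prob_space_clock_law prob_space_measure_pmf)

lemma measurable_next_event:
  fixes x :: "('v::finite, 'd::finite) state"
  shows "(\<lambda>c. next_event (x, c)) \<in> Pi\<^sub>M UNIV (\<lambda>_. borel) \<rightarrow>\<^sub>M count_space UNIV"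
proof -
  have eq: "next_event (x, c) =
      (SOME i. i \<in> {i \<in> running x. \<forall>j\<in>running x. \<not> c j < c i})" for c
    by (simp add: next_event_def arg_min_on_def arg_min_def is_arg_min_def) (metis (lifting))
  have "(\<lambda>c. {i \<in> running x. \<forall>j\<in>running x. \<not> c j < c i})
      \<in> Pi\<^sub>M UNIV (\<lambda>_. borel :: real measure) \<rightarrow>\<^sub>M count_space UNIV"
  proof (subst measurable_count_space_eq_countable, safe)
    fix A :: "'v option set"
    have "{c \<in> space (Pi\<^sub>M UNIV (\<lambda>_. borel :: real measure)).
            \<forall>i\<in>UNIV. (i \<in> running x \<and> (\<forall>j\<in>running x. \<not> c j < c i)) = (i \<in> A)}
          \<in> sets (Pi\<^sub>M UNIV (\<lambda>_. borel :: real measure))"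
      by measurable
    also have "{c \<in> space (Pi\<^sub>M UNIV (\<lambda>_. borel :: real measure)).
            \<forall>i\<in>UNIV. (i \<in> running x \<and> (\<forall>j\<in>running x. \<not> c j < c i)) = (i \<in> A)} =
        (\<lambda>c. {i \<in> running x. \<forall>j\<in>running x. \<not> c j < c i}) -` {A} \<inter>
          space (Pi\<^sub>M UNIV (\<lambda>_. borel :: real measure))"
      by blast
    finally show "\<dots> \<in> sets (Pi\<^sub>M UNIV (\<lambda>_. borel :: real measure))" .
  qed (auto simp: uncountable_infinite)
  from measurable_compose[OF this, of "\<lambda>A. SOME i. i \<in> A" "count_space UNIV"]
  show ?thesis unfolding eq by simp
qed

lemma measurable_config_step:
  fixes adj :: "'v::finite \<Rightarrow> 'v \<Rightarrow> bool" and tie :: "('v, 'd::finite) state \<Rightarrow> 'v pmf"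
  assumes lam: "0 < lam"
  shows "config_step adj lam tie \<in> config_space \<rightarrow>\<^sub>M subprob_algebra config_space"
proof -
  let ?C = "Pi\<^sub>M UNIV (\<lambda>_. borel) :: ('v option \<Rightarrow> real) measure"
  let ?N = "config_space :: ('v, 'd) config measure"
  define F where "F x e c = measure_pmf (event_step adj tie x e) \<bind>
      (\<lambda>y. distr (clock_law lam e) ?N (\<lambda>r. (y, (\<lambda>i. if i = e then r
        else if i \<in> running x then c i - c e else c i))))" for x e and c :: "'v option \<Rightarrow> real"
  have F: "F x e \<in> ?C \<rightarrow>\<^sub>M subprob_algebra ?N" for x e
  proof -
    have K: "clock_law lam e \<in> space (subprob_algebra borel)"
      by (auto simp: space_subprob_algebra prob_space_clock_law[OF lam] prob_space_imp_subprob_space)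
    have "(\<lambda>((c, y), r). (y, (\<lambda>i. if i = e then r
        else if i \<in> running x then c i - c e else c i)))
        \<in> (?C \<Otimes>\<^sub>M measure_pmf (event_step adj tie x e)) \<Otimes>\<^sub>M borel \<rightarrow>\<^sub>M ?N"
      unfolding config_space_def split_beta'
      by (intro measurable_Pair measurable_PiM_single')
         (auto intro!: measurable_compose[OF measurable_fst] measurable_snd)
    then show ?thesis
      unfolding F_def
      by (intro measurable_bind[where N="measure_pmf (event_step adj tie x e)"] measurable_const)
         (auto intro!: measurable_distr2[where M=borel] measurable_const K
            simp: split_beta' space_subprob_algebra prob_space_imp_subprob_space prob_space_measure_pmf)
  qed
  have "(\<lambda>c. config_step adj lam tie (x, c)) \<in> ?C \<rightarrow>\<^sub>M subprob_algebra ?N" for x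
  proof -
    have "(\<lambda>c. F x (next_event (x, c)) c) \<in> ?C \<rightarrow>\<^sub>M subprob_algebra ?N"
      by (rule measurable_compose_countable[OF F measurable_next_event])
    then show ?thesis
      by (simp add: config_step_def F_def renew_clocks_def waiting_time_def cong: if_cong)
  qed
  then show ?thesis
    unfolding config_space_def
    by (intro measurable_pair_measure_countable1) (auto simp: config_space_def)
qed

lemma prob_space_config_step:
  assumes lam: "0 < lam"
  shows "prob_space (config_step adj lam tie (z :: ('v::finite, 'd::finite) config))"
  unfolding config_step_def
proof (rule prob_space.prob_space_bind[OF prob_space_measure_pmf])
  have m: "(\<lambda>r. (y, renew_clocks z r)) \<in> clock_law lam e \<rightarrow>\<^sub>M config_space"
    for y :: "('v, 'd) state" and e :: "'v option"
    unfolding config_space_def renew_clocks_def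
    by (intro measurable_Pair measurable_PiM_single') auto
  have p: "prob_space (distr (clock_law lam e) config_space (\<lambda>r. (y, renew_clocks z r)))"
    for y :: "('v, 'd) state" and e :: "'v option"
    by (intro prob_space.prob_space_distr prob_space_clock_law lam m)
  then show "AE y in measure_pmf (event_step adj tie (fst z) (next_event z)).
      prob_space (distr (clock_law lam (next_event z)) config_space (\<lambda>r. (y, renew_clocks z r)))"
    by simp
  show "(\<lambda>y. distr (clock_law lam (next_event z)) config_space (\<lambda>r. (y, renew_clocks z r)))
      \<in> measure_pmf (event_step adj tie (fst z) (next_event z)) \<rightarrow>\<^sub>M subprob_algebra config_space"
    by (auto simp: space_subprob_algebra intro!: prob_space_imp_subprob_space p)
qed

lemma Ionescu_Tulcea_config_kernel:
  fixes tie :: "('v::finite, 'd::finite) state \<Rightarrow> 'v pmf"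
  assumes lam: "0 < lam"
  shows "Ionescu_Tulcea (config_kernel adj lam tie \<mu>) (\<lambda>_. config_space)"
proof (rule Ionescu_Tulcea.intro, goal_cases)
  case (1 m)
  show "config_kernel adj lam tie \<mu> m
      \<in> Pi\<^sub>M {0..<m} (\<lambda>_. config_space) \<rightarrow>\<^sub>M subprob_algebra config_space"
  proof (cases m)
    case 0
    then show ?thesis
      by (auto simp: config_kernel_def[abs_def] space_subprob_algebra sets_initial_config
          intro!: measurable_const prob_space_imp_subprob_space prob_space_initial_config lam)
  next
    case (Suc l)
    then have "(\<lambda>\<omega>. \<omega> l) \<in> Pi\<^sub>M {0..<m} (\<lambda>_. config_space) \<rightarrow>\<^sub>M config_space"
      by (intro measurable_component_singleton) auto
    from measurable_compose[OF this measurable_config_step[OF lam]] Suc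
    show ?thesis by (simp add: config_kernel_def[abs_def])
  qed
next
  case (2 m \<omega>)
  show ?case
    by (cases m) (simp_all add: config_kernel_def prob_space_initial_config[OF lam]
        prob_space_config_step[OF lam])
qed

lemma prob_space_path_measure:
  assumes lam: "0 < lam"
  shows "prob_space (path_measure adj lam tie \<mu>)"
proof -
  interpret IT: Ionescu_Tulcea "config_kernel adj lam tie \<mu>" "\<lambda>_. config_space"
    by (rule Ionescu_Tulcea_config_kernel[OF lam])
  show ?thesis
  proof
    have "emeasure (path_measure adj lam tie \<mu>)
        (IT.PF.emb UNIV {} (space (Pi\<^sub>M {} (\<lambda>_. config_space)))) = 1"
      unfolding path_measure_def
      by (subst IT.lim)
         (use prob_space.emeasure_space_1[OF IT.PF.prob_space_P[of "{}"]] in \<open>auto simp: IT.CI_def\<close>)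
    then show "emeasure (path_measure adj lam tie \<mu>) (space (path_measure adj lam tie \<mu>)) = 1"
      by (simp add: path_measure_def prod_emb_def space_PiM vimage_def restrict_def)
  qed
qed

end

theory Submission
  imports Defs
begin

text \<open>
  All clocks are exponential, so the dynamics are those of a continuous-time Markov chain on a
  countable state space whose total jump rates are at most \<open>C = n(1 + \<lambda>)\<close>. Two discrete
  chains describe it. The jump chain \<^emph>\<open>jump_kernel\<close> records the successive states. The uniformised
  chain \<^emph>\<open>uniform_kernel\<close> moves at the points of a Poisson process of rate \<open>C\<close> and ignores
  service completions at empty queues. The state at time \<open>t\<close> has the law of the uniformised chain
  after a Poisson(\<open>C t\<close>) number of steps (\<^emph>\<open>distr_state_at\<close>).

  Passing from the clocks to the chains needs only memorylessness: given the past, the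
  clocks after an event are again independent and exponential, the waiting time is exponential
  with the total rate, and the next event is chosen independently of it
  (\<^emph>\<open>fresh_clocks_step\<close>). Iterating gives the expectation of any function of the \<open>m\<close>-th event
  time and configuration as the \<open>m\<close>-th power of an integral operator (\<^emph>\<open>path_nn_integral\<close>).
  The transition probabilities of the uniformised chain at Poisson times solve the renewal
  equation of this operator, hence dominate the sum over the number of events before \<open>t\<close>.
  The bounds for a set and for its complement add up to 1, and there is no explosion, so both are
  equalities.

  Stability comes from a Lyapunov function. The job joins a queue that is no longer than the one at
  the position of a single fixed walker, and this walker visits every vertex with the same
  frequency \<open>1/n\<close>. For the sum of the squares of the queue lengths the drift therefore becomes
  negative after averaging over the walk. Instead of looking many steps ahead, one
  adds the linear corrector \<open>2 \<Sum>\<^sub>v q\<^sub>v h\<^sub>v(w)\<close>, where \<open>h\<^sub>v\<close> solves, up to a small error, the Poisson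
  equation of the walk for the indicator of the vertex \<open>v\<close>. The drift is then at most
  \<open>c - (1 - \<lambda>) \<Sum>\<^sub>v q\<^sub>v\<close> in a single step (\<^emph>\<open>drift\<close>). Foster's criterion gives finite
  mean return times for both chains, and the cycle formula an invariant distribution of
  the uniformised chain.

  The graph enters through the primitivity of the non-backtracking walk (\<^emph>\<open>primitive\<close>): after enough
  steps every directed edge can be reached from every other one in any prescribed number of steps.
  So all walkers can be brought anywhere simultaneously while each arriving job is served at once,
  which yields irreducibility, and the walk converges to the uniform distribution, which yields the
  approximate solution of the Poisson equation. The same convergence theorem (\<^emph>\<open>kpow_converges\<close>)
  is used for the walk and for the uniformised chain.
\<close>

section \<open>Iterated transition kernels\<close>

abbreviation expect :: "'s pmf \<Rightarrow> ('s \<Rightarrow> real) \<Rightarrow> real" where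
  "expect p \<equiv> measure_pmf.expectation p"

primrec kpow :: "('s \<Rightarrow> 's pmf) \<Rightarrow> nat \<Rightarrow> 's \<Rightarrow> 's pmf" where
  "kpow P 0 x = return_pmf x"
| "kpow P (Suc n) x = bind_pmf (P x) (kpow P n)"

lemma kpow_0: "kpow P 0 = return_pmf"
  and kpow_Suc: "kpow P (Suc n) = (\<lambda>x. bind_pmf (P x) (kpow P n))"
  by auto

lemma kpow_one: "kpow P (Suc 0) = P"
  by (simp add: kpow_Suc kpow_0 bind_return_pmf')

lemma kpow_add: "kpow P (m + n) = (\<lambda>x. bind_pmf (kpow P m x) (kpow P n))"
  by (induction m) (simp_all add: kpow_0 kpow_Suc bind_return_pmf bind_assoc_pmf)

lemma bind_kpow: "bind_pmf p P = p \<Longrightarrow> bind_pmf p (kpow P n) = p"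
proof (induction n)
  case (Suc n)
  have "bind_pmf p (kpow P (Suc n)) = bind_pmf (bind_pmf p P) (kpow P n)"
    by (simp add: bind_assoc_pmf kpow_Suc)
  also have "\<dots> = p" by (simp only: Suc.prems Suc.IH[OF Suc.prems])
  finally show ?case .
qed (simp add: kpow_0 bind_return_pmf')

lemma set_kpow_mono: "(\<And>z. set_pmf (P z) \<subseteq> set_pmf (Q z)) \<Longrightarrow> set_pmf (kpow P n x) \<subseteq> set_pmf (kpow Q n x)"
proof (induction n arbitrary: x)
  case (Suc n)
  have "(\<Union>y\<in>set_pmf (P x). set_pmf (kpow P n y)) \<subseteq> (\<Union>y\<in>set_pmf (Q x). set_pmf (kpow Q n y))"
    using Suc.IH Suc.prems by (intro UN_mono) auto
  then show ?case by simp
qed simp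

lemma set_kpow_closed:
  "(\<And>z. z \<in> S \<Longrightarrow> set_pmf (P z) \<subseteq> S) \<Longrightarrow> x \<in> S \<Longrightarrow> set_pmf (kpow P n x) \<subseteq> S"
  by (induction n arbitrary: x) auto

section \<open>Return times under a Foster drift condition\<close>

text \<open>
  One step of the chain, killed on arrival at \<open>x\<close>. Iterates of this operator describe the chain
  up to its first visit to \<open>x\<close>.
\<close>

definition taboo :: "('s \<Rightarrow> 's pmf) \<Rightarrow> 's \<Rightarrow> ('s \<Rightarrow> ennreal) \<Rightarrow> 's \<Rightarrow> ennreal" where
  "taboo P x f z = (\<integral>\<^sup>+ y. indicator (- {x}) y * f y \<partial>measure_pmf (P z))"

lemma taboo_mono: "(\<And>y. y \<in> S \<Longrightarrow> f y \<le> g y) \<Longrightarrow> set_pmf (P z) \<subseteq> S \<Longrightarrow> taboo P x f z \<le> taboo P x g z"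
  unfolding taboo_def
  by (intro nn_integral_mono_AE) (auto simp: AE_measure_pmf_iff intro!: mult_left_mono)

lemma taboo_mono': "f \<le> g \<Longrightarrow> taboo P x f \<le> taboo P x g"
  unfolding taboo_def le_fun_def
  by (auto intro!: nn_integral_mono mult_left_mono)

lemma taboo_add: "taboo P x (\<lambda>y. f y + g y) z = taboo P x f z + taboo P x g z"
  unfolding taboo_def by (simp add: distrib_left nn_integral_add)

lemma taboo_cmult: "taboo P x (\<lambda>y. c * f y) z = c * taboo P x f z"
  unfolding taboo_def by (simp add: mult.left_commute nn_integral_cmult)

lemma taboo_sum: "taboo P x (\<lambda>y. \<Sum>i\<in>I. f i y) z = (\<Sum>i\<in>I. taboo P x (f i) z)"
  unfolding taboo_def by (simp add: sum_distrib_left nn_integral_sum)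

lemma taboo_le: "taboo P x f z \<le> (\<integral>\<^sup>+ y. f y \<partial>measure_pmf (P z))"
  unfolding taboo_def by (intro nn_integral_mono) (auto simp: indicator_def)

text \<open>
  Splitting a step according to whether it ends in \<open>x\<close>; this is the only link between the killed
  and the original chain.
\<close>

lemma integral_eq_taboo:
  "(\<integral>\<^sup>+ y. f y \<partial>measure_pmf (P z)) = taboo P x f z + f x * ennreal (pmf (P z) x)"
proof -
  have "(\<integral>\<^sup>+ y. f y \<partial>measure_pmf (P z)) =
      (\<integral>\<^sup>+ y. indicator (- {x}) y * f y + f x * indicator {x} y \<partial>measure_pmf (P z))"
    by (intro nn_integral_cong) (auto simp: indicator_def)
  also have "\<dots> = taboo P x f z + f x * ennreal (pmf (P z) x)"
    unfolding taboo_def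
    by (subst nn_integral_add) (auto simp: nn_integral_cmult emeasure_pmf_single)
  finally show ?thesis .
qed

text \<open>
  The probability that the chain started in a given state is not in \<open>x\<close> at any of the times \<open>1, \<dots>, n\<close>.
  The sum over \<open>n\<close> is the mean hitting time of \<open>x\<close>, or the mean return time if the chain starts in \<open>x\<close>.
\<close>

abbreviation avoid :: "('s \<Rightarrow> 's pmf) \<Rightarrow> 's \<Rightarrow> nat \<Rightarrow> 's \<Rightarrow> ennreal" where
  "avoid P x n \<equiv> (taboo P x ^^ n) (\<lambda>_. 1)"

lemma avoid_decreasing: "avoid P x (Suc n) z \<le> avoid P x n z"
proof -
  have "avoid P x (Suc n) \<le> avoid P x n"
  proof (induction n)
    case 0
    have "taboo P x (\<lambda>_. 1) z \<le> 1" for z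
      using taboo_le[of P x "\<lambda>_. 1" z] by simp
    then show ?case by (simp add: le_fun_def)
  next
    case (Suc n)
    then show ?case by (simp add: taboo_mono')
  qed
  then show ?thesis by (simp add: le_fun_def)
qed

lemma avoid_antimono: "m \<le> n \<Longrightarrow> avoid P x n z \<le> avoid P x m z"
  by (rule lift_Suc_antimono_le[of "\<lambda>n. avoid P x n z"]) (rule avoid_decreasing)

lemma avoid_le_1: "avoid P x n z \<le> 1"
  using avoid_antimono[of 0 n P x z] by simp

lemma nn_integral_less_1:
  assumes "\<And>y. f y \<le> 1" "y \<in> set_pmf p" "f y < (1::ennreal)"
  shows "(\<integral>\<^sup>+ y. f y \<partial>measure_pmf p) < 1"
proof -
  have "(\<integral>\<^sup>+ y. f y \<partial>measure_pmf p) < (\<integral>\<^sup>+ y. 1 \<partial>measure_pmf p)"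
  proof (rule nn_integral_less)
    have "(\<integral>\<^sup>+ y. f y \<partial>measure_pmf p) \<le> (\<integral>\<^sup>+ y. 1 \<partial>measure_pmf p)"
      by (intro nn_integral_mono assms)
    then show "(\<integral>\<^sup>+ y. f y \<partial>measure_pmf p) \<noteq> \<infinity>" by (auto simp: top_unique)
    show "\<not> (AE x in measure_pmf p. 1 \<le> f x)"
      using assms(2,3) by (auto simp: AE_measure_pmf_iff not_le)
  qed (use assms in auto)
  then show ?thesis by simp
qed

lemma avoid_less_1:
  "1 \<le> j \<Longrightarrow> x \<in> set_pmf (kpow P j z) \<Longrightarrow> avoid P x j z < 1"
proof (induction j arbitrary: z rule: nat_induct_at_least)
  case base
  then have "x \<in> set_pmf (P z)" by (simp only: One_nat_def kpow_one)
  then show ?case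
    using nn_integral_less_1[of "indicator (- {x})" x "P z"] by (simp add: taboo_def indicator_def)
next
  case (Suc j)
  then obtain y where y: "y \<in> set_pmf (P z)" "x \<in> set_pmf (kpow P j y)" by auto
  then have "avoid P x j y < 1" by (intro Suc.IH)
  then have "(\<integral>\<^sup>+ w. indicator (- {x}) w * avoid P x j w \<partial>measure_pmf (P z)) < 1"
    using avoid_le_1[where P=P and x=x and n=j]
    by (intro nn_integral_less_1[OF _ y(1)]) (auto split: split_indicator)
  then show ?case by (simp add: taboo_def[of P x _ z])
qed

text \<open>
  The function \<open>V\<close> decreases on average except on \<open>F\<close>. The exceptional set is removed by adding a
  multiple of \<open>\<phi> = \<Sum>\<^sub>i\<^sub><\<^sub>L avoid P x i\<close>. One killed step turns \<open>\<phi>\<close> into \<open>\<phi> - 1 + avoid P x L\<close>, so \<open>\<phi>\<close>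
  never increases, and it decreases by a fixed amount on the finite set \<open>F\<close>, from
  which \<open>x\<close> is reached within \<open>L\<close> steps with positive probability. The
  corrected function \<open>W\<close> decreases by 1 in every killed step and so bounds the mean
  return time.
\<close>

lemma foster_finite_return:
  fixes P :: "'s \<Rightarrow> 's pmf" and V :: "'s \<Rightarrow> ennreal"
  assumes closed: "\<And>z. z \<in> S \<Longrightarrow> set_pmf (P z) \<subseteq> S"
    and F: "finite F" and b: "b < \<infinity>" and V: "\<And>z. z \<in> S \<Longrightarrow> V z < \<infinity>"
    and drift: "\<And>z. z \<in> S \<Longrightarrow> (\<integral>\<^sup>+ y. V y \<partial>measure_pmf (P z)) + 1 \<le> V z + b * indicator F z"
    and reach: "\<And>z. z \<in> S \<Longrightarrow> \<exists>j\<ge>1. x \<in> set_pmf (kpow P j z)"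
    and x: "x \<in> S"
  shows "(\<Sum>n. avoid P x n x) < \<infinity>"
proof -
  define u where "u = avoid P x"
  have u_Suc: "taboo P x (u n) = u (Suc n)" for n by (simp add: u_def)
  have u_le: "u n z \<le> 1" for n z by (simp add: u_def avoid_le_1)
  obtain j where j: "\<And>z. z \<in> S \<Longrightarrow> 1 \<le> j z \<and> x \<in> set_pmf (kpow P (j z) z)"
    using reach by metis
  \<comment> \<open>Within \<open>L\<close> steps the chain can reach \<open>x\<close> from each point of the exceptional set.\<close>
  define L where "L = Max (insert 0 (j ` (F \<inter> S)))"
  have L: "u L z < 1" if "z \<in> F" "z \<in> S" for z
  proof -
    have "j z \<le> L" unfolding L_def using that F by (intro Max_ge) auto
    then have "u L z \<le> u (j z) z" by (simp add: u_def avoid_antimono)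
    also have "\<dots> < 1" using j[OF that(2)] by (auto simp: u_def intro!: avoid_less_1)
    finally show ?thesis .
  qed
  define \<delta> where "\<delta> = Min (insert 1 ((\<lambda>z. 1 - u L z) ` (F \<inter> S)))"
  have \<delta>: "0 < \<delta>" "\<delta> \<le> 1"
    unfolding \<delta>_def using F L by (auto simp: Min_gr_iff diff_gr0_ennreal)
  have \<delta>': "u L z + \<delta> \<le> 1" if "z \<in> F" "z \<in> S" for z
  proof -
    have "\<delta> \<le> 1 - u L z" unfolding \<delta>_def using that F by (intro Min_le) auto
    then have "u L z + \<delta> \<le> u L z + (1 - u L z)" by (rule add_left_mono)
    also have "\<dots> = 1" using u_le[of L z] by (simp add: add_diff_inverse_ennreal)
    finally show ?thesis .
  qed
  define c where "c = b / \<delta>"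
  have c: "c < \<infinity>" "c * \<delta> = b"
  proof -
    have "\<delta> \<noteq> 0" "\<delta> \<noteq> top" using \<delta> by (auto simp: top_unique)
    moreover from this have "c \<noteq> top" using b by (auto simp: c_def ennreal_divide_eq_top_iff)
    ultimately show "c < \<infinity>" "c * \<delta> = b"
      by (auto simp: c_def less_top[symmetric] ennreal_divide_times mult_divide_eq_ennreal)
  qed
  define \<phi> where "\<phi> z = (\<Sum>i<L. u i z)" for z
  have \<phi>_le: "\<phi> z \<le> of_nat L" for z
    unfolding \<phi>_def using sum_bounded_above[of "{..<L}" "\<lambda>i. u i z" 1] u_le by simp
  have T\<phi>: "taboo P x \<phi> z + 1 = \<phi> z + u L z" for z
  proof -
    have "taboo P x \<phi> z + 1 = (\<Sum>i<L. u (Suc i) z) + u 0 z"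
      unfolding \<phi>_def taboo_sum u_Suc by (simp add: u_def)
    also have "\<dots> = (\<Sum>i<Suc L. u i z)"
      by (simp only: sum.lessThan_Suc_shift add.commute)
    also have "\<dots> = \<phi> z + u L z"
      by (simp add: \<phi>_def)
    finally show ?thesis .
  qed
  have T\<phi>_drift: "taboo P x \<phi> z + \<delta> * indicator F z \<le> \<phi> z" if "z \<in> S" for z
  proof (cases "z \<in> F")
    case True
    have "u L z + (taboo P x \<phi> z + \<delta>) \<le> taboo P x \<phi> z + 1"
      using \<delta>'[OF True that] by (metis add.assoc add.commute add_left_mono)
    also have "\<dots> = u L z + \<phi> z" by (subst T\<phi>) (rule add.commute)
    finally have "taboo P x \<phi> z + \<delta> \<le> \<phi> z"
      using u_le[of L z] by (subst (asm) ennreal_add_left_cancel_le) (auto simp: top_unique)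
    then show ?thesis using True by simp
  next
    case False
    have "taboo P x \<phi> z + 1 \<le> \<phi> z + 1" unfolding T\<phi> using u_le by (intro add_left_mono)
    then have "taboo P x \<phi> z \<le> \<phi> z"
      by (simp add: add.commute[of _ 1] ennreal_add_left_cancel_le)
    then show ?thesis using False by simp
  qed
  define W where "W z = V z + c * \<phi> z" for z
  have W: "1 + taboo P x W z \<le> W z" if z: "z \<in> S" for z
  proof -
    have "1 + taboo P x W z = (taboo P x V z + 1) + c * taboo P x \<phi> z"
      unfolding W_def taboo_add taboo_cmult by (simp add: ac_simps)
    also have "\<dots> \<le> (V z + b * indicator F z) + c * taboo P x \<phi> z"
      using drift[OF z] taboo_le[of P x V z] by (intro add_right_mono) (meson add_right_mono order_trans)
    also have "\<dots> = V z + c * (taboo P x \<phi> z + \<delta> * indicator F z)"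
      by (simp add: distrib_left c(2)[symmetric] ac_simps)
    also have "\<dots> \<le> W z"
      unfolding W_def using T\<phi>_drift[OF z] by (intro add_left_mono mult_left_mono) auto
    finally show ?thesis .
  qed
  have "(\<Sum>i<n. u i z) \<le> W z" if "z \<in> S" for n z
    using that
  proof (induction n arbitrary: z)
    case (Suc n)
    have "(\<Sum>i<Suc n. u i z) = 1 + (\<Sum>i<n. u (Suc i) z)"
      unfolding sum.lessThan_Suc_shift by (simp add: u_def)
    also have "(\<Sum>i<n. u (Suc i) z) = taboo P x (\<lambda>z. \<Sum>i<n. u i z) z"
      unfolding taboo_sum u_Suc ..
    also have "\<dots> \<le> taboo P x W z"
      using Suc closed by (intro taboo_mono[where S=S]) auto
    also have "1 + \<dots> \<le> W z" by (rule W[OF Suc.prems])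
    finally show ?case by (simp add: add_left_mono)
  qed simp
  then have "(\<Sum>n. u n x) \<le> W x"
    using x by (intro suminf_le_const) auto
  also have "\<dots> < \<infinity>"
  proof -
    have "c * \<phi> x \<le> c * of_nat L" by (intro mult_left_mono \<phi>_le) auto
    also have "\<dots> < \<infinity>" using c(1) by (simp add: ennreal_mult_less_top of_nat_less_top)
    finally show ?thesis using V[OF x] by (simp add: W_def)
  qed
  finally show ?thesis by (simp add: u_def)
qed

section \<open>Invariant distributions\<close>

text \<open>
  The cycle formula: the expected number of visits to \<open>y\<close> before the return to \<open>x\<close>, divided by the
  mean return time \<open>Z\<close>. The functional \<open>\<Gamma>\<close> is the expected sum of \<open>h\<close> over one cycle; letting
  the chain make one more step only shifts the cycle by one, since the cycle starts and ends in \<open>x\<close>.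
\<close>

lemma invariant_pmf_exists:
  fixes P :: "'s::countable \<Rightarrow> 's pmf"
  assumes fin: "(\<Sum>n. avoid P x n x) < \<infinity>"
  obtains p where "bind_pmf p P = p" "x \<in> set_pmf p" "\<And>y. y \<in> set_pmf p \<Longrightarrow> \<exists>n. y \<in> set_pmf (kpow P n x)"
proof -
  let ?T = "taboo P x"
  define \<Gamma> where "\<Gamma> h = (\<Sum>n. (?T ^^ n) h x)" for h
  define Z where "Z = \<Gamma> (\<lambda>_. 1)"
  have \<Gamma>_mono: "f \<le> g \<Longrightarrow> \<Gamma> f \<le> \<Gamma> g" for f g
    unfolding \<Gamma>_def
  proof (intro suminf_le)
    fix n assume "f \<le> g"
    then have "(?T ^^ n) f \<le> (?T ^^ n) g" by (induction n) (auto intro: taboo_mono')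
    then show "(?T ^^ n) f x \<le> (?T ^^ n) g x" by (simp add: le_fun_def)
  qed auto
  have Tn_add: "(?T ^^ n) (\<lambda>y. f y + g y) = (\<lambda>z. (?T ^^ n) f z + (?T ^^ n) g z)" for n f g
    proof (induction n)
    case (Suc n)
    show ?case by (rule ext) (simp add: Suc taboo_add)
  qed simp
  have Tn_cmult: "(?T ^^ n) (\<lambda>y. c * f y) = (\<lambda>z. c * (?T ^^ n) f z)" for n f c
    proof (induction n)
    case (Suc n)
    show ?case by (rule ext) (simp add: Suc taboo_cmult)
  qed simp
  have \<Gamma>_add: "\<Gamma> (\<lambda>y. f y + g y) = \<Gamma> f + \<Gamma> g" for f g
    unfolding \<Gamma>_def Tn_add by (simp add: suminf_add)
  have \<Gamma>_cmult: "\<Gamma> (\<lambda>y. c * f y) = c * \<Gamma> f" for f c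
    unfolding \<Gamma>_def Tn_cmult by (simp add: ennreal_suminf_cmult)
  have \<Gamma>_T: "h x + \<Gamma> (?T h) = \<Gamma> h" for h
    unfolding \<Gamma>_def
    by (subst (2) suminf_offset[of _ 1]) (auto simp: funpow_Suc_right simp del: funpow.simps)
  have \<Gamma>_ge: "h x \<le> \<Gamma> h" for h
    using \<Gamma>_T[of h] le_iff_add by metis
  have Z: "1 \<le> Z" "Z < \<infinity>"
    using fin \<Gamma>_ge[of "\<lambda>_. 1"] unfolding Z_def by (simp_all add: \<Gamma>_def)
  have recurrent: "\<Gamma> (\<lambda>z. ennreal (pmf (P z) x)) = 1"
  proof -
    have "(\<lambda>z. 1) = (\<lambda>z. ?T (\<lambda>_. 1) z + ennreal (pmf (P z) x))"
      using integral_eq_taboo[of P _ "\<lambda>_. 1" x] by (auto simp: fun_eq_iff)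
    then have "Z = \<Gamma> (?T (\<lambda>_. 1)) + \<Gamma> (\<lambda>z. ennreal (pmf (P z) x))"
      unfolding Z_def by (simp only: \<Gamma>_add[symmetric])
    moreover have "1 + \<Gamma> (?T (\<lambda>_. 1)) = Z" unfolding Z_def by (rule \<Gamma>_T)
    ultimately have eq: "\<Gamma> (?T (\<lambda>_. 1)) + \<Gamma> (\<lambda>z. ennreal (pmf (P z) x)) = \<Gamma> (?T (\<lambda>_. 1)) + 1"
      by (simp add: add.commute)
    moreover have "\<Gamma> (?T (\<lambda>_. 1)) \<noteq> \<infinity>"
      using \<open>1 + \<Gamma> (?T (\<lambda>_. 1)) = Z\<close> Z by auto
    ultimately show ?thesis by (simp add: ennreal_add_left_cancel)
  qed
  have invariant: "\<Gamma> (\<lambda>z. \<integral>\<^sup>+ y. h y \<partial>measure_pmf (P z)) = \<Gamma> h" for h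
  proof -
    have "\<Gamma> (\<lambda>z. \<integral>\<^sup>+ y. h y \<partial>measure_pmf (P z)) = \<Gamma> (?T h) + h x * \<Gamma> (\<lambda>z. ennreal (pmf (P z) x))"
      unfolding integral_eq_taboo[of P _ h x] \<Gamma>_add \<Gamma>_cmult ..
    then show ?thesis using \<Gamma>_T[of h] by (simp add: recurrent add.commute)
  qed
  have decomp: "\<Gamma> h = (\<integral>\<^sup>+ y. h y * \<Gamma> (indicator {y}) \<partial>count_space UNIV)" for h
  proof -
    have "(?T ^^ n) h z = (\<integral>\<^sup>+ y. h y * (?T ^^ n) (indicator {y}) z \<partial>count_space UNIV)" for n z
    proof (induction n arbitrary: z)
      case 0
      have "(\<integral>\<^sup>+ y. h y * indicator {y} z \<partial>count_space UNIV) = (\<integral>\<^sup>+ y. h z * indicator {z} y \<partial>count_space UNIV)"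
        by (intro nn_integral_cong) (auto simp: indicator_def)
      also have "\<dots> = h z"
        by (simp add: nn_integral_cmult one_ennreal_def[symmetric])
      finally show ?case by simp
    next
      case (Suc n)
      interpret pair_sigma_finite "measure_pmf (P z)" "count_space UNIV :: 's measure"
        by (intro pair_sigma_finite.intro prob_space_imp_sigma_finite prob_space_measure_pmf
            sigma_finite_measure_count_space)
      have m: "f \<in> borel_measurable (measure_pmf (P z) \<Otimes>\<^sub>M count_space UNIV)" for f :: "'s \<times> 's \<Rightarrow> ennreal"
        by (subst measurable_cong_sets[OF sets_pair_measure_cong[OF sets_measure_pmf_count_space refl] refl])
           (simp add: pair_measure_countable)
      have "(?T ^^ Suc n) h z = (\<integral>\<^sup>+ w. \<integral>\<^sup>+ y. indicator (- {x}) w * (h y * (?T ^^ n) (indicator {y}) w) \<partial>count_space UNIV \<partial>measure_pmf (P z))"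
        by (simp add: taboo_def[of P x _ z] Suc nn_integral_cmult)
      also have "\<dots> = (\<integral>\<^sup>+ y. \<integral>\<^sup>+ w. indicator (- {x}) w * (h y * (?T ^^ n) (indicator {y}) w) \<partial>measure_pmf (P z) \<partial>count_space UNIV)"
        by (rule Fubini'[symmetric]) (rule m)
      also have "\<dots> = (\<integral>\<^sup>+ y. h y * (?T ^^ Suc n) (indicator {y}) z \<partial>count_space UNIV)"
        by (intro nn_integral_cong) (simp add: taboo_def[of P x _ z] mult.left_commute nn_integral_cmult)
      finally show ?case .
    qed
    then have "\<Gamma> h = (\<Sum>n. \<integral>\<^sup>+ y. h y * (?T ^^ n) (indicator {y}) x \<partial>count_space UNIV)"
      unfolding \<Gamma>_def by simp
    also have "\<dots> = (\<integral>\<^sup>+ y. (\<Sum>n. h y * (?T ^^ n) (indicator {y}) x) \<partial>count_space UNIV)"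
      by (rule nn_integral_suminf[symmetric]) simp
    finally show ?thesis by (simp add: \<Gamma>_def ennreal_suminf_cmult)
  qed
  have \<Gamma>_le: "\<Gamma> (indicator {y}) \<le> Z" for y
    unfolding Z_def by (intro \<Gamma>_mono) (auto simp: le_fun_def indicator_def)
  define p where "p y = enn2real (\<Gamma> (indicator {y}) / Z)" for y
  have p: "ennreal (p y) = \<Gamma> (indicator {y}) / Z" for y
  proof -
    have "\<Gamma> (indicator {y}) / Z \<noteq> top"
      using \<Gamma>_le[of y] Z by (auto simp: ennreal_divide_eq_top_iff top_unique)
    then show ?thesis unfolding p_def by (intro ennreal_enn2real) (simp add: less_top)
  qed
  have p1: "(\<integral>\<^sup>+ y. ennreal (p y) \<partial>count_space UNIV) = 1"
  proof -
    have "(\<integral>\<^sup>+ y. ennreal (p y) \<partial>count_space UNIV) = (\<integral>\<^sup>+ y. 1 * \<Gamma> (indicator {y}) \<partial>count_space UNIV) / Z"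
      unfolding p by (simp add: nn_integral_divide)
    also have "\<dots> = 1"
      unfolding decomp[of "\<lambda>_. 1", symmetric] Z_def[symmetric] using Z by (auto intro!: ennreal_divide_self)
    finally show ?thesis .
  qed
  have pe: "pmf (embed_pmf p) y = p y" for y
    using p1 by (intro pmf_embed_pmf) (auto simp: p_def)
  have inte: "(\<integral>\<^sup>+ y. h y \<partial>measure_pmf (embed_pmf p)) = \<Gamma> h / Z" for h
  proof -
    have "(\<integral>\<^sup>+ y. h y \<partial>measure_pmf (embed_pmf p)) = (\<integral>\<^sup>+ y. (h y * \<Gamma> (indicator {y})) / Z \<partial>count_space UNIV)"
      by (simp add: nn_integral_measure_pmf pe p divide_ennreal_def ac_simps)
    then show ?thesis by (simp add: nn_integral_divide decomp[of h])
  qed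
  show thesis
  proof
    show "bind_pmf (embed_pmf p) P = embed_pmf p"
    proof (rule pmf_eqI)
      fix y
      have "ennreal (pmf (bind_pmf (embed_pmf p) P) y) = \<Gamma> (\<lambda>z. \<integral>\<^sup>+ w. indicator {y} w \<partial>measure_pmf (P z)) / Z"
        by (simp add: ennreal_pmf_bind inte emeasure_pmf_single)
      also have "\<dots> = ennreal (pmf (embed_pmf p) y)"
        unfolding invariant pe p ..
      finally show "pmf (bind_pmf (embed_pmf p) P) y = pmf (embed_pmf p) y" by simp
    qed
    have "1 \<le> \<Gamma> (indicator {x})"
      using \<Gamma>_ge[of "indicator {x}"] by simp
    then have "\<Gamma> (indicator {x}) / Z \<noteq> 0" using Z by (auto simp: ennreal_divide_eq_0_iff)
    then have "p x \<noteq> 0" using p[of x] by auto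
    then show "x \<in> set_pmf (embed_pmf p)" by (simp add: set_pmf_iff pe)
    fix y assume "y \<in> set_pmf (embed_pmf p)"
    then have "p y \<noteq> 0" by (simp add: set_pmf_iff pe)
    moreover have "0 \<le> p y" by (simp add: p_def)
    ultimately have "\<Gamma> (indicator {y}) \<noteq> 0" using p[of y] by auto
    then obtain n where n: "(?T ^^ n) (indicator {y}) x \<noteq> 0"
      unfolding \<Gamma>_def by (auto simp: suminf_eq_zero_iff)
    have "(?T ^^ n) h z \<le> (\<integral>\<^sup>+ w. h w \<partial>measure_pmf (kpow P n z))" for n h z
    proof (induction n arbitrary: z)
      case (Suc n)
      have "(?T ^^ Suc n) h z \<le> (\<integral>\<^sup>+ y. (?T ^^ n) h y \<partial>measure_pmf (P z))"
        by (simp add: taboo_le)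
      also have "\<dots> \<le> (\<integral>\<^sup>+ y. (\<integral>\<^sup>+ w. h w \<partial>measure_pmf (kpow P n y)) \<partial>measure_pmf (P z))"
        by (intro nn_integral_mono Suc)
      finally show ?case by simp
    qed simp
    from this[of n "indicator {y}" x] n have "pmf (kpow P n x) y \<noteq> 0"
      by (auto simp: emeasure_pmf_single)
    then show "\<exists>n. y \<in> set_pmf (kpow P n x)" by (auto simp: set_pmf_iff)
  qed
qed

section \<open>Convergence to the invariant distribution\<close>

lemma finite_approx_pmf:
  fixes p :: "'s pmf"
  assumes "0 < (e::real)"
  obtains C where "finite C" "C \<subseteq> set_pmf p" "measure_pmf.prob p (- C) \<le> e"
proof -
  have "(\<lambda>n. measure_pmf.prob p (from_nat_into (set_pmf p) ` {..n})) \<longlonglongrightarrow>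
      measure_pmf.prob p (\<Union>n. from_nat_into (set_pmf p) ` {..n})"
    by (intro measure_pmf.finite_Lim_measure_incseq) (auto simp: incseq_def)
  moreover have "(\<Union>n. from_nat_into (set_pmf p) ` {..n}) = set_pmf p"
    (is "?U = _")
  proof
    show "?U \<subseteq> set_pmf p" using from_nat_into[OF set_pmf_not_empty[of p]] by auto
    show "set_pmf p \<subseteq> ?U"
    proof
      fix x assume "x \<in> set_pmf p"
      then have "x = from_nat_into (set_pmf p) (to_nat_on (set_pmf p) x)" by simp
      then show "x \<in> ?U" by blast
    qed
  qed
  ultimately have "(\<lambda>n. measure_pmf.prob p (from_nat_into (set_pmf p) ` {..n})) \<longlonglongrightarrow> 1"
    using measure_Int_set_pmf[of p UNIV] by simp
  then have "\<forall>\<^sub>F n in sequentially. 1 - e < measure_pmf.prob p (from_nat_into (set_pmf p) ` {..n})"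
    using assms by (intro order_tendstoD) auto
  then obtain n where n: "1 - e < measure_pmf.prob p (from_nat_into (set_pmf p) ` {..n})"
    by (auto simp: eventually_sequentially)
  show thesis
  proof
    show "from_nat_into (set_pmf p) ` {..n} \<subseteq> set_pmf p"
      using from_nat_into[OF set_pmf_not_empty[of p]] by auto
    show "measure_pmf.prob p (- (from_nat_into (set_pmf p) ` {..n})) \<le> e"
      using n measure_pmf.prob_compl[of "from_nat_into (set_pmf p) ` {..n}" p]
      by (simp add: Compl_eq_Diff_UNIV)
  qed simp
qed

lemma integrable_pmf_bounded:
  fixes f :: "'s \<Rightarrow> real"
  assumes "\<And>z. \<bar>f z\<bar> \<le> B" shows "integrable (measure_pmf p) f"
  by (intro measure_pmf.integrable_const_bound[of _ B]) (use assms in auto)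

lemma abs_expectation_le:
  fixes f :: "'s \<Rightarrow> real"
  assumes "\<And>z. \<bar>f z\<bar> \<le> B" shows "\<bar>expect p f\<bar> \<le> B"
proof -
  have "\<bar>expect p f\<bar> \<le> expect p (\<lambda>z. \<bar>f z\<bar>)"
    by (rule integral_abs_bound)
  also have "\<dots> \<le> expect p (\<lambda>_. B)"
    using assms order_trans[OF abs_ge_zero assms]
    by (intro integral_mono integrable_pmf_bounded[where B=B]) auto
  finally show ?thesis by simp
qed

lemma expectation_bind_bounded:
  fixes f :: "'s \<Rightarrow> real"
  assumes "\<And>z. \<bar>f z\<bar> \<le> B"
  shows "expect (bind_pmf p q) f = expect p (\<lambda>x. expect (q x) f)"
  unfolding measure_pmf_bind
  by (rule integral_bind[where K="count_space UNIV" and B=B and B'=1])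
     (use assms in \<open>auto simp: space_subprob_algebra prob_space_imp_subprob_space prob_space_measure_pmf\<close>)

text \<open>
  Let \<open>a\<^sub>n z\<close> be the error at time \<open>n\<close> for the starting state \<open>z\<close>, a function of mean zero under \<open>p\<close>.
  By invariance its \<open>L\<^sup>1(p)\<close> norm \<open>l\<^sub>n\<close> does not increase. While \<open>l\<^sub>n\<close> stays above a positive
  bound, the positive and the negative part of \<open>a\<^sub>n\<close> both have substantial mass on a fixed finite
  set \<open>C\<close>. All of \<open>C\<close> is reached from \<open>y0\<close> in one and the same number \<open>m\<close> of steps, so
  there is a definite cancellation at \<open>y0\<close>, and \<open>l\<close> drops by a fixed amount every \<open>m\<close> steps. Hence
  \<open>l\<^sub>n\<close> tends to 0, and so does \<open>a\<^sub>n x\<close> at each point \<open>x\<close> of positive mass.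
\<close>

theorem kpow_converges:
  fixes P :: "'s \<Rightarrow> 's pmf" and f :: "'s \<Rightarrow> real"
  assumes inv: "bind_pmf p P = p" and y0: "y0 \<in> set_pmf p"
    and reach: "\<And>C. finite C \<Longrightarrow> C \<subseteq> set_pmf p \<Longrightarrow> \<exists>m. C \<subseteq> set_pmf (kpow P m y0)"
    and bd: "\<And>z. \<bar>f z\<bar> \<le> B" and x: "x \<in> set_pmf p"
  shows "(\<lambda>n. expect (kpow P n x) f) \<longlonglongrightarrow> expect p f"
proof -
  let ?E = "expect"
  define B' where "B' = B + B"
  have B: "0 \<le> B" using bd[of x] by linarith
  define a where "a n z = ?E (kpow P n z) f - ?E p f" for n z
  have a_bd: "\<bar>a n z\<bar> \<le> B'" for n z
    using abs_expectation_le[of f B "kpow P n z", OF bd] abs_expectation_le[of f B p, OF bd]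
    unfolding a_def B'_def by linarith
  note int = integrable_pmf_bounded[where B=B']
  have a_int: "integrable (measure_pmf q) (a n)" "integrable (measure_pmf q) (\<lambda>z. \<bar>a n z\<bar>)" for q n
    by (auto intro!: int a_bd)
  have a_add: "a (m + n) z = ?E (kpow P m z) (a n)" for m n z
  proof -
    have "integrable (measure_pmf (kpow P m z)) (\<lambda>z. ?E (kpow P n z) f)"
      by (rule integrable_pmf_bounded[where B=B]) (rule abs_expectation_le[OF bd])
    then show ?thesis
      unfolding a_def kpow_add
      by (subst expectation_bind_bounded[of f B, OF bd]) simp
  qed
  have Ea: "?E p (a n) = 0" for n
  proof -
    have "?E p f = ?E p (\<lambda>z. ?E (kpow P n z) f)"
      by (subst bind_kpow[OF inv, of n, symmetric], subst expectation_bind_bounded[of f B]) (auto intro: bd)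
    then show ?thesis
      unfolding a_def
      by (subst Bochner_Integration.integral_diff)
         (auto intro!: integrable_pmf_bounded[where B=B] abs_expectation_le bd)
  qed
  define l where "l n = ?E p (\<lambda>z. \<bar>a n z\<bar>)" for n
  have l_shift: "l n = ?E p (\<lambda>z. ?E (kpow P m z) (\<lambda>w. \<bar>a n w\<bar>))" for n m
    unfolding l_def
    by (subst bind_kpow[OF inv, of m, symmetric], subst expectation_bind_bounded[of _ B'])
       (auto intro: a_bd)
  have l_nonneg: "0 \<le> l n" for n unfolding l_def by simp
  have Eint: "integrable (measure_pmf p) (\<lambda>z. ?E (kpow P m z) (\<lambda>w. \<bar>a n w\<bar>))" for m n
    by (intro int abs_expectation_le) (simp add: a_bd)
  have l_add: "l (m + n) \<le> l n" for m n
    unfolding l_shift[of n m] unfolding l_def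
    by (intro integral_mono a_int Eint) (simp add: a_add)
  have small: "\<exists>n. l n < 2 * \<eta>" if \<eta>: "0 < \<eta>" for \<eta>
  proof (rule ccontr)
    assume "\<nexists>n. l n < 2 * \<eta>"
    then have big: "2 * \<eta> \<le> l n" for n by (auto simp: not_less)
    have B': "0 < B'"
      using big[of 0] abs_expectation_le[of "\<lambda>z. \<bar>a 0 z\<bar>" B' p] a_bd \<eta> unfolding l_def by fastforce
    \<comment> \<open>Outside \<open>C\<close> a function bounded by \<open>B'\<close> has mean at most \<open>\<eta> / 2\<close>.\<close>
    have "0 < \<eta> / (2 * B')" using \<eta> B' by simp
    from finite_approx_pmf[OF this, of p] obtain C where
      C: "finite C" "C \<subseteq> set_pmf p" "measure_pmf.prob p (- C) \<le> \<eta> / (2 * B')" by blast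
    from reach[OF C(1,2)] obtain m where m: "C \<subseteq> set_pmf (kpow P m y0)" ..
    let ?q = "kpow P m y0"
    define \<epsilon> where "\<epsilon> = Min (insert 1 (pmf ?q ` C))"
    have \<epsilon>: "0 < \<epsilon>" "\<And>z. z \<in> C \<Longrightarrow> \<epsilon> \<le> pmf ?q z"
      unfolding \<epsilon>_def using C(1) m by (auto simp: Min_gr_iff pmf_positive_iff)
    have half: "\<epsilon> * (\<eta> / 2) \<le> ?E ?q g"
      if g: "\<And>z. 0 \<le> g z" "\<And>z. g z \<le> B'" "\<eta> \<le> ?E p g" for g
    proof -
      have gB: "\<bar>g z\<bar> \<le> B'" for z using g(1,2)[of z] by simp
      have gi: "\<bar>indicator C z * g z\<bar> \<le> B'" for z using gB[of z] B' by (auto simp: indicator_def)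
      have fin: "?E q (\<lambda>z. indicator C z * g z) = (\<Sum>z\<in>C. pmf q z * g z)" for q
      proof -
        have "?E q (\<lambda>z. indicator C z * g z) = (\<Sum>z\<in>C. indicator C z * g z * pmf q z)"
          by (rule integral_measure_pmf_real) (use C in \<open>auto simp: indicator_def split: if_splits\<close>)
        then show ?thesis by (simp add: mult.commute)
      qed
      have "?E p g = ?E p (\<lambda>z. indicator C z * g z) + ?E p (\<lambda>z. indicator (- C) z * g z)"
        by (subst Bochner_Integration.integral_add[symmetric])
           (auto intro!: int gB gi Bochner_Integration.integral_cong simp: indicator_def B' less_imp_le)
      also have "?E p (\<lambda>z. indicator (- C) z * g z) \<le> ?E p (\<lambda>z. B' * indicator (- C) z)"
        by (intro integral_mono int) (use g gB B' in \<open>auto simp: indicator_def\<close>)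
      also have "\<dots> \<le> \<eta> / 2"
        using C(3) B' by (simp add: field_simps)
      finally have "\<eta> / 2 \<le> ?E p (\<lambda>z. indicator C z * g z)" using g(3) by simp
      also have "\<dots> \<le> (\<Sum>z\<in>C. 1 * g z)"
        unfolding fin by (intro sum_mono mult_right_mono g pmf_le_1)
      finally have "\<epsilon> * (\<eta> / 2) \<le> \<epsilon> * (\<Sum>z\<in>C. g z)" using \<epsilon>(1) by simp
      also have "\<dots> \<le> (\<Sum>z\<in>C. pmf ?q z * g z)"
        unfolding sum_distrib_left by (intro sum_mono mult_right_mono g \<epsilon>)
      also have "\<dots> = ?E ?q (\<lambda>z. indicator C z * g z)" by (rule fin[symmetric])
      also have "\<dots> \<le> ?E ?q g"
        using g by (intro integral_mono int gB gi) (auto simp: indicator_def)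
      finally show ?thesis .
    qed
    have drop: "\<bar>a (m + n) y0\<bar> \<le> ?E ?q (\<lambda>w. \<bar>a n w\<bar>) - \<epsilon> * \<eta>" for n
    proof -
      define u where "u z = max (a n z) 0" for z
      define v where "v z = max (- a n z) 0" for z
      have uv: "a n z = u z - v z" "\<bar>a n z\<bar> = u z + v z" "0 \<le> u z" "0 \<le> v z" "u z \<le> B'" "v z \<le> B'" for z
        using a_bd[of n z] B' by (auto simp: u_def v_def)
      have uvi: "integrable (measure_pmf q) u" "integrable (measure_pmf q) v" for q
        using uv by (auto intro!: int)
      have "?E p u - ?E p v = 0" using Ea[of n] unfolding uv(1) using uvi by simp
      moreover have "2 * \<eta> \<le> ?E p u + ?E p v" using big[of n] unfolding l_def uv(2) using uvi by simp
      ultimately have "\<eta> \<le> ?E p u" "\<eta> \<le> ?E p v" by simp_all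
      then have "\<epsilon> * (\<eta> / 2) \<le> ?E ?q u" "\<epsilon> * (\<eta> / 2) \<le> ?E ?q v"
        using half[of u, OF uv(3,5)] half[of v, OF uv(4,6)] by simp_all
      moreover have "?E ?q (a n) = ?E ?q u - ?E ?q v"
      proof -
        have "a n = (\<lambda>z. u z - v z)" using uv(1) by auto
        then show ?thesis using uvi by simp
      qed
      moreover have "?E ?q (\<lambda>w. \<bar>a n w\<bar>) = ?E ?q u + ?E ?q v"
        unfolding uv(2) using uvi by simp
      ultimately show ?thesis unfolding a_add by (simp add: abs_le_iff)
    qed
    define \<delta> where "\<delta> = pmf p y0 * (\<epsilon> * \<eta>)"
    have \<delta>: "0 < \<delta>" using y0 \<epsilon> \<eta> by (simp add: \<delta>_def pmf_positive_iff)
    have ind: "integrable (measure_pmf q) (\<lambda>z. (\<epsilon> * \<eta>) * indicator {y0} z)" for q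
      using \<epsilon> \<eta> by (intro integrable_pmf_bounded[where B="\<epsilon> * \<eta>"]) (auto simp: indicator_def)
    have step: "l (m + n) \<le> l n - \<delta>" for n
    proof -
      have "l (m + n) \<le> ?E p (\<lambda>z. ?E (kpow P m z) (\<lambda>w. \<bar>a n w\<bar>) - (\<epsilon> * \<eta>) * indicator {y0} z)"
        unfolding l_def
      proof (intro integral_mono a_int Bochner_Integration.integrable_diff Eint)
        fix z show "\<bar>a (m + n) z\<bar> \<le> ?E (kpow P m z) (\<lambda>w. \<bar>a n w\<bar>) - (\<epsilon> * \<eta>) * indicator {y0} z"
          using drop[of n] by (cases "z = y0") (auto simp: a_add)
      qed (rule ind)
      also have "\<dots> = l n - \<delta>"
        unfolding l_shift[of n m]
        by (subst Bochner_Integration.integral_diff, rule Eint, rule ind) (simp add: \<delta>_def measure_pmf_single)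
      finally show ?thesis .
    qed
    have "l (j * m) \<le> l 0 - of_nat j * \<delta>" for j
    proof (induction j)
      case (Suc j)
      then show ?case using step[of "j * m"] by (simp add: algebra_simps)
    qed simp
    moreover obtain j where "l 0 < of_nat j * \<delta>" using \<delta> reals_Archimedean3 by blast
    ultimately show False using l_nonneg[of "j * m"] by (smt (verit))
  qed
  have "l \<longlonglongrightarrow> 0"
  proof (rule LIMSEQ_I)
    fix r :: real assume "0 < r"
    then obtain n where "l n < 2 * (r / 2)" using small[of "r / 2"] by auto
    then have "norm (l k - 0) < r" if "n \<le> k" for k
      using l_add[of "k - n" n] l_nonneg[of k] that by simp
    then show "\<exists>n. \<forall>k\<ge>n. norm (l k - 0) < r" by blast
  qed
  have al: "\<bar>a n x\<bar> \<le> l n / pmf p x" for n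
  proof -
    have "pmf p x * \<bar>a n x\<bar> = ?E p (\<lambda>z. \<bar>a n x\<bar> * indicator {x} z)"
      by (simp add: measure_pmf_single)
    also have "\<dots> \<le> l n"
      unfolding l_def
      by (intro integral_mono a_int int) (auto simp: indicator_def a_bd order_trans[OF abs_ge_zero a_bd])
    finally show ?thesis using x by (simp add: field_simps pmf_positive_iff)
  qed
  have "(\<lambda>n. a n x) \<longlonglongrightarrow> 0"
  proof (rule Lim_null_comparison)
    show "(\<lambda>n. l n / pmf p x) \<longlonglongrightarrow> 0" by (rule tendsto_divide_zero) fact
    show "\<forall>\<^sub>F n in sequentially. norm (a n x) \<le> l n / pmf p x" using al by simp
  qed
  then show ?thesis
    by (simp add: a_def LIM_zero_iff)
qed

section \<open>Non-backtracking walks on non-bipartite regular graphs\<close>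

locale nonbipartite_regular_graph =
  fixes adj :: "'v::finite \<Rightarrow> 'v \<Rightarrow> bool" and k :: nat
  assumes simple: "simple_graph adj" and regular: "regular_graph adj k" and k: "3 \<le> k"
    and connected: "connected_graph adj" and aperiodic: "aperiodic_graph adj"
begin

abbreviation "E \<equiv> directed_edges adj"
abbreviation "B \<equiv> nbrw_step adj"

definition succs :: "'v \<times> 'v \<Rightarrow> ('v \<times> 'v) set" where
  "succs e = {(v, w). v = snd e \<and> adj v w \<and> w \<noteq> fst e}"

definition preds :: "'v \<times> 'v \<Rightarrow> ('v \<times> 'v) set" where
  "preds e = {(u, v). v = fst e \<and> adj u v \<and> u \<noteq> snd e}"

lemma adj_sym: "adj u v \<Longrightarrow> adj v u"
  using simple by (auto simp: simple_graph_def dest: sympD)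

lemma card_neighbours: "card {w. adj v w} = k"
  using regular by (simp add: regular_graph_def)

lemma card_neighbours': "card {u. adj u v} = k"
  using card_neighbours[of v] adj_sym by (metis (no_types, lifting) Collect_cong)

lemma card_succs: "e \<in> E \<Longrightarrow> card (succs e) = k - 1"
proof -
  assume "e \<in> E"
  then have "fst e \<in> {w. adj (snd e) w}" by (auto simp: directed_edges_def intro: adj_sym)
  moreover have "succs e = Pair (snd e) ` ({w. adj (snd e) w} - {fst e})" by (auto simp: succs_def)
  ultimately show ?thesis by (simp add: card_image inj_on_def card_neighbours)
qed

lemma card_preds: "e \<in> E \<Longrightarrow> card (preds e) = k - 1"
proof -
  assume "e \<in> E"
  then have "snd e \<in> {w. adj w (fst e)}" by (auto simp: directed_edges_def intro: adj_sym)
  moreover have "preds e = (\<lambda>u. (u, fst e)) ` ({u. adj u (fst e)} - {snd e})" by (auto simp: preds_def)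
  ultimately show ?thesis by (simp add: card_image inj_on_def card_neighbours')
qed

text \<open>
  Degree at least 3 leaves a way out that avoids two given neighbours, so any two edges into a vertex have
  a common successor.
\<close>

lemma third_neighbour: "\<exists>w. adj v w \<and> w \<noteq> a \<and> w \<noteq> b"
proof (rule ccontr)
  assume "\<not> ?thesis"
  then have "{w. adj v w} \<subseteq> {a, b}" by auto
  then have "card {w. adj v w} \<le> card {a, b}" by (intro card_mono) auto
  also have "\<dots> \<le> 2" by (simp add: card_insert_if)
  finally show False using k by (simp add: card_neighbours)
qed

lemma set_step: "set_pmf (B e) = succs e"
proof -
  have "{w. adj (snd e) w \<and> w \<noteq> fst e} \<noteq> {}" using third_neighbour[of "snd e" "fst e" "fst e"] by auto
  then show ?thesis by (auto simp: nbrw_step_def succs_def set_pmf_of_set)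
qed

lemma succs_E: "succs e \<subseteq> E"
  by (auto simp: succs_def directed_edges_def)

lemma in_succs_iff: "f \<in> E \<Longrightarrow> g \<in> E \<Longrightarrow> g \<in> succs f \<longleftrightarrow> f \<in> preds g"
  by (auto simp: succs_def preds_def directed_edges_def)

text \<open>
  Every edge has \<open>k - 1\<close> successors and \<open>k - 1\<close> predecessors. Counting the pairs (edge, successor)
  that start in \<open>S\<close> shows that the set of successors is at least as large as \<open>S\<close>; in the case of
  equality no other edge leads into it.
\<close>

lemma succs_count:
  assumes S: "S \<subseteq> E" and S': "S' = (\<Union>f\<in>S. succs f)"
  shows "card S \<le> card S'" and "card S = card S' \<Longrightarrow> f \<in> E \<Longrightarrow> succs f \<inter> S' \<noteq> {} \<Longrightarrow> f \<in> S"
proof -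
  have S'E: "S' \<subseteq> E" using succs_E unfolding S' by blast
  let ?X = "(\<lambda>(f, g). (g, f)) ` Sigma S succs" and ?Y = "Sigma S' preds"
  have sub: "?X \<subseteq> ?Y" 
  proof clarify
    fix f g assume "f \<in> S" "g \<in> succs f"
    then show "g \<in> S' \<and> f \<in> preds g"
      using S S'E in_succs_iff[of f g] unfolding S' by blast
  qed
  have X: "card ?X = card S * (k - 1)"
    using S by (subst card_image) (auto simp: inj_on_def card_succs subset_iff simp del: split_paired_All)
  have Y: "card ?Y = card S' * (k - 1)"
    using S'E by (auto simp: card_preds subset_iff simp del: split_paired_All)
  have "card ?X \<le> card ?Y" using sub by (intro card_mono) auto
  then show "card S \<le> card S'" using k by (simp add: X Y)
  assume "card S = card S'" "f \<in> E" "succs f \<inter> S' \<noteq> {}"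
  then have "?X = ?Y" using sub X Y by (intro card_subset_eq) auto
  from \<open>succs f \<inter> S' \<noteq> {}\<close> obtain g where g: "g \<in> succs f" "g \<in> S'" by auto
  then have "(g, f) \<in> ?Y" using in_succs_iff[of f g] S'E \<open>f \<in> E\<close> by auto
  then show "f \<in> S" unfolding \<open>?X = ?Y\<close>[symmetric] by auto
qed

lemma closed_set_UNIV:
  assumes "v \<in> A" and "\<And>u w. u \<in> A \<Longrightarrow> adj u w \<Longrightarrow> w \<in> A"
  shows "A = UNIV"
proof -
  have "w \<in> A" if "adj\<^sup>*\<^sup>* v w" for w
    using that by induction (use assms in auto)
  then show ?thesis using connected by (auto simp: connected_graph_def)
qed

lemma not_bipartite: "\<not> (\<forall>u v. adj u v \<longrightarrow> (u \<in> A \<longleftrightarrow> v \<notin> A))"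
proof
  assume A: "\<forall>u v. adj u v \<longrightarrow> (u \<in> A \<longleftrightarrow> v \<notin> A)"
  have par: "(adj ^^ m) u v \<Longrightarrow> (u \<in> A \<longleftrightarrow> v \<in> A) \<longleftrightarrow> even m" for m u v
    by (induction m arbitrary: v) (use A in auto)
  have "2 dvd Gcd {m::nat. 0 < m \<and> (\<exists>v. (adj ^^ m) v v)}"
    by (intro Gcd_greatest) (use par in blast)
  then show False using aperiodic by (simp add: aperiodic_graph_def)
qed

text \<open>
  When the set of edges reached does not grow in two consecutive steps, it consists of all
  edges into some vertex set \<open>A\<close>, because any two edges into a vertex have a common successor.
  One step later it is the set of all edges into the set \<open>A'\<close> of neighbours of \<open>A\<close>, and all neighbours
  of \<open>A'\<close> lie in \<open>A\<close>. By connectedness \<open>A\<close> and \<open>A'\<close> are either disjoint, which would make the graph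
  bipartite, or both contain every vertex.
\<close>

lemma stable_set_UNIV:
  assumes S: "S \<subseteq> E" "S \<noteq> {}" and S': "S' = (\<Union>f\<in>S. succs f)" and S2: "S2 = (\<Union>f\<in>S'. succs f)"
    and c: "card S = card S'" "card S' = card S2"
  shows "S = E"
proof -
  have S'E: "S' \<subseteq> E" using succs_E unfolding S' by blast
  have full: "(x, v) \<in> T" if T: "T \<subseteq> E" "card T = card (\<Union>f\<in>T. succs f)" "(u, v) \<in> T" "adj x v" for T u x v
  proof -
    obtain w where "adj v w" "w \<noteq> u" "w \<noteq> x" using third_neighbour by blast
    then have "(v, w) \<in> succs (u, v)" "(v, w) \<in> succs (x, v)" by (auto simp: succs_def)
    then show ?thesis
      using succs_count(2)[OF T(1) refl T(2), of "(x, v)"] T(3,4) by (auto simp: directed_edges_def)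
  qed
  define A where "A = snd ` S"
  define A' where "A' = {w. \<exists>v\<in>A. adj v w}"
  have S_in: "(x, v) \<in> S" if "v \<in> A" "adj x v" for x v
    using full[of S] S(1) c(1) that unfolding S' A_def by force
  have out: "v \<in> A" if "(v, w) \<in> S'" for v w
    using that unfolding S' A_def by (force simp: succs_def)
  have S'_out: "(v, w) \<in> S'" if "v \<in> A" "adj v w" for v w
  proof -
    obtain x where "adj v x" "x \<noteq> w" using third_neighbour[of v w w] by blast
    then have "(x, v) \<in> S" "(v, w) \<in> succs (x, v)" using S_in that adj_sym by (auto simp: succs_def)
    then show ?thesis unfolding S' by blast
  qed
  have source_in: "x \<in> A" if w: "w \<in> A'" "adj x w" for x w
  proof -
    obtain v where "v \<in> A" "adj v w" using w(1) unfolding A'_def by blast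
    then have "(v, w) \<in> S'" by (rule S'_out)
    then have "(x, w) \<in> S'" using full[of S' v w x] S'E c(2) w unfolding S2 by blast
    then show ?thesis by (rule out)
  qed
  obtain v0 where v0: "v0 \<in> A" using S(2) by (auto simp: A_def)
  have neighbour_in: "w \<in> A'" if "v \<in> A" "adj v w" for v w
    unfolding A'_def using that by blast
  have cover: "A \<union> A' = UNIV"
    by (rule closed_set_UNIV[of v0]) (use v0 source_in neighbour_in adj_sym in blast)+
  have "A \<inter> A' \<noteq> {}"
  proof
    assume disj: "A \<inter> A' = {}"
    have "u \<in> A \<longleftrightarrow> v \<notin> A" if "adj u v" for u v
      using that cover disj source_in[of v u] neighbour_in[of u v] by blast
    then show False using not_bipartite by blast
  qed
  then obtain v1 where "v1 \<in> A \<inter> A'" by auto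
  then have "A \<inter> A' = UNIV"
    by (rule closed_set_UNIV) (use source_in neighbour_in adj_sym in blast)
  then show "S = E" using S(1) S_in by (auto simp: directed_edges_def)
qed

lemma mono_bounded_nat_stabilises:
  fixes c :: "nat \<Rightarrow> nat"
  assumes "\<And>m. c m \<le> c (Suc m)" "\<And>m. c m \<le> b"
  shows "\<exists>m0. \<forall>m\<ge>m0. c m = c m0"
proof -
  have fin: "finite (range c)" by (rule finite_subset[of _ "{..b}"]) (auto intro: assms(2))
  have "Max (range c) \<in> range c" by (rule Max_in[OF fin]) simp
  then obtain m0 where m0: "c m0 = Max (range c)" by auto
  have "c m = c m0" if "m0 \<le> m" for m
    using lift_Suc_mono_le[of c, OF assms(1) that] Max_ge[OF fin, of "c m"] m0 by simp
  then show ?thesis by blast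
qed

text \<open>
  The number of edges that can be reached in exactly \<open>m\<close> steps is nondecreasing in \<open>m\<close> and
  bounded, hence eventually constant, and then all edges are reached.
\<close>

lemma reach_all:
  assumes e: "e \<in> E"
  shows "\<exists>m0. \<forall>m\<ge>m0. set_pmf (kpow B m e) = E"
proof -
  define R where "R m = set_pmf (kpow B m e)" for m
  have R_Suc: "R (Suc m) = (\<Union>f\<in>R m. succs f)" for m
    using kpow_add[of B m "Suc 0"] by (simp add: R_def kpow_one set_step del: kpow.simps)
  have RE: "R m \<subseteq> E" for m
    unfolding R_def by (rule set_kpow_closed) (use e succs_E in \<open>auto simp: set_step\<close>)
  have ne: "R m \<noteq> {}" for m by (simp add: R_def set_pmf_not_empty)
  obtain m0 where m0: "\<forall>m\<ge>m0. card (R m) = card (R m0)"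
    using mono_bounded_nat_stabilises[of "\<lambda>m. card (R m)" "card E"] succs_count(1)[OF RE R_Suc]
      card_mono[OF finite RE] by blast
  have "R m = E" if "m0 \<le> m" for m
    by (rule stable_set_UNIV[OF RE ne R_Suc R_Suc]) 
      (use m0[rule_format, of m] m0[rule_format, of "Suc m"] m0[rule_format, of "Suc (Suc m)"] that in linarith)+
  then show ?thesis by (auto simp: R_def)
qed

lemma primitive: "\<exists>M. \<forall>m\<ge>M. \<forall>e\<in>E. set_pmf (kpow B m e) = E"
proof -
  obtain m0 where m0: "\<And>e m. e \<in> E \<Longrightarrow> m0 e \<le> m \<Longrightarrow> set_pmf (kpow B m e) = E"
    using reach_all by metis
  have "m0 e \<le> Max (m0 ` E)" if "e \<in> E" for e using that by (intro Max_ge) auto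
  then show ?thesis using m0 by (meson order_trans)
qed

lemma pmf_step: "pmf (B f) g = indicator (succs f) g / real (card (succs f))"
proof -
  let ?W = "{w. adj (snd f) w \<and> w \<noteq> fst f}"
  have ne: "?W \<noteq> {}" using third_neighbour[of "snd f" "fst f" "fst f"] by auto
  have "B f = pmf_of_set (Pair (snd f) ` ?W)"
    unfolding nbrw_step_def using ne by (intro map_pmf_of_set_inj) (auto simp: inj_on_def)
  also have "Pair (snd f) ` ?W = succs f" by (auto simp: succs_def)
  finally show ?thesis using ne \<open>Pair (snd f) ` ?W = succs f\<close>[symmetric] by simp
qed

lemma E_ne: "E \<noteq> {}"
proof -
  obtain w where "adj undefined w" using third_neighbour by blast
  then show ?thesis by (auto simp: directed_edges_def)
qed

lemma uniform_invariant: "bind_pmf (pmf_of_set E) B = pmf_of_set E"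
proof (rule pmf_eqI)
  fix g
  have "pmf (bind_pmf (pmf_of_set E) B) g = (\<Sum>f\<in>E. indicator (succs f) g / real (k - 1)) / real (card E)"
    using E_ne by (simp add: pmf_bind integral_pmf_of_set pmf_step card_succs)
  also have "(\<Sum>f\<in>E. indicator (succs f) g / real (k - 1)) = (indicator E g :: real)"
  proof (cases "g \<in> E")
    case True
    have "(\<Sum>f\<in>E. indicator (succs f) g / real (k - 1)) = (\<Sum>f\<in>E. indicator (preds g) f / real (k - 1))"
      using True in_succs_iff by (intro sum.cong) (auto simp: indicator_def)
    also have "\<dots> = real (card (E \<inter> preds g)) / real (k - 1)"
      by (simp only: sum_divide_distrib[symmetric]) (simp add: indicator_def)
    also have "E \<inter> preds g = preds g" by (auto simp: preds_def directed_edges_def)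
    finally show ?thesis using True k card_preds by simp
  next
    case False
    then have "g \<notin> succs f" for f using succs_E by blast
    then show ?thesis using False by simp
  qed
  finally show "pmf (bind_pmf (pmf_of_set E) B) g = pmf (pmf_of_set E) g"
    using E_ne by simp
qed

lemma card_E: "card E = CARD('v) * k" and card_E_head: "card {e \<in> E. snd e = v} = k"
proof -
  have "E = Sigma UNIV (\<lambda>v. {w. adj v w})" by (auto simp: directed_edges_def)
  then show "card E = CARD('v) * k" by (simp add: card_SigmaI card_neighbours)
  have "{e \<in> E. snd e = v} = (\<lambda>u. (u, v)) ` {u. adj u v}" by (auto simp: directed_edges_def)
  then show "card {e \<in> E. snd e = v} = k" by (simp add: card_image inj_on_def card_neighbours')
qed

lemma position_converges:
  assumes e: "e \<in> E"
  shows "(\<lambda>m. expect (kpow B m e) (\<lambda>f. of_bool (snd f = v))) \<longlonglongrightarrow> 1 / real CARD('v)"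
proof -
  obtain M where M: "\<forall>m\<ge>M. \<forall>e\<in>E. set_pmf (kpow B m e) = E" using primitive ..
  have "(\<lambda>m. expect (kpow B m e) (\<lambda>f. of_bool (snd f = v)))
      \<longlonglongrightarrow> (expect (pmf_of_set E) (\<lambda>f. of_bool (snd f = v)) :: real)"
  proof (rule kpow_converges[where ?y0.0=e and B=1])
    fix C assume "finite C" "C \<subseteq> set_pmf (pmf_of_set E)"
    moreover have "set_pmf (kpow B M e) = E" using M e by blast
    ultimately show "\<exists>m. C \<subseteq> set_pmf (kpow B m e)" using E_ne by (intro exI[of _ M]) simp
  qed (use e E_ne uniform_invariant in auto)
  also have "expect (pmf_of_set E) (\<lambda>f. of_bool (snd f = v)) =
      real (card {e \<in> E. snd e = v}) / real (card E)"
    using E_ne by (simp add: integral_pmf_of_set sum.If_cases of_bool_def Int_def conj_commute)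
  also have "\<dots> = 1 / real CARD('v)" using k by (simp add: card_E card_E_head)
  finally show ?thesis .
qed

text \<open>
  With \<open>p\<^sub>j v e\<close> the probability of being at \<open>v\<close> after \<open>j\<close> steps from \<open>e\<close>, take \<open>h = \<Sum>\<^sub>j\<^sub><\<^sub>m p\<^sub>j\<close>.
  One step shifts the sum by one, so it changes \<open>h\<close> by \<open>p\<^sub>m - p\<^sub>0\<close>, and \<open>p\<^sub>m\<close> is
  at most \<open>1/n + \<delta>\<close> for large \<open>m\<close>. The error \<open>\<delta>\<close> is later absorbed by the slack \<open>1 - \<lambda>\<close> in the drift.
\<close>

lemma approximate_Poisson_equation:
  assumes "0 < (\<delta>::real)"
  obtains h :: "'v \<Rightarrow> 'v \<times> 'v \<Rightarrow> real" and H where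
    "\<And>v e. 0 \<le> h v e" "\<And>v e. h v e \<le> H"
    "\<And>v e. e \<in> E \<Longrightarrow> expect (B e) (h v) \<le> h v e + (1 / real CARD('v) + \<delta>) - of_bool (snd e = v)"
proof -
  let ?p = "\<lambda>m v e. expect (kpow B m e) (\<lambda>f. of_bool (snd f = v)) :: real"
  have p_bd: "\<bar>?p m v e\<bar> \<le> 1" for m v e by (rule abs_expectation_le) simp
  have "\<forall>\<^sub>F m in sequentially. \<forall>(v, e)\<in>UNIV \<times> E. ?p m v e < 1 / real CARD('v) + \<delta>"
    by (rule eventually_ball_finite) (use assms in \<open>auto intro!: order_tendstoD(2)[OF position_converges]\<close>)
  then obtain m where m: "\<And>v e. e \<in> E \<Longrightarrow> ?p m v e < 1 / real CARD('v) + \<delta>"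
    by (force simp: eventually_sequentially)
  define h where "h v e = (\<Sum>j<m. ?p j v e)" for v e
  show thesis
  proof
    show "0 \<le> h v e" for v e unfolding h_def by (intro sum_nonneg) simp
    show "h v e \<le> real m" for v e
      using sum_bounded_above[of "{..<m}" "\<lambda>j. ?p j v e" 1] p_bd abs_le_D1 unfolding h_def by fastforce
    fix v e assume e: "e \<in> E"
    have "expect (B e) (h v) = (\<Sum>j<m. expect (B e) (?p j v))"
      unfolding h_def by (intro Bochner_Integration.integral_sum integrable_pmf_bounded[where B=1] p_bd)
    also have "\<dots> = (\<Sum>j<m. ?p (Suc j) v e)"
      by (intro sum.cong refl) (simp add: expectation_bind_bounded[where B=1])
    also have "\<dots> = h v e + ?p m v e - ?p 0 v e"
    proof -
      have "(\<Sum>j<m. ?p (Suc j) v e) + ?p 0 v e = (\<Sum>j<Suc m. ?p j v e)"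
        by (simp only: sum.lessThan_Suc_shift add.commute)
      then show ?thesis by (simp add: h_def)
    qed
    finally show "expect (B e) (h v) \<le> h v e + (1 / real CARD('v) + \<delta>) - of_bool (snd e = v)"
      using m[OF e, of v] by simp
  qed
qed

end

section \<open>Exponential clocks\<close>

abbreviation clock_space :: "('i \<Rightarrow> real) measure" where
  "clock_space \<equiv> Pi\<^sub>M UNIV (\<lambda>_. borel)"

definition clock_rate :: "real \<Rightarrow> 'v::finite option \<Rightarrow> real" where
  "clock_rate lam e = (case e of None \<Rightarrow> lam * real CARD('v) | Some v \<Rightarrow> 1)"

definition total_rate :: "real \<Rightarrow> ('v::finite, 'd) state \<Rightarrow> real" where
  "total_rate lam x = (\<Sum>e\<in>running x. clock_rate lam e)"

abbreviation fresh_clocks :: "real \<Rightarrow> ('v::finite option \<Rightarrow> real) measure" where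
  "fresh_clocks lam \<equiv> Pi\<^sub>M UNIV (clock_law lam)"

lemma clock_law_eq: "clock_law lam e = density lborel (exponential_density (clock_rate lam e))"
  by (simp add: clock_law_def clock_rate_def)

lemma clock_rate_pos: "0 < lam \<Longrightarrow> 0 < clock_rate lam (e :: 'v::finite option)"
  by (auto simp: clock_rate_def split: option.split)

lemma sets_fresh_clocks [measurable_cong]:
  "sets (fresh_clocks lam) = sets (clock_space)"
  by (intro sets_PiM_cong) auto

lemma prob_space_fresh_clocks: "0 < lam \<Longrightarrow> prob_space (fresh_clocks lam)"
  by (intro prob_space_PiM prob_space_clock_law)

lemma exponential_memoryless:
  assumes l: "0 < l" and s: "0 \<le> s" and [measurable]: "G \<in> borel_measurable borel"
  shows "(\<integral>\<^sup>+ r. indicator {s<..} r * G (r - s) \<partial>density lborel (exponential_density l)) =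
    ennreal (exp (- (l * s))) * (\<integral>\<^sup>+ r. G r \<partial>density lborel (exponential_density l))"
proof -
  have "(\<integral>\<^sup>+ r. indicator {s<..} r * G (r - s) \<partial>density lborel (exponential_density l)) =
      (\<integral>\<^sup>+ r. ennreal (exponential_density l r) * (indicator {s<..} r * G (r - s)) \<partial>lborel)"
    by (subst nn_integral_density) auto
  also have "\<dots> = (\<integral>\<^sup>+ r. ennreal (exponential_density l (s + r)) * (indicator {0<..} r * G r) \<partial>lborel)"
    by (subst nn_integral_real_affine[where c=1 and t=s])
       (auto intro!: nn_integral_cong split: split_indicator)
  also have "\<dots> = (\<integral>\<^sup>+ r. ennreal (exp (- (l * s))) * (ennreal (exponential_density l r) * G r) \<partial>lborel)"
  proof (rule nn_integral_cong_AE)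
    have "AE r in lborel. (r::real) \<noteq> 0" by (rule AE_lborel_singleton)
    then show "AE r in lborel. ennreal (exponential_density l (s + r)) * (indicator {0<..} r * G r) =
        ennreal (exp (- (l * s))) * (ennreal (exponential_density l r) * G r)"
    proof eventually_elim
      case (elim r)
      show ?case
      proof (cases "0 < r")
        case True
        then have "exponential_density l (s + r) = exp (- (l * s)) * exponential_density l r"
          using s by (simp add: exponential_density_def exp_add[symmetric] algebra_simps)
        then show ?thesis using True l
          by (simp add: ennreal_mult exponential_density_nonneg mult.assoc)
      next
        case False
        then show ?thesis using elim by (simp add: exponential_density_def)
      qed
    qed
  qed
  also have "\<dots> = ennreal (exp (- (l * s))) * (\<integral>\<^sup>+ r. G r \<partial>density lborel (exponential_density l))"
    by (subst nn_integral_density) (auto simp: nn_integral_cmult)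
  finally show ?thesis .
qed

lemma product_prob_space_clock_law:
  "0 < lam \<Longrightarrow> product_prob_space (clock_law lam :: 'v::finite option \<Rightarrow> real measure)"
  by (simp add: product_prob_space_def product_prob_space_axioms_def product_sigma_finite_def
      prob_space_clock_law prob_space_imp_sigma_finite)

lemma measurable_fun_upd_clock [measurable]:
  "(\<lambda>p. (fst p)(j := snd p)) \<in>
      clock_space \<Otimes>\<^sub>M borel \<rightarrow>\<^sub>M clock_space"
  by (intro measurable_PiM_single') (auto simp: fun_upd_def)

lemma sigma_finite_clock_law: "0 < lam \<Longrightarrow> sigma_finite_measure (clock_law lam e)"
  by (intro prob_space_imp_sigma_finite prob_space_clock_law)

lemma borel_measurable_integral_clock:
  assumes "0 < lam" and "f \<in> borel_measurable (clock_space)"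
  shows "(\<lambda>c. \<integral>\<^sup>+ r. f (c(j := r)) \<partial>clock_law lam j) \<in> borel_measurable (clock_space)"
  using measurable_compose[OF measurable_fun_upd_clock assms(2), of j]
  by (intro sigma_finite_measure.borel_measurable_nn_integral sigma_finite_clock_law assms(1))
     (simp add: split_beta')

text \<open>
  Replacing one clock by a fresh copy does not change the joint law. This turns statements about a
  single coordinate of the product measure into one-dimensional integrals.
\<close>

lemma resample_clock:
  fixes f :: "('v::finite option \<Rightarrow> real) \<Rightarrow> ennreal"
  assumes lam: "0 < lam" and [measurable]: "f \<in> borel_measurable (clock_space)"
  shows "(\<integral>\<^sup>+ c. f c \<partial>fresh_clocks lam) =
    (\<integral>\<^sup>+ c. \<integral>\<^sup>+ r. f (c(j := r)) \<partial>clock_law lam j \<partial>fresh_clocks lam)"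
proof -
  interpret product_prob_space "clock_law lam :: 'v option \<Rightarrow> real measure" UNIV
    by (rule product_prob_space_clock_law[OF lam])
  have U: "UNIV = insert j (UNIV - {j})" by auto
  have F: "(\<lambda>c. \<integral>\<^sup>+ r. f (c(j := r)) \<partial>clock_law lam j) \<in> borel_measurable (fresh_clocks lam)"
    using borel_measurable_integral_clock[OF assms] by simp
  have 1: "(\<integral>\<^sup>+ c. h c \<partial>fresh_clocks lam) =
     (\<integral>\<^sup>+ c. \<integral>\<^sup>+ r. h (c(j := r)) \<partial>clock_law lam j \<partial>Pi\<^sub>M (UNIV - {j}) (clock_law lam))"
    if "h \<in> borel_measurable (fresh_clocks lam)" for h
    using product_nn_integral_insert[of "UNIV - {j}" j h] that U by simp
  show ?thesis
    by (subst 1, simp) (subst 1, rule F, simp add: M.emeasure_space_1)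
qed

text \<open>
  When the clock of \<open>e\<close> rings at \<open>s\<close> and is renewed, the vector of clocks with the new value is
  independent of \<open>s\<close>.
\<close>

lemma swap_clock:
  fixes \<phi> :: "real \<Rightarrow> ('v::finite option \<Rightarrow> real) \<Rightarrow> ennreal"
  assumes lam: "0 < lam"
    and [measurable]: "case_prod \<phi> \<in> borel_measurable (borel \<Otimes>\<^sub>M clock_space)"
  shows "(\<integral>\<^sup>+ c. \<integral>\<^sup>+ r. \<phi> (c e) (c(e := r)) \<partial>clock_law lam e \<partial>fresh_clocks lam) =
    (\<integral>\<^sup>+ s. \<integral>\<^sup>+ c. \<phi> s c \<partial>fresh_clocks lam \<partial>clock_law lam e)"
proof -
  let ?P = "fresh_clocks lam" and ?e = "clock_law lam e"
  interpret e: prob_space ?e by (rule prob_space_clock_law[OF lam])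
  interpret P: prob_space ?P by (rule prob_space_fresh_clocks[OF lam])
  interpret eP: pair_sigma_finite ?e ?P ..
  have m1: "(\<lambda>p. \<phi> (fst (fst p)) ((snd (fst p))(e := snd p)))
      \<in> borel_measurable ((borel \<Otimes>\<^sub>M clock_space) \<Otimes>\<^sub>M borel)"
  proof -
    have "(\<lambda>p. (fst (fst p), (\<lambda>q. (fst q)(e := snd q)) (snd (fst p), snd p)))
       \<in> (borel \<Otimes>\<^sub>M clock_space) \<Otimes>\<^sub>M borel \<rightarrow>\<^sub>M borel \<Otimes>\<^sub>M clock_space"
      by measurable
    from measurable_compose[OF this assms(2)] show ?thesis by simp
  qed
  have m2: "(\<lambda>p. \<integral>\<^sup>+ r. \<phi> (fst p) ((snd p)(e := r)) \<partial>?e) \<in> borel_measurable (borel \<Otimes>\<^sub>M clock_space)"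
    using m1 by (intro e.borel_measurable_nn_integral) (simp add: split_beta')
  have ms: "(\<lambda>c. \<phi> s c) \<in> borel_measurable (clock_space)" for s
    using measurable_Pair2[OF assms(2), of s] by simp
  have m3: "(\<lambda>c. \<integral>\<^sup>+ r. \<phi> (c e) (c(e := r)) \<partial>?e) \<in> borel_measurable (clock_space)"
  proof -
    have "(\<lambda>c. (c e, c)) \<in> clock_space \<rightarrow>\<^sub>M borel \<Otimes>\<^sub>M clock_space"
      by measurable
    from measurable_compose[OF this m2] show ?thesis by simp
  qed
  have "(\<integral>\<^sup>+ c. \<integral>\<^sup>+ r. \<phi> (c e) (c(e := r)) \<partial>?e \<partial>?P) =
      (\<integral>\<^sup>+ c. \<integral>\<^sup>+ s. \<integral>\<^sup>+ r. \<phi> s (c(e := r)) \<partial>?e \<partial>?e \<partial>?P)"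
    by (subst resample_clock[OF lam m3, of e]) simp
  also have "\<dots> = (\<integral>\<^sup>+ s. \<integral>\<^sup>+ c. \<integral>\<^sup>+ r. \<phi> s (c(e := r)) \<partial>?e \<partial>?P \<partial>?e)"
    using m2 by (subst eP.Fubini'[symmetric]) (simp_all add: split_beta')
  also have "\<dots> = (\<integral>\<^sup>+ s. \<integral>\<^sup>+ c. \<phi> s c \<partial>?P \<partial>?e)"
    by (intro nn_integral_cong resample_clock[OF lam ms, symmetric])
  finally show ?thesis .
qed

text \<open>
  The clocks in \<open>L\<close> after they have run for a time \<open>s\<close>.
\<close>

definition shift_clocks :: "real \<Rightarrow> 'v option set \<Rightarrow> ('v option \<Rightarrow> real) \<Rightarrow> 'v option \<Rightarrow> real" where
  "shift_clocks s L c = (\<lambda>i. if i \<in> L then c i - s else c i)"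

lemma measurable_shift_clocks [measurable]:
  "(\<lambda>(s, c). shift_clocks s L c) \<in> borel \<Otimes>\<^sub>M clock_space \<rightarrow>\<^sub>M clock_space"
  unfolding shift_clocks_def by (intro measurable_PiM_single') (auto simp: split_beta')

lemma measurable_shift_clocks' [measurable]:
  "shift_clocks s L \<in> clock_space \<rightarrow>\<^sub>M clock_space"
  unfolding shift_clocks_def by (intro measurable_PiM_single') auto

lemma shift_one_clock:
  fixes G :: "('v::finite option \<Rightarrow> real) \<Rightarrow> ennreal"
  assumes lam: "0 < lam" and s: "0 \<le> s" and [measurable]: "G \<in> borel_measurable (clock_space)"
  shows "(\<integral>\<^sup>+ c. indicator {s<..} (c j) * G (shift_clocks s {j} c) \<partial>fresh_clocks lam) =
    ennreal (exp (- (clock_rate lam j * s))) * (\<integral>\<^sup>+ c. G c \<partial>fresh_clocks lam)"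
proof -
  have upd: "shift_clocks s {j} (c(j := r)) = c(j := r - s)" for c r
    by (auto simp: shift_clocks_def)
  have G: "(\<lambda>r. G (c(j := r))) \<in> borel_measurable borel" for c
  proof -
    have "(\<lambda>r. c(j := r)) \<in> borel \<rightarrow>\<^sub>M clock_space"
      by (intro measurable_PiM_single') (auto simp: fun_upd_def)
    from measurable_compose[OF this assms(3)] show ?thesis .
  qed
  have "(\<integral>\<^sup>+ c. indicator {s<..} (c j) * G (shift_clocks s {j} c) \<partial>fresh_clocks lam) =
     (\<integral>\<^sup>+ c. \<integral>\<^sup>+ r. indicator {s<..} r * G (c(j := r - s)) \<partial>clock_law lam j \<partial>fresh_clocks lam)"
    by (subst resample_clock[OF lam, of _ j]) (auto simp: upd)
  also have "\<dots> = (\<integral>\<^sup>+ c. ennreal (exp (- (clock_rate lam j * s))) * (\<integral>\<^sup>+ r. G (c(j := r)) \<partial>clock_law lam j) \<partial>fresh_clocks lam)"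
    unfolding clock_law_eq
    by (subst exponential_memoryless[OF clock_rate_pos[OF lam] s G]) simp
  also have "\<dots> = ennreal (exp (- (clock_rate lam j * s))) *
      (\<integral>\<^sup>+ c. \<integral>\<^sup>+ r. G (c(j := r)) \<partial>clock_law lam j \<partial>fresh_clocks lam)"
    using borel_measurable_integral_clock[OF lam assms(3), of j] by (intro nn_integral_cmult) simp
  also have "\<dots> = ennreal (exp (- (clock_rate lam j * s))) * (\<integral>\<^sup>+ c. G c \<partial>fresh_clocks lam)"
    by (subst resample_clock[OF lam assms(3), of j]) simp
  finally show ?thesis .
qed

text \<open>
  Memorylessness for several clocks at once, by induction on their number: on the event that no
  clock in \<open>L\<close> rings before \<open>s\<close>, the remaining times have the original law.
\<close>

lemma shift_fresh_clocks:
  fixes G :: "('v::finite option \<Rightarrow> real) \<Rightarrow> ennreal"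
  assumes lam: "0 < lam" and s: "0 \<le> s" and G: "G \<in> borel_measurable (clock_space)"
  shows "(\<integral>\<^sup>+ c. indicator {c. \<forall>i\<in>L. s < c i} c * G (shift_clocks s L c) \<partial>fresh_clocks lam) =
    ennreal (exp (- ((\<Sum>i\<in>L. clock_rate lam i) * s))) * (\<integral>\<^sup>+ c. G c \<partial>fresh_clocks lam)"
proof -
  have "finite L" by simp
  then show ?thesis
    using G
  proof (induction L arbitrary: G)
    case empty
    show ?case by (simp add: shift_clocks_def[abs_def])
  next
    case (insert j L)
    note [measurable] = insert.prems
    let ?H = "\<lambda>c. indicator {c. \<forall>i\<in>L. s < c i} c * G (shift_clocks s L c) :: ennreal"
    have ind: "Measurable.pred (clock_space) (\<lambda>c. \<forall>i\<in>L. s < c i)"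
      by measurable
    have H: "?H \<in> borel_measurable (clock_space)"
      using ind by measurable
    have "shift_clocks s (insert j L) c = shift_clocks s L (shift_clocks s {j} c)" for c
      using insert.hyps by (auto simp: shift_clocks_def fun_eq_iff)
    moreover have "(\<forall>i\<in>insert j L. s < c i) \<longleftrightarrow> s < c j \<and> (\<forall>i\<in>L. s < shift_clocks s {j} c i)" for c
      using insert.hyps by (auto simp: shift_clocks_def)
    ultimately have "(\<integral>\<^sup>+ c. indicator {c. \<forall>i\<in>insert j L. s < c i} c * G (shift_clocks s (insert j L) c) \<partial>fresh_clocks lam)
       = (\<integral>\<^sup>+ c. indicator {s<..} (c j) * ?H (shift_clocks s {j} c) \<partial>fresh_clocks lam)"
      by (intro nn_integral_cong) (auto simp: indicator_def)
    also have "\<dots> = ennreal (exp (- (clock_rate lam j * s))) * (\<integral>\<^sup>+ c. ?H c \<partial>fresh_clocks lam)"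
      by (rule shift_one_clock[OF lam s H])
    also have "\<dots> = ennreal (exp (- (clock_rate lam j * s))) *
       (ennreal (exp (- ((\<Sum>i\<in>L. clock_rate lam i) * s))) * (\<integral>\<^sup>+ c. G c \<partial>fresh_clocks lam))"
      by (subst insert.IH[OF insert.prems]) simp
    also have "\<dots> = ennreal (exp (- ((\<Sum>i\<in>insert j L. clock_rate lam i) * s))) * (\<integral>\<^sup>+ c. G c \<partial>fresh_clocks lam)"
    proof -
      have "exp (- (clock_rate lam j * s)) * exp (- ((\<Sum>i\<in>L. clock_rate lam i) * s)) =
          exp (- ((\<Sum>i\<in>insert j L. clock_rate lam i) * s))"
        using insert.hyps by (simp add: exp_add[symmetric] distrib_right)
      then show ?thesis by (simp add: mult.assoc[symmetric] ennreal_mult[symmetric])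
    qed
    finally show ?case .
  qed
qed

lemma AE_clocks_distinct:
  assumes lam: "0 < lam"
  shows "AE c in fresh_clocks lam. inj (c :: 'v::finite option \<Rightarrow> real)"
proof -
  have "AE c in fresh_clocks lam. c i \<noteq> c j" if "i \<noteq> j" for i j :: "'v option"
  proof -
    have [measurable]: "(\<lambda>c. c i) \<in> borel_measurable (clock_space)" for i :: "'v option"
      by (rule measurable_component_singleton) simp
    have m: "(\<lambda>c. indicator {0} (c i - c j) :: ennreal) \<in> borel_measurable (clock_space)"
      by measurable
    have "(\<integral>\<^sup>+ c. indicator {0} (c i - c j) \<partial>fresh_clocks lam) =
      (\<integral>\<^sup>+ c. \<integral>\<^sup>+ r. indicator {c j} r \<partial>clock_law lam i \<partial>fresh_clocks lam)"
      using that by (subst resample_clock[OF lam m, of i])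
        (intro nn_integral_cong, auto simp: indicator_def)
    also have "\<dots> = (\<integral>\<^sup>+ c. 0 \<partial>(fresh_clocks lam :: ('v option \<Rightarrow> real) measure))"
    proof (rule nn_integral_cong)
      fix c :: "'v option \<Rightarrow> real"
      have "AE x in lborel. ennreal (exponential_density (clock_rate lam i) x) * indicator {c j} x = 0"
        using AE_lborel_singleton[of "c j"] by eventually_elim simp
      then show "(\<integral>\<^sup>+ r. indicator {c j} r \<partial>clock_law lam i) = 0"
        unfolding clock_law_eq by (subst nn_integral_density) (auto simp: nn_integral_0_iff_AE)
    qed
    finally have "(\<integral>\<^sup>+ c. indicator {0} (c i - c j) \<partial>fresh_clocks lam) = 0" by simp
    then have "AE c in fresh_clocks lam. indicator {0} (c i - c j) = (0::ennreal)"
      using m by (subst (asm) nn_integral_0_iff_AE) auto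
    then show ?thesis by eventually_elim (auto simp: indicator_def split: if_splits)
  qed
  then have "AE c in fresh_clocks lam. \<forall>i j :: 'v option. i \<noteq> j \<longrightarrow> c i \<noteq> c j"
    by (simp add: AE_all_countable)
  then show ?thesis by eventually_elim (auto simp: inj_def)
qed

lemma finite_running [simp]: "finite (running (x :: ('v::finite, 'd) state))"
  by (simp add: running_def)

lemma next_event_running:
  fixes x :: "('v::finite, 'd) state"
  shows "next_event (x, c) \<in> running x" and "j \<in> running x \<Longrightarrow> c (next_event (x, c)) \<le> c j"
proof -
  have "running x \<noteq> {}" by (auto simp: running_def)
  from arg_min_if_finite[OF finite_running this, of c]
  show "next_event (x, c) \<in> running x" and "j \<in> running x \<Longrightarrow> c (next_event (x, c)) \<le> c j"
    by (auto simp: next_event_def not_less)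
qed

lemma total_rate_pos: "0 < lam \<Longrightarrow> 0 < total_rate lam (x :: ('v::finite, 'd) state)"
  unfolding total_rate_def by (intro sum_pos clock_rate_pos) (auto simp: running_def)

text \<open>
  The one-step description of competing exponential clocks. Almost surely exactly one running clock is
  minimal. If it is the clock of \<open>e\<close> and rings at time \<open>s\<close>, then the other running clocks exceed \<open>s\<close>,
  which contributes the factor \<open>exp (- s)\<close> to the power of the sum of their rates, and all clocks
  start afresh. Together with the density of the clock of \<open>e\<close> this is the density of the total rate,
  weighted with the probability that \<open>e\<close> is the next event.
\<close>

lemma fresh_clocks_step:
  fixes x :: "('v::finite, 'd) state" and g :: "'v option \<Rightarrow> real \<Rightarrow> ('v option \<Rightarrow> real) \<Rightarrow> ennreal"
  assumes lam: "0 < lam"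
    and g: "\<And>e. case_prod (g e) \<in> borel_measurable (borel \<Otimes>\<^sub>M clock_space)"
  shows "(\<integral>\<^sup>+ c. \<integral>\<^sup>+ r. g (next_event (x, c)) (waiting_time (x, c)) (renew_clocks (x, c) r)
        \<partial>clock_law lam (next_event (x, c)) \<partial>fresh_clocks lam) =
    (\<Sum>e\<in>running x. ennreal (clock_rate lam e / total_rate lam x) *
      (\<integral>\<^sup>+ s. ennreal (exponential_density (total_rate lam x) s) * (\<integral>\<^sup>+ c. g e s c \<partial>fresh_clocks lam) \<partial>lborel))"
proof -
  let ?J = "running x" and ?R = "total_rate lam x"
  interpret P: prob_space "fresh_clocks lam :: ('v option \<Rightarrow> real) measure"
    by (rule prob_space_fresh_clocks[OF lam])
  define L where "L e = ?J - {e}" for e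
  define \<phi> where "\<phi> e s c = (indicator {c. \<forall>i\<in>L e. s < c i} c * g e s (shift_clocks s (L e) c) :: ennreal)" for e s c
  have [measurable]: "case_prod (g e) \<in> borel_measurable (borel \<Otimes>\<^sub>M clock_space)" for e by (rule g)
  have \<phi>: "case_prod (\<phi> e) \<in> borel_measurable (borel \<Otimes>\<^sub>M clock_space)" for e
  proof -
    have 1: "(\<lambda>p. (fst p, (\<lambda>(s, c). shift_clocks s (L e) c) p)) \<in>
        borel \<Otimes>\<^sub>M clock_space \<rightarrow>\<^sub>M borel \<Otimes>\<^sub>M clock_space"
      by measurable
    have 2: "Measurable.pred (borel \<Otimes>\<^sub>M clock_space) (\<lambda>p. \<forall>i\<in>L e. fst p < (snd p i :: real))"
    proof -
      have [measurable]: "(\<lambda>p. snd p i) \<in> borel_measurable (borel \<Otimes>\<^sub>M clock_space)" for i :: "'v option"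
        by (rule measurable_compose[OF measurable_snd measurable_component_singleton]) simp
      show ?thesis by measurable
    qed
    show ?thesis
      using measurable_compose[OF 1 g[of e]] 2
      by (simp add: \<phi>_def split_beta' indicator_def[abs_def] if_distrib[where f="\<lambda>u. u * _"] cong: if_cong)
  qed
  have gm: "(\<lambda>c. g e s c) \<in> borel_measurable (clock_space)" for e s
    using measurable_Pair2[OF g, of s] by simp
  have m3: "(\<lambda>c. \<integral>\<^sup>+ r. \<phi> e (c e) (c(e := r)) \<partial>clock_law lam e) \<in> borel_measurable (clock_space)" for e
  proof -
    have "(\<lambda>p. (fst p e, (\<lambda>q. (fst q)(e := snd q)) p))
       \<in> clock_space \<Otimes>\<^sub>M borel \<rightarrow>\<^sub>M borel \<Otimes>\<^sub>M clock_space"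
      by measurable
    from measurable_compose[OF this \<phi>[of e]] show ?thesis
      by (intro sigma_finite_measure.borel_measurable_nn_integral sigma_finite_clock_law lam)
         (simp add: split_beta')
  qed
  have "(\<integral>\<^sup>+ c. \<integral>\<^sup>+ r. g (next_event (x, c)) (waiting_time (x, c)) (renew_clocks (x, c) r)
        \<partial>clock_law lam (next_event (x, c)) \<partial>fresh_clocks lam) =
     (\<integral>\<^sup>+ c. (\<Sum>e\<in>?J. \<integral>\<^sup>+ r. \<phi> e (c e) (c(e := r)) \<partial>clock_law lam e) \<partial>fresh_clocks lam)"
  proof (rule nn_integral_cong_AE)
    show "AE c in fresh_clocks lam. (\<integral>\<^sup>+ r. g (next_event (x, c)) (waiting_time (x, c)) (renew_clocks (x, c) r)
        \<partial>clock_law lam (next_event (x, c))) = (\<Sum>e\<in>?J. \<integral>\<^sup>+ r. \<phi> e (c e) (c(e := r)) \<partial>clock_law lam e)"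
      using AE_clocks_distinct[OF lam]
    proof eventually_elim
      case (elim c)
      define e0 where "e0 = next_event (x, c)"
      have e0: "e0 \<in> ?J" "\<And>j. j \<in> ?J \<Longrightarrow> c e0 \<le> c j"
        by (auto simp: e0_def next_event_running)
      have z: "\<phi> e (c e) (c(e := r)) = 0" if "e \<in> ?J" "e \<noteq> e0" for e r
      proof -
        have "e0 \<in> L e" "\<not> c e < c e0" using e0 that by (auto simp: L_def not_less)
        then show ?thesis using that by (auto simp: \<phi>_def indicator_def)
      qed
      have nz: "\<phi> e0 (c e0) (c(e0 := r)) = g e0 (c e0) (renew_clocks (x, c) r)" for r
      proof -
        have "c e0 < c i" if "i \<in> L e0" for i
          using that e0 elim by (auto simp: L_def less_le dest: injD)
        moreover have "shift_clocks (c e0) (L e0) (c(e0 := r)) = renew_clocks (x, c) r"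
          by (auto simp: shift_clocks_def renew_clocks_def L_def e0_def waiting_time_def)
        ultimately show ?thesis by (auto simp: \<phi>_def L_def indicator_def)
      qed
      have "(\<Sum>e\<in>?J. \<integral>\<^sup>+ r. \<phi> e (c e) (c(e := r)) \<partial>clock_law lam e) =
          (\<integral>\<^sup>+ r. \<phi> e0 (c e0) (c(e0 := r)) \<partial>clock_law lam e0)"
        using e0(1) z by (subst sum.remove[of _ e0]) auto
      then show ?case unfolding nz by (simp add: e0_def[symmetric] waiting_time_def)
    qed
  qed
  also have "\<dots> = (\<Sum>e\<in>?J. \<integral>\<^sup>+ c. \<integral>\<^sup>+ r. \<phi> e (c e) (c(e := r)) \<partial>clock_law lam e \<partial>fresh_clocks lam)"
    using m3 by (intro nn_integral_sum) simp
  also have "\<dots> = (\<Sum>e\<in>?J. \<integral>\<^sup>+ s. \<integral>\<^sup>+ c. \<phi> e s c \<partial>fresh_clocks lam \<partial>clock_law lam e)"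
    by (intro sum.cong refl swap_clock[OF lam \<phi>])
  also have "\<dots> = (\<Sum>e\<in>?J. ennreal (clock_rate lam e / ?R) *
      (\<integral>\<^sup>+ s. ennreal (exponential_density ?R s) * (\<integral>\<^sup>+ c. g e s c \<partial>fresh_clocks lam) \<partial>lborel))"
  proof (rule sum.cong[OF refl])
    fix e assume e: "e \<in> ?J"
    have mI: "(\<lambda>s. \<integral>\<^sup>+ c. g e s c \<partial>fresh_clocks lam) \<in> borel_measurable borel"
      using g[of e] by (intro P.borel_measurable_nn_integral) simp
    have mI': "(\<lambda>s. \<integral>\<^sup>+ c. \<phi> e s c \<partial>fresh_clocks lam) \<in> borel_measurable borel"
      using \<phi>[of e] by (intro P.borel_measurable_nn_integral) simp
    have rp: "0 < clock_rate lam e" "0 < ?R" using clock_rate_pos[OF lam] total_rate_pos[OF lam, of x] by auto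
    have "(\<integral>\<^sup>+ s. \<integral>\<^sup>+ c. \<phi> e s c \<partial>fresh_clocks lam \<partial>clock_law lam e) =
        (\<integral>\<^sup>+ s. ennreal (exponential_density (clock_rate lam e) s) * (\<integral>\<^sup>+ c. \<phi> e s c \<partial>fresh_clocks lam) \<partial>lborel)"
      unfolding clock_law_eq[of lam e] using mI' by (intro nn_integral_density) auto
    also have "\<dots> = (\<integral>\<^sup>+ s. ennreal (clock_rate lam e / ?R) *
       (ennreal (exponential_density ?R s) * (\<integral>\<^sup>+ c. g e s c \<partial>fresh_clocks lam)) \<partial>lborel)"
    proof (rule nn_integral_cong)
      fix s :: real
      show "ennreal (exponential_density (clock_rate lam e) s) * (\<integral>\<^sup>+ c. \<phi> e s c \<partial>fresh_clocks lam) =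
        ennreal (clock_rate lam e / ?R) *
          (ennreal (exponential_density ?R s) * (\<integral>\<^sup>+ c. g e s c \<partial>fresh_clocks lam))"
      proof (cases "0 \<le> s")
        case True
        have R: "?R = clock_rate lam e + (\<Sum>i\<in>L e. clock_rate lam i)"
          unfolding total_rate_def L_def using e by (subst sum.remove[of _ e]) auto
        have "exponential_density (clock_rate lam e) s * exp (- ((\<Sum>i\<in>L e. clock_rate lam i) * s)) =
            clock_rate lam e / ?R * exponential_density ?R s"
        proof -
          have "exp (- (s * clock_rate lam e)) * exp (- ((\<Sum>i\<in>L e. clock_rate lam i) * s)) = exp (- (s * ?R))"
            by (simp add: R exp_add[symmetric] distrib_left mult.commute)
          then show ?thesis using True rp by (simp add: exponential_density_def)
        qed
        then have "ennreal (exponential_density (clock_rate lam e) s) * ennreal (exp (- ((\<Sum>i\<in>L e. clock_rate lam i) * s)))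
          = ennreal (clock_rate lam e / ?R) * ennreal (exponential_density ?R s)"
          using rp by (simp add: ennreal_mult[symmetric] exponential_density_nonneg)
        then show ?thesis
          unfolding \<phi>_def shift_fresh_clocks[OF lam True gm] by (simp add: mult.assoc[symmetric])
      qed (simp add: exponential_density_def)
    qed
    also have "\<dots> = ennreal (clock_rate lam e / ?R) *
      (\<integral>\<^sup>+ s. ennreal (exponential_density ?R s) * (\<integral>\<^sup>+ c. g e s c \<partial>fresh_clocks lam) \<partial>lborel)"
      using mI by (intro nn_integral_cmult) measurable
    finally show "(\<integral>\<^sup>+ s. \<integral>\<^sup>+ c. \<phi> e s c \<partial>fresh_clocks lam \<partial>clock_law lam e) = \<dots>" .
  qed
  finally show ?thesis .
qed

section \<open>The jump chain and the uniformised chain\<close>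

definition event_pmf :: "real \<Rightarrow> 'v::finite option set \<Rightarrow> 'v option pmf" where
  "event_pmf lam J = embed_pmf (\<lambda>e. indicator J e * clock_rate lam e / (\<Sum>i\<in>J. clock_rate lam i))"

lemma pmf_event:
  assumes lam: "0 < lam" and J: "J \<noteq> {}"
  shows "pmf (event_pmf lam J) e = indicator J e * clock_rate lam e / (\<Sum>i\<in>J. clock_rate lam i)"
  unfolding event_pmf_def
proof (rule pmf_embed_pmf)
  have pos: "0 < (\<Sum>i\<in>J. clock_rate lam i)" using J clock_rate_pos[OF lam] by (intro sum_pos) auto
  then show nn: "0 \<le> indicator J e * clock_rate lam e / (\<Sum>i\<in>J. clock_rate lam i)" for e
    using clock_rate_pos[OF lam, of e] by (simp add: indicator_def)
  have "(\<integral>\<^sup>+ e. ennreal (indicator J e * clock_rate lam e / (\<Sum>i\<in>J. clock_rate lam i)) \<partial>count_space UNIV) =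
     ennreal (\<Sum>e\<in>UNIV. indicator J e * clock_rate lam e / (\<Sum>i\<in>J. clock_rate lam i))"
    using nn by (simp add: nn_integral_count_space_finite sum_ennreal)
  also have "(\<Sum>e\<in>UNIV. indicator J e * clock_rate lam e / (\<Sum>i\<in>J. clock_rate lam i)) = 1"
    using pos by (simp add: sum_divide_distrib[symmetric] indicator_def sum.If_cases if_distrib[where f="\<lambda>u. u * _"] cong: if_cong)
  finally show "(\<integral>\<^sup>+ e. ennreal (indicator J e * clock_rate lam e / (\<Sum>i\<in>J. clock_rate lam i)) \<partial>count_space UNIV) = 1"
    by simp
qed

lemma set_event_pmf:
  assumes lam: "0 < lam" and J: "J \<noteq> {}"
  shows "set_pmf (event_pmf lam J) = J"
proof -
  have "0 < (\<Sum>i\<in>J. clock_rate lam i)" using J clock_rate_pos[OF lam] by (intro sum_pos) auto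
  moreover have "clock_rate lam e \<noteq> 0" for e :: "'a option"
    using clock_rate_pos[OF lam, of e] by simp
  ultimately show ?thesis
    by (auto simp: set_pmf_iff pmf_event[OF lam J] indicator_def)
qed

lemma expectation_event:
  fixes f :: "'v::finite option \<Rightarrow> real"
  assumes "0 < lam" "J \<noteq> {}"
  shows "(\<Sum>i\<in>J. clock_rate lam i) * expect (event_pmf lam J) f =
    (\<Sum>e\<in>J. clock_rate lam e * f e)"
proof -
  have "0 < (\<Sum>i\<in>J. clock_rate lam i)" using assms clock_rate_pos[OF assms(1)] by (intro sum_pos) auto
  moreover have "expect (event_pmf lam J) f = (\<Sum>e\<in>J. f e * pmf (event_pmf lam J) e)"
    by (rule integral_measure_pmf_real) (auto simp: set_event_pmf assms)
  ultimately show ?thesis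
    by (simp add: pmf_event assms sum_distrib_left mult.commute)
qed

lemma nn_integral_event:
  assumes "0 < lam" "J \<noteq> {}"
  shows "(\<integral>\<^sup>+ e. f e \<partial>measure_pmf (event_pmf lam J)) =
    (\<Sum>e\<in>J. ennreal (clock_rate lam e / (\<Sum>i\<in>J. clock_rate lam i)) * f e)"
proof -
  have "(\<integral>\<^sup>+ e. f e \<partial>measure_pmf (event_pmf lam J)) = (\<Sum>e\<in>J. f e * ennreal (pmf (event_pmf lam J) e))"
    by (subst nn_integral_measure_pmf_finite) (simp_all add: set_event_pmf assms)
  then show ?thesis
    by (simp add: pmf_event assms mult.commute)
qed

text \<open>
  The choice \<open>J = running x\<close> gives the jump chain. For larger \<open>J\<close> also services at empty queues can
  be chosen; they leave the state unchanged because of the truncated subtraction on natural numbers.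
\<close>

definition event_kernel :: "('v::finite \<Rightarrow> 'v \<Rightarrow> bool) \<Rightarrow> real \<Rightarrow> (('v, 'd::finite) state \<Rightarrow> 'v pmf) \<Rightarrow>
    'v option set \<Rightarrow> ('v, 'd) state \<Rightarrow> ('v, 'd) state pmf" where
  "event_kernel adj lam tie J x = bind_pmf (event_pmf lam J) (event_step adj tie x)"

lemma event_step_idle: "e \<notin> running x \<Longrightarrow> event_step adj tie x e = return_pmf x"
  by (cases e; cases x) (auto simp: event_step_def running_def image_iff fun_eq_iff)

lemma finite_set_event_step [simp]: "finite (set_pmf (event_step adj tie (x :: ('v::finite, 'd::finite) state) e))"
  by (cases x; cases e) (auto simp: event_step_def)

definition jump_kernel where
  "jump_kernel adj lam tie x = event_kernel adj lam tie (running x) x"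

definition uniform_kernel where
  "uniform_kernel adj lam tie x = event_kernel adj lam tie UNIV x"

lemma integrable_finite_pmf: "finite (set_pmf p) \<Longrightarrow> integrable (measure_pmf p) (f :: _ \<Rightarrow> real)"
  by (rule integrable_measure_pmf_finite)

lemma finite_set_event_kernel [simp]:
  "finite (set_pmf (event_kernel adj lam tie J (x :: ('v::finite, 'd::finite) state)))"
  by (simp add: event_kernel_def)

lemma expectation_bind_finite:
  fixes f :: "'s \<Rightarrow> real"
  assumes "finite (set_pmf p)" "\<And>x. x \<in> set_pmf p \<Longrightarrow> finite (set_pmf (q x))"
  shows "expect (bind_pmf p q) f = expect p (\<lambda>x. expect (q x) f)"
  using assms
  by (subst pmf_expectation_bind[where A="set_pmf p"])
     (simp_all add: integral_measure_pmf[where A="set_pmf p"])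

text \<open>
  Enlarging \<open>J\<close> only adds events without effect, so the generator is the same for the jump chain and
  for the uniformised chain. The drift condition has to be verified only once.
\<close>

lemma expectation_event_kernel:
  fixes f :: "('v::finite, 'd::finite) state \<Rightarrow> real"
  assumes lam: "0 < lam" and J: "running x \<subseteq> J"
  shows "(\<Sum>i\<in>J. clock_rate lam i) * (expect (event_kernel adj lam tie J x) f - f x) =
    (\<Sum>e\<in>running x. clock_rate lam e * (expect (event_step adj tie x e) f - f x))"
proof -
  have ne: "J \<noteq> {}" using J by (auto simp: running_def)
  have "(\<Sum>i\<in>J. clock_rate lam i) * (expect (event_kernel adj lam tie J x) f - f x) =
     (\<Sum>e\<in>J. clock_rate lam e * (expect (event_step adj tie x e) f - f x))"
  proof -
    have "(\<Sum>i\<in>J. clock_rate lam i) * expect (event_kernel adj lam tie J x) f =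
        (\<Sum>e\<in>J. clock_rate lam e * expect (event_step adj tie x e) f)"
      unfolding event_kernel_def
      by (subst expectation_bind_finite) (simp_all add: expectation_event[OF lam ne])
    then show ?thesis by (simp add: right_diff_distrib sum_subtractf sum_distrib_right)
  qed
  also have "\<dots> = (\<Sum>e\<in>running x. clock_rate lam e * (expect (event_step adj tie x e) f - f x))"
    using J by (intro sum.mono_neutral_right) (auto simp: event_step_idle)
  finally show ?thesis .
qed

section \<open>A Lyapunov function for the queues\<close>

locale nbrw_queue = nonbipartite_regular_graph adj k
  for adj :: "'v::finite \<Rightarrow> 'v \<Rightarrow> bool" and k +
  fixes lam :: real and tie :: "('v, 'd::finite) state \<Rightarrow> 'v pmf"
  assumes lam: "0 < lam" "lam < 1" and tie: "tie_breaking_rule adj tie"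
begin

abbreviation "S \<equiv> states adj :: ('v, 'd) state set"
abbreviation "EK \<equiv> event_kernel adj lam tie"

lemma tie_shortest: "x \<in> S \<Longrightarrow> set_pmf (tie x) \<subseteq> shortest_positions x"
  using tie by (auto simp: tie_breaking_rule_def)

lemma set_walkers:
  "set_pmf (Pi_pmf UNIV undefined (\<lambda>i. B (w i))) = {w'. \<forall>i. w' i \<in> succs (w i)}" for w :: "'d \<Rightarrow> 'v \<times> 'v"
  by (auto simp: set_Pi_pmf PiE_dflt_def set_step)

lemma set_arrival:
  "set_pmf (event_step adj tie (q, w) None) =
    {(q(s := q s + 1), w') | s w'. s \<in> set_pmf (tie (q, w)) \<and> (\<forall>i. w' i \<in> succs (w i))}"
  by (auto simp: event_step_def set_walkers)

lemma set_service: "set_pmf (event_step adj tie (q, w) (Some v)) = {(q(v := q v - 1), w)}"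
  by (simp add: event_step_def)

lemma states_iff: "(q, w) \<in> S \<longleftrightarrow> (\<forall>i. w i \<in> E)"
  by (simp add: states_def)

lemma closed: "x \<in> S \<Longrightarrow> set_pmf (event_step adj tie x e) \<subseteq> S"
proof (cases x; cases e)
  fix q w assume x: "x \<in> S" "x = (q, w)" and e: "e = None"
  show ?thesis
    unfolding x(2) e set_arrival by (clarsimp simp: states_iff) (rule succs_E[THEN subsetD], blast)
qed (auto simp: set_service states_iff)

lemma closed_kernel: "x \<in> S \<Longrightarrow> set_pmf (EK J x) \<subseteq> S"
  using closed unfolding event_kernel_def set_bind_pmf by blast

text \<open>
  The Lyapunov function is \<open>\<Sum>\<^sub>v (q\<^sub>v\<^sup>2 + 2 q\<^sub>v h\<^sub>v(e))\<close>, with \<open>e\<close> the edge of one fixed walker. A job joins a queue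
  of length at most \<open>q\<^sub>p\<close>, with \<open>p\<close> the position of this walker, and raises the sum of
  squares by at most \<open>2 q\<^sub>p + 1\<close>. The step of the walker changes the corrector by about
  \<open>2 (\<Sum>\<^sub>v q\<^sub>v)/n - 2 q\<^sub>p\<close>, so \<open>q\<^sub>p\<close> cancels and on average the arrival is as harmless as
  one at a uniformly chosen server. Since \<open>\<lambda> < 1\<close>, the services outweigh the arrivals.
\<close>

lemma drift:
  obtains V :: "('v, 'd) state \<Rightarrow> real" and c where "\<And>x. 0 \<le> V x" "0 \<le> c"
    "\<And>x. x \<in> S \<Longrightarrow> (\<Sum>e\<in>running x. clock_rate lam e * (expect (event_step adj tie x e) V - V x))
        \<le> c - (1 - lam) * real (\<Sum>v\<in>UNIV. fst x v)"
proof -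
  let ?n = "real CARD('v)"
  have n: "0 < ?n" by simp
  \<comment> \<open>At total arrival rate \<open>\<lambda> n\<close> this error costs at most half of the slack \<open>2 (1 - \<lambda>)\<close>.\<close>
  define \<delta> where "\<delta> = (1 - lam) / (2 * ?n)"
  have \<delta>: "0 < \<delta>" using lam by (simp add: \<delta>_def)
  obtain h :: "'v \<Rightarrow> 'v \<times> 'v \<Rightarrow> real" and H where h: "\<And>v e. 0 \<le> h v e" "\<And>v e. h v e \<le> H"
    "\<And>v e. e \<in> E \<Longrightarrow> expect (B e) (h v) \<le> h v e + (1 / ?n + \<delta>) - of_bool (snd e = v)"
    using approximate_Poisson_equation[OF \<delta>] by blast
  define i0 :: 'd where "i0 = undefined"
  define W where "W q e = (\<Sum>v\<in>UNIV. real (q v) ^ 2 + 2 * real (q v) * h v e)" for q :: "'v \<Rightarrow> nat" and e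
  define V where "V x = W (fst x) (snd x i0)" for x :: "('v, 'd) state"
  have W_nonneg: "0 \<le> W q e" for q e unfolding W_def using h(1) by (intro sum_nonneg add_nonneg_nonneg mult_nonneg_nonneg) auto
  define a where "a = 3 + 2 * H + 2 * \<delta>"
  have a: "0 \<le> a" using h(1,2)[of undefined undefined] \<delta> by (simp add: a_def)
  have service: "expect (event_step adj tie (q, w) (Some v)) V - V (q, w) \<le> 1 - 2 * real (q v)"
    if "0 < q v" for q v and w :: "'d \<Rightarrow> 'v \<times> 'v"
  proof -
    let ?e = "w i0"
    have "W (q(v := q v - 1)) ?e - W q ?e =
       (\<Sum>u\<in>UNIV. if u = v then (real (q v - 1)^2 + 2 * real (q v - 1) * h v ?e) - (real (q v)^2 + 2 * real (q v) * h v ?e) else 0)"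
      unfolding W_def sum_subtractf[symmetric] by (intro sum.cong) auto
    also have "\<dots> = 1 - 2 * real (q v) - 2 * h v ?e"
      using that by (simp add: of_nat_diff power2_eq_square algebra_simps)
    also have "\<dots> \<le> 1 - 2 * real (q v)" using h(1) by simp
    finally show ?thesis by (simp add: event_step_def V_def)
  qed
  have arrival: "expect (event_step adj tie (q, w) None) V - V (q, w) \<le>
      2 * (1 / ?n + \<delta>) * real (\<Sum>v\<in>UNIV. q v) + a" if x: "(q, w) \<in> S" for q w
  proof -
    let ?e = "w i0"
    define p where "p = snd ?e"
    have e: "?e \<in> E" using x by (auto simp: states_iff)
    let ?bound = "W q ?e + 2 * (1 / ?n + \<delta>) * real (\<Sum>v\<in>UNIV. q v) + a"
    have W_step: "expect (B ?e) (W (q(s := q s + 1))) \<le> ?bound" if s: "s \<in> set_pmf (tie (q, w))" for s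
    proof -
      let ?q = "q(s := q s + 1)"
      have fin: "finite (set_pmf (B ?e))" by simp
      have "q s \<le> q p"
        using tie_shortest[OF x] s by (auto simp: shortest_positions_def positions_def p_def)
      have "expect (B ?e) (W ?q) =
          (\<Sum>v\<in>UNIV. real (?q v)^2 + 2 * real (?q v) * expect (B ?e) (h v))"
        unfolding W_def using integrable_finite_pmf[OF fin] by (simp add: Bochner_Integration.integral_sum)
      also have "\<dots> \<le> (\<Sum>v\<in>UNIV. real (?q v)^2 + 2 * real (?q v) * (h v ?e + (1 / ?n + \<delta>) - of_bool (p = v)))"
        by (intro sum_mono add_left_mono mult_left_mono) (auto simp: p_def h(3)[OF e])
      also have "\<dots> = (\<Sum>v\<in>UNIV. (real (q v)^2 + 2 * real (q v) * h v ?e) + 2 * (1 / ?n + \<delta>) * real (q v)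
           - (if v = p then 2 * real (q p) else 0)
           + (if v = s then 2 * real (q s) + 1 + 2 * (h s ?e + (1 / ?n + \<delta>) - of_bool (p = s)) else 0))"
        by (intro sum.cong) (auto simp: power2_eq_square algebra_simps add_divide_distrib)
      also have "\<dots> = W q ?e + 2 * (1 / ?n + \<delta>) * real (\<Sum>v\<in>UNIV. q v) - 2 * real (q p)
           + (2 * real (q s) + 1 + 2 * (h s ?e + (1 / ?n + \<delta>) - of_bool (p = s)))"
        unfolding W_def by (simp add: sum.distrib sum_subtractf sum_distrib_left)
      also have "\<dots> \<le> ?bound"
      proof -
        have aux: "W' + Y - 2 * a' + (2 * b' + 1 + 2 * (c' + (d' + \<delta>) - o')) \<le> W' + Y + (3 + 2 * H + 2 * \<delta>)"
          if "d' \<le> 1" "b' \<le> a'" "0 \<le> o'" "c' \<le> H" for W' Y a' b' c' d' o' :: real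
        proof -
          have "2 * b' \<le> 2 * a'" "2 * c' \<le> 2 * H" "2 * d' \<le> 2" "0 \<le> 2 * o'" using that by auto
          then show ?thesis unfolding distrib_left right_diff_distrib by (simp add: algebra_simps)
        qed
        have "1 / ?n \<le> 1" using n by (simp add: field_simps)
        moreover have "real (q s) \<le> real (q p)" "0 \<le> (of_bool (p = s) :: real)" using \<open>q s \<le> q p\<close> by auto
        ultimately show ?thesis using h(2)[of s ?e] unfolding a_def by (intro aux)
      qed
      finally show ?thesis .
    qed
    have marg: "expect (Pi_pmf UNIV undefined (\<lambda>i. B (w i))) (\<lambda>w'. f (w' i0)) =
        expect (B ?e) f" for f :: "_ \<Rightarrow> real"
    proof -
      have "map_pmf (\<lambda>w'. w' i0) (Pi_pmf UNIV undefined (\<lambda>i. B (w i))) = B ?e"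
        by (subst Pi_pmf_component) auto
      then show ?thesis using integral_map_pmf by metis
    qed
    have "expect (event_step adj tie (q, w) None) V =
        expect (tie (q, w)) (\<lambda>s. expect (B ?e) (W (q(s := q s + 1))))"
      unfolding event_step_def
      by (simp add: expectation_bind_finite V_def marg)
    also have "\<dots> \<le> expect (tie (q, w)) (\<lambda>s. ?bound)"
      using W_step by (intro integral_mono_AE) (auto simp: AE_measure_pmf_iff intro!: integrable_finite_pmf)
    finally show ?thesis by (simp add: V_def)
  qed
  show thesis
  proof
    show "0 \<le> V x" for x by (simp add: V_def W_nonneg)
    show "0 \<le> lam * ?n * a + ?n" using lam a by simp
    fix x assume x: "x \<in> S"
    obtain q w where [simp]: "x = (q, w)" by (cases x)
    let ?Q = "real (\<Sum>v\<in>UNIV. q v)"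
    let ?D = "\<lambda>e. expect (event_step adj tie x e) V - V x"
    have "(\<Sum>e\<in>running x. clock_rate lam e * ?D e) = lam * ?n * ?D None + (\<Sum>v | 0 < q v. ?D (Some v))"
      unfolding running_def by (subst sum.insert) (auto simp: sum.reindex clock_rate_def)
    also have "\<dots> \<le> lam * ?n * (2 * (1 / ?n + \<delta>) * ?Q + a) + (\<Sum>v | 0 < q v. 1 - 2 * real (q v))"
      using arrival[of q w] service[of q _ w] x lam by (intro add_mono mult_left_mono sum_mono) auto
    also have "(\<Sum>v | 0 < q v. 1 - 2 * real (q v)) \<le> (\<Sum>v\<in>UNIV. 1 - 2 * real (q v))"
      by (intro sum_mono2) auto
    also have "\<dots> = ?n - 2 * ?Q" by (simp add: sum_subtractf sum_distrib_left)
    also have "lam * ?n * (2 * (1 / ?n + \<delta>) * ?Q + a) + (?n - 2 * ?Q) = 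
        lam * ?n * a + ?n - (2 - 2 * lam - lam * (1 - lam)) * ?Q"
      unfolding \<delta>_def using n by (simp add: field_simps)
    also have "\<dots> \<le> lam * ?n * a + ?n - (1 - lam) * ?Q"
    proof -
      have "(1 - lam) * 1 \<le> (1 - lam) * (2 - lam)" using lam by (intro mult_left_mono) auto
      then have "(1 - lam) * ?Q \<le> (2 - 2 * lam - lam * (1 - lam)) * ?Q"
        by (intro mult_right_mono) (auto simp: algebra_simps intro: sum_nonneg)
      then show ?thesis by simp
    qed
    finally show "(\<Sum>e\<in>running x. clock_rate lam e * ?D e) \<le> lam * ?n * a + ?n - (1 - lam) * real (\<Sum>v\<in>UNIV. fst x v)"
      by simp
  qed
qed

lemma foster_drift:
  obtains V :: "('v, 'd) state \<Rightarrow> real" and F b where "\<And>x. 0 \<le> V x" "finite F"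
    "\<And>x J. x \<in> S \<Longrightarrow> running x \<subseteq> J \<Longrightarrow>
      (\<integral>\<^sup>+ y. ennreal (V y) \<partial>measure_pmf (EK J x)) + 1 \<le> ennreal (V x) + ennreal b * indicator F x"
proof -
  from drift obtain V :: "('v, 'd) state \<Rightarrow> real" and c where V: "\<And>x. 0 \<le> V x" and c: "0 \<le> c"
    and d: "\<And>x. x \<in> S \<Longrightarrow> (\<Sum>e\<in>running x. clock_rate lam e * (expect (event_step adj tie x e) V - V x))
        \<le> c - (1 - lam) * real (\<Sum>v\<in>UNIV. fst x v)" by blast
  define C where "C = (\<Sum>e\<in>(UNIV :: 'v option set). clock_rate lam e)"
  \<comment> \<open>With more than \<open>L\<close> jobs the drift is at most \<open>- C\<close>, hence at most \<open>- 1\<close> per step of a chain with rate at most \<open>C\<close>.\<close>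
  define L where "L = nat \<lceil>(c + C) / (1 - lam)\<rceil>"
  define F where "F = {x :: ('v, 'd) state. (\<Sum>v\<in>UNIV. fst x v) \<le> L}"
  define r0 where "r0 = clock_rate lam (None :: 'v option)"
  define b where "b = c / r0 + 1"
  have r0: "0 < r0" unfolding r0_def by (rule clock_rate_pos[OF lam(1)])
  have rp: "0 \<le> clock_rate lam (e :: 'v option)" for e using clock_rate_pos[OF lam(1), of e] by simp
  have finF: "finite F"
  proof (rule finite_subset)
    show "F \<subseteq> (PiE UNIV (\<lambda>_. {..L})) \<times> UNIV"
    proof
      fix x assume x: "x \<in> F"
      have "fst x v \<le> L" for v
        using member_le_sum[of v UNIV "fst x"] x by (simp add: F_def)
      then show "x \<in> (PiE UNIV (\<lambda>_. {..L})) \<times> UNIV" by (cases x) auto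
    qed
    show "finite ((PiE UNIV (\<lambda>_. {..L}) :: ('v \<Rightarrow> nat) set) \<times> (UNIV :: ('d \<Rightarrow> 'v \<times> 'v) set))"
      by (intro finite_cartesian_product finite_PiE) auto
  qed
  have main: "(\<integral>\<^sup>+ y. ennreal (V y) \<partial>measure_pmf (EK J x)) + 1 \<le> ennreal (V x) + ennreal b * indicator F x"
    if x: "x \<in> S" and J: "running x \<subseteq> J" for x J
  proof -
    let ?E = "expect (EK J x) V"
    define \<rho> where "\<rho> = (\<Sum>i\<in>J. clock_rate lam i)"
    have "None \<in> J" using J by (auto simp: running_def)
    then have \<rho>: "r0 \<le> \<rho>" "\<rho> \<le> C"
      unfolding \<rho>_def r0_def C_def by (auto intro!: member_le_sum sum_mono2 rp)
    have ineq: "\<rho> * (?E - V x) \<le> c - (1 - lam) * real (\<Sum>v\<in>UNIV. fst x v)"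
      unfolding \<rho>_def expectation_event_kernel[OF lam(1) J] by (rule d[OF x])
    have "?E + 1 \<le> V x + b * indicator F x"
    proof (cases "x \<in> F")
      case True
      have "0 \<le> (1 - lam) * real (\<Sum>v\<in>UNIV. fst x v)" using lam(2) by (intro mult_nonneg_nonneg) (auto intro: sum_nonneg)
      with ineq have "\<rho> * (?E - V x) \<le> c" by linarith
      then have "?E - V x \<le> c / \<rho>" using \<rho> r0 by (simp add: field_simps)
      also have "\<dots> \<le> c / r0" using \<rho> r0 c by (intro divide_left_mono) auto
      finally show ?thesis using True by (simp add: b_def)
    next
      case False
      have "(c + C) / (1 - lam) \<le> real L" unfolding L_def by linarith
      also have "\<dots> \<le> real (\<Sum>v\<in>UNIV. fst x v)" using False by (simp add: F_def not_le flip: of_nat_sum)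
      finally have "c + C \<le> (1 - lam) * real (\<Sum>v\<in>UNIV. fst x v)" using lam(2) by (simp add: field_simps)
      with ineq \<rho> have "\<rho> * (?E - V x) \<le> \<rho> * (-1)" by linarith
      then have "?E - V x \<le> -1" using \<rho> r0 by (subst (asm) mult_le_cancel_left_pos) auto
      then show ?thesis using False by simp
    qed
    moreover have "(\<integral>\<^sup>+ y. ennreal (V y) \<partial>measure_pmf (EK J x)) = ennreal ?E"
      by (rule nn_integral_eq_integral) (auto intro!: integrable_finite_pmf V)
    moreover have "0 \<le> ?E" by (intro Bochner_Integration.integral_nonneg V)
    moreover have "0 \<le> b" using c r0 by (simp add: b_def)
    moreover have "ennreal ?E + ennreal 1 = ennreal (?E + 1)"
      by (rule ennreal_plus[symmetric]) (simp_all add: V)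
    moreover have "ennreal (V x) + ennreal (b * indicator F x) = ennreal (V x + b * indicator F x)"
      by (rule ennreal_plus[symmetric]) (simp_all add: V \<open>0 \<le> b\<close>)
    ultimately have "ennreal ?E + ennreal 1 \<le> ennreal (V x) + ennreal (b * indicator F x)"
      by (simp only: ennreal_leI)
    then show ?thesis
      using \<open>_ = ennreal ?E\<close> by (cases "x \<in> F") simp_all
  qed
  show thesis by (rule that[OF V finF main])
qed

section \<open>Irreducibility\<close>

definition reach :: "('v, 'd) state \<Rightarrow> ('v, 'd) state \<Rightarrow> bool" where
  "reach x y \<longleftrightarrow> (\<exists>m. y \<in> set_pmf (kpow (jump_kernel adj lam tie) m x))"

lemma reach_refl: "reach x x"
  by (auto simp: reach_def intro!: exI[of _ 0])

lemma reach_trans: "reach x y \<Longrightarrow> reach y z \<Longrightarrow> reach x z"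
proof -
  assume "reach x y" "reach y z"
  then obtain m l where "y \<in> set_pmf (kpow (jump_kernel adj lam tie) m x)"
      "z \<in> set_pmf (kpow (jump_kernel adj lam tie) l y)" by (auto simp: reach_def)
  then have "z \<in> set_pmf (kpow (jump_kernel adj lam tie) (m + l) x)" by (auto simp: kpow_add)
  then show ?thesis by (auto simp: reach_def)
qed

lemma set_event_kernel: "J \<noteq> {} \<Longrightarrow> set_pmf (EK J x) = (\<Union>e\<in>J. set_pmf (event_step adj tie x e))"
  by (simp add: event_kernel_def set_event_pmf lam)

lemma running_ne: "running x \<noteq> {}"
  by (simp add: running_def)

lemma reach_event: "e \<in> running x \<Longrightarrow> y \<in> set_pmf (event_step adj tie x e) \<Longrightarrow> reach x y"
  unfolding reach_def
  by (rule exI[of _ "Suc 0"], simp only: kpow_one)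
     (auto simp: jump_kernel_def set_event_kernel running_ne)

lemma reach_service: "0 < q v \<Longrightarrow> reach (q, w) (q(v := q v - 1), w)"
  by (rule reach_event[of "Some v"]) (auto simp: running_def set_service)

lemma reach_arrival:
  "s \<in> set_pmf (tie (q, w)) \<Longrightarrow> (\<And>i. w' i \<in> succs (w i)) \<Longrightarrow> reach (q, w) (q(s := q s + 1), w')"
  by (rule reach_event[of None]) (auto simp: running_def set_arrival)

text \<open>
  Serving the arriving job immediately lets the walkers move without any effect on the queues.
\<close>

lemma reach_walk_step:
  assumes "\<And>i. w' i \<in> succs (w i)"
  shows "reach (q, w) (q, w')"
proof -
  obtain s where s: "s \<in> set_pmf (tie (q, w))" using set_pmf_not_empty by fast
  have "reach (q(s := q s + 1), w') ((q(s := q s + 1))(s := (q(s := q s + 1)) s - 1), w')"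
    by (rule reach_service) simp
  then have "reach (q(s := q s + 1), w') (q, w')" by simp
  with reach_arrival[OF s assms] show ?thesis by (rule reach_trans)
qed

lemma reach_walk_steps: "(\<And>i. w' i \<in> set_pmf (kpow B m (w i))) \<Longrightarrow> reach (q, w) (q, w')"
proof (induction m arbitrary: w)
  case 0
  then have "w' = w" by auto
  then show ?case by (simp add: reach_refl)
next
  case (Suc m)
  then have "\<forall>i. \<exists>f\<in>succs (w i). w' i \<in> set_pmf (kpow B m f)" by (simp add: set_step)
  then obtain f where "\<And>i. f i \<in> succs (w i)" "\<And>i. w' i \<in> set_pmf (kpow B m (f i))" by metis
  then show ?case using reach_walk_step Suc.IH reach_trans by blast
qed

lemma reach_walk: 
  assumes "(q, w) \<in> S" "(q, w') \<in> S"
  shows "reach (q, w) (q, w')"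
proof -
  obtain M where "\<forall>m\<ge>M. \<forall>e\<in>E. set_pmf (kpow B m e) = E" using primitive ..
  then have "\<And>i. w' i \<in> set_pmf (kpow B M (w i))" using assms by (auto simp: states_iff)
  then show ?thesis by (rule reach_walk_steps)
qed

text \<open>
  If all walkers stand at \<open>v\<close>, the next job joins the queue of \<open>v\<close> under every tie-breaking rule.
\<close>

lemma reach_add_job:
  assumes "(q, w) \<in> S"
  obtains w' where "reach (q, w) (q(v := q v + 1), w')" "(q(v := q v + 1), w') \<in> S"
proof -
  obtain u where "adj v u" using third_neighbour by blast
  then have e: "(u, v) \<in> E" by (auto simp: directed_edges_def adj_sym)
  define w0 :: "'d \<Rightarrow> 'v \<times> 'v" where "w0 = (\<lambda>_. (u, v))"
  have x0: "(q, w0) \<in> S" using e by (simp add: states_iff w0_def)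
  have "positions (q, w0) = {v}" by (auto simp: positions_def w0_def)
  then have "shortest_positions (q, w0) \<subseteq> {v}" by (auto simp: shortest_positions_def)
  then have "set_pmf (tie (q, w0)) \<subseteq> {v}" using tie_shortest[OF x0] by blast
  then have v: "v \<in> set_pmf (tie (q, w0))" using set_pmf_not_empty[of "tie (q, w0)"] by blast
  obtain f where f: "f \<in> succs (u, v)" using set_pmf_not_empty[of "B (u, v)"] by (auto simp: set_step)
  have "reach (q, w0) (q(v := q v + 1), \<lambda>_. f)" by (rule reach_arrival[OF v]) (use f in \<open>simp add: w0_def\<close>)
  with reach_walk[OF assms x0] have "reach (q, w) (q(v := q v + 1), \<lambda>_. f)" by (rule reach_trans)
  moreover have "(q(v := q v + 1), \<lambda>_. f) \<in> S" using f succs_E[of "(u, v)"] by (auto simp: states_iff)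
  ultimately show thesis by (rule that)
qed

lemma reach_empty: "reach (q, w) (\<lambda>_. 0, w)"
proof (induction "\<Sum>v\<in>UNIV. q v" arbitrary: q rule: less_induct)
  case less
  show ?case
  proof (cases "\<exists>v. 0 < q v")
    case True
    then obtain v where v: "0 < q v" ..
    have "(\<Sum>u\<in>UNIV. (q(v := q v - 1)) u) < (\<Sum>u\<in>UNIV. q u)"
      using v by (intro sum_strict_mono_ex1) auto
    from less[OF this] reach_service[of q v w, OF v] show ?thesis using reach_trans by blast
  next
    case False
    then have "q = (\<lambda>_. 0)" by auto
    then show ?thesis by (simp add: reach_refl)
  qed
qed

lemma reach_fill:
  assumes "(\<lambda>_. 0, w) \<in> S"
  shows "\<exists>w'. reach (\<lambda>_. 0, w) (q, w') \<and> (q, w') \<in> S"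
proof (induction "\<Sum>v\<in>UNIV. q v" arbitrary: q rule: less_induct)
  case less
  show ?case
  proof (cases "\<exists>v. 0 < q v")
    case True
    then obtain v where v: "0 < q v" ..
    let ?q = "q(v := q v - 1)"
    have "(\<Sum>u\<in>UNIV. ?q u) < (\<Sum>u\<in>UNIV. q u)"
      using v by (intro sum_strict_mono_ex1) auto
    from less[OF this] obtain w1 where w1: "reach (\<lambda>_. 0, w) (?q, w1)" "(?q, w1) \<in> S" by blast
    from reach_add_job[OF w1(2), of v] obtain w2 where
      "reach (?q, w1) (?q(v := ?q v + 1), w2)" "(?q(v := ?q v + 1), w2) \<in> S" .
    moreover have "?q(v := ?q v + 1) = q" using v by auto
    ultimately show ?thesis using reach_trans[OF w1(1)] by metis
  next
    case False
    then have "q = (\<lambda>_. 0)" by auto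
    then show ?thesis using assms reach_refl by auto
  qed
qed

text \<open>
  Empty all queues, build up the required queue lengths job by job, and finally move the walkers.
\<close>

theorem reach_states:
  assumes x: "x \<in> S" and y: "y \<in> S"
  shows "reach x y"
proof -
  obtain q w q' w' where [simp]: "x = (q, w)" "y = (q', w')" by (cases x; cases y)
  have x0: "(\<lambda>_. 0, w) \<in> S" using x by (simp add: states_iff)
  obtain w1 where w1: "reach (\<lambda>_. 0, w) (q', w1)" "(q', w1) \<in> S" using reach_fill[OF x0] by blast
  show ?thesis using reach_trans[OF reach_trans[OF reach_empty w1(1)] reach_walk[OF w1(2)]] y by auto
qed

lemma reach_uniform:
  assumes "x \<in> S" "y \<in> S"
  shows "\<exists>m. y \<in> set_pmf (kpow (uniform_kernel adj lam tie) m x)"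
proof -
  have "set_pmf (jump_kernel adj lam tie z) \<subseteq> set_pmf (uniform_kernel adj lam tie z)" for z
    unfolding jump_kernel_def uniform_kernel_def by (auto simp: set_event_kernel running_ne)
  from set_kpow_mono[of "jump_kernel adj lam tie" "uniform_kernel adj lam tie", OF this] reach_states[OF assms]
  show ?thesis unfolding reach_def by blast
qed

section \<open>Ergodicity of the two chains\<close>

lemma return_finite:
  assumes P: "P = (\<lambda>x. EK (J x) x)" and J: "\<And>x. running x \<subseteq> J x"
    and irr: "\<And>x y. x \<in> S \<Longrightarrow> y \<in> S \<Longrightarrow> \<exists>m. y \<in> set_pmf (kpow P m x)"
    and x: "x \<in> S"
  shows "(\<Sum>m. avoid P x m x) < \<infinity>"
proof -
  from foster_drift obtain V F b where V: "\<And>x. (0::real) \<le> V x" "finite F"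
    "\<And>x J. x \<in> S \<Longrightarrow> running x \<subseteq> J \<Longrightarrow>
      (\<integral>\<^sup>+ y. ennreal (V y) \<partial>measure_pmf (EK J x)) + 1 \<le> ennreal (V x) + ennreal b * indicator F x" by metis
  show ?thesis
  proof (rule foster_finite_return[where V="\<lambda>x. ennreal (V x)" and S=S and F=F and b="ennreal b"])
    show "set_pmf (P z) \<subseteq> S" if "z \<in> S" for z unfolding P by (rule closed_kernel[OF that])
    show "(\<integral>\<^sup>+ y. ennreal (V y) \<partial>measure_pmf (P z)) + 1 \<le> ennreal (V z) + ennreal b * indicator F z" if "z \<in> S" for z
      unfolding P by (rule V(3)[OF that J])
    show "\<exists>j\<ge>1. x \<in> set_pmf (kpow P j z)" if z: "z \<in> S" for z
    proof -
      obtain y where y: "y \<in> set_pmf (P z)" using set_pmf_not_empty by fast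
      then have "y \<in> S" using closed_kernel[OF z] unfolding P by blast
      then obtain m where "x \<in> set_pmf (kpow P m y)" using irr x by blast
      then show ?thesis using y by (intro exI[of _ "Suc m"]) auto
    qed
  qed (use V x in auto)
qed

lemma jump_return_finite: "x \<in> S \<Longrightarrow> (\<Sum>m. avoid (jump_kernel adj lam tie) x m x) < \<infinity>"
  by (rule return_finite[of _ running]) (use reach_states in \<open>auto simp: jump_kernel_def[abs_def] reach_def\<close>)

text \<open>
  At the empty state a service changes nothing, so the chain can wait there. This makes the chain
  aperiodic: any finite set of states can be reached from the empty state in a common number of
  steps.
\<close>

theorem uniform_kernel_ergodic:
  obtains p where "\<And>x f b. x \<in> S \<Longrightarrow> (\<And>z. \<bar>f z\<bar> \<le> (b::real)) \<Longrightarrow>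
    (\<lambda>m. expect (kpow (uniform_kernel adj lam tie) m x) f) \<longlonglongrightarrow> expect p f"
proof -
  let ?U = "uniform_kernel adj lam tie"
  obtain e where "e \<in> E" using E_ne by blast
  define o0 :: "('v, 'd) state" where "o0 = (\<lambda>_. 0, \<lambda>_. e)"
  have o0: "o0 \<in> S" using \<open>e \<in> E\<close> by (simp add: o0_def states_iff)
  have fin: "(\<Sum>m. avoid ?U o0 m o0) < \<infinity>"
    by (rule return_finite[of _ "\<lambda>_. UNIV"]) (use reach_uniform o0 in \<open>auto simp: uniform_kernel_def[abs_def]\<close>)
  obtain p where p: "bind_pmf p ?U = p" "o0 \<in> set_pmf p" "\<And>y. y \<in> set_pmf p \<Longrightarrow> \<exists>m. y \<in> set_pmf (kpow ?U m o0)"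
    using invariant_pmf_exists[OF fin] by blast
  have "set_pmf (event_step adj tie o0 (Some v)) = {o0}" for v
    by (simp add: o0_def set_service fun_upd_idem)
  then have "o0 \<in> set_pmf (?U o0)"
    unfolding uniform_kernel_def by (auto simp: set_event_kernel)
  then have lazy: "o0 \<in> set_pmf (kpow ?U m o0)" for m by (induction m) auto
  have reachC: "\<exists>m. C \<subseteq> set_pmf (kpow ?U m o0)" if C: "finite C" "C \<subseteq> set_pmf p" for C
  proof -
    obtain l where l: "\<And>y. y \<in> C \<Longrightarrow> y \<in> set_pmf (kpow ?U (l y) o0)" using p(3) C by (metis subsetD)
    have "y \<in> set_pmf (kpow ?U (Max (l ` C)) o0)" if y: "y \<in> C" for y
    proof -
      have "l y \<le> Max (l ` C)" using C(1) y by (intro Max_ge) auto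
      then have "kpow ?U (Max (l ` C)) o0 = bind_pmf (kpow ?U (Max (l ` C) - l y) o0) (kpow ?U (l y))"
        by (subst kpow_add[symmetric, THEN fun_cong]) simp
      then show ?thesis using lazy l[OF y] by auto
    qed
    then show ?thesis by blast
  qed
  have S_p: "x \<in> set_pmf p" if x: "x \<in> S" for x
  proof -
    obtain m where "x \<in> set_pmf (kpow ?U m o0)" using reach_uniform[OF o0 x] by blast
    then have "x \<in> set_pmf (bind_pmf p (kpow ?U m))" using p(2) by auto
    then show ?thesis by (simp add: bind_kpow[OF p(1)])
  qed
  show thesis
    by (rule that, rule kpow_converges[OF p(1,2)]) (use reachC S_p in auto)
qed

end

section \<open>The law of the sequence of configurations\<close>

text \<open>
  \<open>h s y\<close> is to be read as the value of being in state \<open>y\<close> directly after an event at time \<open>s\<close>. The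
  operator gives its expectation one event earlier; only jumps into \<open>B\<close> count.
\<close>

definition jump_op :: "('v::finite \<Rightarrow> 'v \<Rightarrow> bool) \<Rightarrow> real \<Rightarrow> (('v, 'd::finite) state \<Rightarrow> 'v pmf) \<Rightarrow> ('v, 'd) state set \<Rightarrow>
    (real \<Rightarrow> ('v, 'd) state \<Rightarrow> ennreal) \<Rightarrow> real \<Rightarrow> ('v, 'd) state \<Rightarrow> ennreal" where
  "jump_op adj lam tie B h s x = (\<integral>\<^sup>+ r. ennreal (exponential_density (total_rate lam x) r) *
     (\<integral>\<^sup>+ y. indicator B y * h (s + r) y \<partial>measure_pmf (jump_kernel adj lam tie x)) \<partial>lborel)"

text \<open>
  The average over the clocks given the state, at a moment when all clocks are fresh.
\<close>

definition fresh_mean :: "real \<Rightarrow> (real \<Rightarrow> ('v::finite, 'd) config \<Rightarrow> ennreal) \<Rightarrow> real \<Rightarrow> ('v, 'd) state \<Rightarrow> ennreal" where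
  "fresh_mean lam g s x = (\<integral>\<^sup>+ c. g s (x, c) \<partial>fresh_clocks lam)"

lemma running_nonempty: "running x \<noteq> {}"
  by (simp add: running_def)

lemma swap_pmf_integral:
  assumes p: "finite (set_pmf p)" and [measurable]: "\<And>y. f y \<in> borel_measurable N"
  shows "(\<integral>\<^sup>+ y. \<integral>\<^sup>+ r. f y r \<partial>N \<partial>measure_pmf p) = (\<integral>\<^sup>+ r. \<integral>\<^sup>+ y. f y r \<partial>measure_pmf p \<partial>N)"
  using p by (simp add: nn_integral_measure_pmf_finite nn_integral_sum nn_integral_multc)

lemma measurable_waiting_time [measurable]:
  "waiting_time \<in> borel_measurable (config_space :: ('v::finite, 'd::finite) config measure)"
proof -
  have "next_event \<in> (config_space :: ('v, 'd) config measure) \<rightarrow>\<^sub>M count_space UNIV"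
    unfolding config_space_def
    by (intro measurable_pair_measure_countable1) (auto intro: measurable_next_event)
  moreover have "(\<lambda>z. snd z i) \<in> borel_measurable (config_space :: ('v, 'd) config measure)" for i
    unfolding config_space_def
    by (rule measurable_compose[OF measurable_snd measurable_component_singleton]) simp
  ultimately show ?thesis
    unfolding waiting_time_def[abs_def] by (rule measurable_compose_countable[rotated])
qed

lemma measurable_fst_config [measurable]:
  "fst \<in> (config_space :: ('v, 'd) config measure) \<rightarrow>\<^sub>M count_space UNIV"
  unfolding config_space_def by simp

lemma nn_integral_config_step:
  fixes z :: "('v::finite, 'd::finite) config"
  assumes lam: "0 < lam" and [measurable]: "f \<in> borel_measurable config_space"
  shows "(\<integral>\<^sup>+ z'. f z' \<partial>config_step adj lam tie z) =
    (\<integral>\<^sup>+ r. \<integral>\<^sup>+ y. f (y, renew_clocks z r) \<partial>measure_pmf (event_step adj tie (fst z) (next_event z))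
      \<partial>clock_law lam (next_event z))"
proof -
  have m: "(\<lambda>r. (y, renew_clocks z r)) \<in> clock_law lam e \<rightarrow>\<^sub>M config_space"
    for y :: "('v, 'd) state" and e :: "'v option"
    unfolding config_space_def renew_clocks_def
    by (intro measurable_Pair measurable_PiM_single') auto
  have fm: "(\<lambda>r. f (y, renew_clocks z r)) \<in> borel_measurable (clock_law lam e)" for y and e :: "'v option"
    by (rule measurable_compose[OF m assms(2)])
  have "(\<integral>\<^sup>+ z'. f z' \<partial>config_step adj lam tie z) =
    (\<integral>\<^sup>+ y. \<integral>\<^sup>+ z'. f z' \<partial>distr (clock_law lam (next_event z)) config_space (\<lambda>r. (y, renew_clocks z r))
      \<partial>measure_pmf (event_step adj tie (fst z) (next_event z)))"
    unfolding config_step_def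
    by (rule nn_integral_bind[where B=config_space])
       (auto simp: space_subprob_algebra m intro!: prob_space_imp_subprob_space prob_space.prob_space_distr
         prob_space_clock_law lam)
  also have "\<dots> = (\<integral>\<^sup>+ y. \<integral>\<^sup>+ r. f (y, renew_clocks z r) \<partial>clock_law lam (next_event z)
      \<partial>measure_pmf (event_step adj tie (fst z) (next_event z)))"
    by (simp add: nn_integral_distr m)
  also have "\<dots> = (\<integral>\<^sup>+ r. \<integral>\<^sup>+ y. f (y, renew_clocks z r) \<partial>measure_pmf (event_step adj tie (fst z) (next_event z))
      \<partial>clock_law lam (next_event z))"
    by (rule swap_pmf_integral) (auto intro: fm)
  finally show ?thesis .
qed

text \<open>
  Averaging over fresh clocks commutes with a step: this is the Markov property of the pair (time,
  state), obtained from the memorylessness of the clocks.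
\<close>

lemma fresh_config_step:
  fixes x :: "('v::finite, 'd::finite) state"
  assumes lam: "0 < lam" and g: "case_prod g \<in> borel_measurable (borel \<Otimes>\<^sub>M config_space)"
  shows "(\<integral>\<^sup>+ c. \<integral>\<^sup>+ z'. indicator B (fst z') * g (s + waiting_time (x, c)) z' \<partial>config_step adj lam tie (x, c)
      \<partial>fresh_clocks lam) = jump_op adj lam tie B (fresh_mean lam g) s x"
proof -
  let ?R = "total_rate lam x"
  define G where "G e t c = (\<integral>\<^sup>+ y. indicator B y * g (s + t) (y, c) \<partial>measure_pmf (event_step adj tie x e))" for e t c
  interpret P: prob_space "fresh_clocks lam :: ('v option \<Rightarrow> real) measure"
    by (rule prob_space_fresh_clocks[OF lam])
  have gy: "(\<lambda>p. g (s + fst p) (y, snd p)) \<in> borel_measurable (borel \<Otimes>\<^sub>M clock_space)" for y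
  proof -
    have "(\<lambda>p. (s + fst p, (y, snd p))) \<in> borel \<Otimes>\<^sub>M clock_space \<rightarrow>\<^sub>M borel \<Otimes>\<^sub>M config_space"
      unfolding config_space_def by measurable
    from measurable_compose[OF this g] show ?thesis by simp
  qed
  have gc: "(\<lambda>c. g t (y, c)) \<in> borel_measurable (clock_space)" for y t
    using measurable_Pair2[OF gy[of y], of "t - s"] by simp
  have gz: "(\<lambda>z'. indicator B (fst z') * g t z') \<in> borel_measurable config_space" for t
  proof -
    have "(\<lambda>z. indicator B (fst z) :: ennreal) \<in> borel_measurable (config_space :: ('v, 'd) config measure)"
      by (rule measurable_compose[OF measurable_fst_config]) simp
    then show ?thesis using measurable_Pair2[OF g, of t] by simp
  qed
  have G: "case_prod (G e) \<in> borel_measurable (borel \<Otimes>\<^sub>M clock_space)" for e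
    unfolding G_def using gy by (simp add: nn_integral_measure_pmf_finite split_beta')
  have fm: "(\<lambda>t. fresh_mean lam g (s + t) y) \<in> borel_measurable borel" for y
    unfolding fresh_mean_def using gy[of y] by (intro P.borel_measurable_nn_integral) (simp add: split_beta')
  have "(\<integral>\<^sup>+ c. \<integral>\<^sup>+ z'. indicator B (fst z') * g (s + waiting_time (x, c)) z' \<partial>config_step adj lam tie (x, c)
      \<partial>fresh_clocks lam) =
    (\<integral>\<^sup>+ c. \<integral>\<^sup>+ r. G (next_event (x, c)) (waiting_time (x, c)) (renew_clocks (x, c) r)
        \<partial>clock_law lam (next_event (x, c)) \<partial>fresh_clocks lam)"
    by (simp add: nn_integral_config_step[OF lam gz] G_def)
  also have "\<dots> = (\<Sum>e\<in>running x. ennreal (clock_rate lam e / ?R) *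
      (\<integral>\<^sup>+ t. ennreal (exponential_density ?R t) * (\<integral>\<^sup>+ c. G e t c \<partial>fresh_clocks lam) \<partial>lborel))"
    by (rule fresh_clocks_step[OF lam G])
  also have "(\<lambda>e t. \<integral>\<^sup>+ c. G e t c \<partial>fresh_clocks lam) =
      (\<lambda>e t. \<integral>\<^sup>+ y. indicator B y * fresh_mean lam g (s + t) y \<partial>measure_pmf (event_step adj tie x e))"
    unfolding G_def fresh_mean_def using gc
    by (intro ext) (subst swap_pmf_integral[symmetric], auto simp: nn_integral_cmult)
  also have "(\<Sum>e\<in>running x. ennreal (clock_rate lam e / ?R) *
      (\<integral>\<^sup>+ t. ennreal (exponential_density ?R t) *
        (\<integral>\<^sup>+ y. indicator B y * fresh_mean lam g (s + t) y \<partial>measure_pmf (event_step adj tie x e)) \<partial>lborel)) =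
    (\<integral>\<^sup>+ t. (\<Sum>e\<in>running x. ennreal (clock_rate lam e / ?R) * (ennreal (exponential_density ?R t) *
        (\<integral>\<^sup>+ y. indicator B y * fresh_mean lam g (s + t) y \<partial>measure_pmf (event_step adj tie x e)))) \<partial>lborel)"
    using fm by (subst nn_integral_sum) (auto simp: nn_integral_measure_pmf_finite nn_integral_cmult)
  also have "\<dots> = jump_op adj lam tie B (fresh_mean lam g) s x"
    unfolding jump_op_def jump_kernel_def event_kernel_def
    by (intro nn_integral_cong)
       (simp add: nn_integral_event[OF lam running_nonempty] total_rate_def sum_distrib_left mult.left_commute)
  finally show ?thesis .
qed

text \<open>
  All functionals of the path that occur below have this form. The set \<open>B\<close> restricts the states
  after the events \<open>1, \<dots>, m\<close>; it is the whole space, a single state or the complement of one.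
\<close>

definition history :: "('v::finite, 'd::finite) state set \<Rightarrow> nat \<Rightarrow> (real \<Rightarrow> ('v, 'd) config \<Rightarrow> ennreal) \<Rightarrow>
    (nat \<Rightarrow> ('v, 'd) config) \<Rightarrow> ennreal" where
  "history B m g \<omega> = (\<Prod>i\<in>{1..m}. indicator B (fst (\<omega> i))) * g (event_time m \<omega>) (\<omega> m)"

lemma measurable_component_config: "i \<in> I \<Longrightarrow> (\<lambda>\<omega>. \<omega> i) \<in> Pi\<^sub>M I (\<lambda>_. config_space) \<rightarrow>\<^sub>M config_space"
  by (rule measurable_component_singleton)

lemma measurable_event_time:
  "{..<m} \<subseteq> I \<Longrightarrow> event_time m \<in> borel_measurable (Pi\<^sub>M I (\<lambda>_. config_space :: ('v::finite, 'd::finite) config measure))"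
  unfolding event_time_def
  by (intro borel_measurable_sum measurable_compose[OF measurable_component_config measurable_waiting_time]) auto

lemma measurable_history:
  fixes g :: "real \<Rightarrow> ('v::finite, 'd::finite) config \<Rightarrow> ennreal"
  assumes g: "case_prod g \<in> borel_measurable (borel \<Otimes>\<^sub>M config_space)" and I: "{..m} \<subseteq> I"
  shows "history B m g \<in> borel_measurable (Pi\<^sub>M I (\<lambda>_. config_space))"
proof -
  let ?c = "config_space :: ('v, 'd) config measure"
  have "(\<lambda>\<omega>. (event_time m \<omega>, \<omega> m)) \<in> Pi\<^sub>M I (\<lambda>_. ?c) \<rightarrow>\<^sub>M borel \<Otimes>\<^sub>M ?c"
  proof (rule measurable_Pair)
    show "event_time m \<in> borel_measurable (Pi\<^sub>M I (\<lambda>_. ?c))"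
      by (rule measurable_event_time) (use I in auto)
    show "(\<lambda>\<omega>. \<omega> m) \<in> Pi\<^sub>M I (\<lambda>_. ?c) \<rightarrow>\<^sub>M ?c"
      by (rule measurable_component_config) (use I in auto)
  qed
  from measurable_compose[OF this g]
  have "(\<lambda>\<omega>. g (event_time m \<omega>) (\<omega> m)) \<in> borel_measurable (Pi\<^sub>M I (\<lambda>_. ?c))" by simp
  moreover have "(\<lambda>\<omega>. indicator B (fst (\<omega> i)) :: ennreal) \<in> borel_measurable (Pi\<^sub>M I (\<lambda>_. ?c))" if "i \<in> {1..m}" for i
    using I that
    by (intro measurable_compose[OF measurable_compose[OF measurable_component_config measurable_fst_config]]) auto
  ultimately show ?thesis
    unfolding history_def[abs_def] by (intro borel_measurable_times_ennreal borel_measurable_prod_ennreal) auto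
qed

lemma history_cong:
  "(\<And>i. i \<le> m \<Longrightarrow> \<omega> i = \<omega>' i) \<Longrightarrow> history B m g \<omega> = history B m g \<omega>'"
  by (auto simp: history_def event_time_def intro!: arg_cong2[where f="(*)"] prod.cong
      arg_cong2[where f=g] sum.cong)

lemma history_Suc:
  "history B (Suc m) g (fun_upd \<omega> (Suc m) z) =
   (\<Prod>i\<in>{1..m}. indicator B (fst (\<omega> i))) * (indicator B (fst z) * g (event_time m \<omega> + waiting_time (\<omega> m)) z)"
proof -
  have "event_time (Suc m) (fun_upd \<omega> (Suc m) z) = event_time m \<omega> + waiting_time (\<omega> m)"
    by (simp add: event_time_def)
  moreover have "(\<Prod>i\<in>{1..m}. indicator B (fst (fun_upd \<omega> (Suc m) z i))) = (\<Prod>i\<in>{1..m}. indicator B (fst (\<omega> i)) :: ennreal)"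
    by (intro prod.cong) auto
  ultimately show ?thesis by (simp add: history_def mult.assoc)
qed

text \<open>
  The path measure is built forwards, while the operator acts backwards: the last step of the path
  is integrated out first, which replaces \<open>g\<close> by a function whose mean over fresh clocks is
  \<open>jump_op\<close> applied to that of \<open>g\<close>.
\<close>

theorem path_nn_integral:
  fixes tie :: "('v::finite, 'd::finite) state \<Rightarrow> 'v pmf"
  assumes lam: "0 < lam" and g: "case_prod g \<in> borel_measurable (borel \<Otimes>\<^sub>M config_space)"
  shows "(\<integral>\<^sup>+ \<omega>. history B m g \<omega> \<partial>path_measure adj lam tie \<mu>) =
    (\<integral>\<^sup>+ x. (jump_op adj lam tie B ^^ m) (fresh_mean lam g) 0 x \<partial>measure_pmf \<mu>)"
proof -
  let ?c = "config_space :: ('v, 'd) config measure" and ?u = "\<lambda>_. undefined :: ('v, 'd) config"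
  interpret IT: Ionescu_Tulcea "config_kernel adj lam tie \<mu>" "\<lambda>_. ?c"
    by (rule Ionescu_Tulcea_config_kernel[OF lam])
  have u: "?u \<in> space (Pi\<^sub>M {0..<0} (\<lambda>_. ?c))"
    by (auto simp: space_PiM PiE_iff extensional_def)
  have "(\<integral>\<^sup>+ \<omega>. history B m g \<omega> \<partial>path_measure adj lam tie \<mu>) = (\<integral>\<^sup>+ \<omega>. history B m g \<omega> \<partial>IT.C 0 (Suc m) ?u)"
  proof -
    let ?J = "{0..<Suc m}"
    have up: "IT.up_to ?J = Suc m"
      using IT.up_to_iff_Ico[of ?J "Suc m"] IT.up_to[of ?J] by (intro antisym) (auto simp: subset_eq)
    have hJ: "history B m g \<in> borel_measurable (Pi\<^sub>M ?J (\<lambda>_. ?c))" by (intro measurable_history g) auto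
    have r: "history B m g (restrict \<omega> ?J) = history B m g \<omega>" for \<omega> by (rule history_cong) auto
    have mr: "(\<lambda>\<omega>. restrict \<omega> ?J) \<in> path_measure adj lam tie \<mu> \<rightarrow>\<^sub>M Pi\<^sub>M ?J (\<lambda>_. ?c)"
      unfolding path_measure_def
      by (subst measurable_cong_sets[OF IT.PF.sets_lim refl]) (auto intro!: measurable_restrict measurable_component_singleton)
    have mr': "(\<lambda>\<omega>. restrict \<omega> ?J) \<in> IT.C 0 (Suc m) ?u \<rightarrow>\<^sub>M Pi\<^sub>M ?J (\<lambda>_. ?c)"
      by (subst measurable_cong_sets[OF IT.sets_C[OF u] refl]) (auto intro!: measurable_restrict measurable_component_singleton)
    have "(\<integral>\<^sup>+ \<omega>. history B m g \<omega> \<partial>path_measure adj lam tie \<mu>) =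
        (\<integral>\<^sup>+ \<omega>. history B m g \<omega> \<partial>distr (path_measure adj lam tie \<mu>) (Pi\<^sub>M ?J (\<lambda>_. ?c)) (\<lambda>\<omega>. restrict \<omega> ?J))"
      by (subst nn_integral_distr[OF mr], simp add: hJ, simp only: r)
    also have "distr (path_measure adj lam tie \<mu>) (Pi\<^sub>M ?J (\<lambda>_. ?c)) (\<lambda>\<omega>. restrict \<omega> ?J) = IT.CI ?J"
      unfolding path_measure_def by (rule IT.distr_lim) simp
    also have "(\<integral>\<^sup>+ \<omega>. history B m g \<omega> \<partial>IT.CI ?J) = (\<integral>\<^sup>+ \<omega>. history B m g \<omega> \<partial>IT.C 0 (Suc m) ?u)"
      unfolding IT.CI_def up by (subst nn_integral_distr[OF mr'], simp add: hJ, simp only: r)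
    finally show ?thesis .
  qed
  also have "\<dots> = (\<integral>\<^sup>+ x. (jump_op adj lam tie B ^^ m) (fresh_mean lam g) 0 x \<partial>measure_pmf \<mu>)"
    using g
  proof (induction m arbitrary: g)
    case 0
    have h0: "history B 0 g \<in> borel_measurable (Pi\<^sub>M {0..<Suc 0} (\<lambda>_. ?c))"
      by (intro measurable_history 0) auto
    have g0: "(\<lambda>z. g 0 z) \<in> borel_measurable ?c" using measurable_Pair2[OF 0, of 0] by simp
    have "(\<integral>\<^sup>+ \<omega>. history B 0 g \<omega> \<partial>IT.C 0 (Suc 0) ?u) = (\<integral>\<^sup>+ z. g 0 z \<partial>initial_config lam \<mu>)"
    proof -
      have "IT.C 0 (Suc 0) ?u = IT.eP 0 ?u"
        using bind_return[OF IT.measurable_eP[of 0] u] by (simp only: IT.C.simps add_0_left)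
      then show ?thesis
        using IT.nn_integral_eP[OF u h0] by (simp add: config_kernel_def history_def event_time_def)
    qed
    also have "\<dots> = (\<integral>\<^sup>+ x. \<integral>\<^sup>+ c. g 0 (x, c) \<partial>fresh_clocks lam \<partial>measure_pmf \<mu>)"
      unfolding initial_config_def
    proof (rule sigma_finite_measure.nn_integral_fst[symmetric])
      show "sigma_finite_measure (fresh_clocks lam)" by (intro prob_space_imp_sigma_finite prob_space_fresh_clocks lam)
      show "g 0 \<in> borel_measurable (measure_pmf \<mu> \<Otimes>\<^sub>M fresh_clocks lam)"
        using g0 sets_initial_config[of lam \<mu>] unfolding initial_config_def
        by (simp cong: measurable_cong_sets)
    qed
    finally show ?case by (simp add: fresh_mean_def)
  next
    case (Suc m)
    \<comment> \<open>The value of \<open>g\<close> after one more step, as a function of the time and configuration before it.\<close>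
    define g' where "g' s z = (\<integral>\<^sup>+ z'. indicator B (fst z') * g (s + waiting_time z) z' \<partial>config_step adj lam tie z)" for s z
    have g': "case_prod g' \<in> borel_measurable (borel \<Otimes>\<^sub>M config_space)"
    proof -
      have 1: "(\<lambda>q. (fst (fst q) + waiting_time (snd (fst q)), snd q)) \<in> (borel \<Otimes>\<^sub>M ?c) \<Otimes>\<^sub>M ?c \<rightarrow>\<^sub>M borel \<Otimes>\<^sub>M ?c"
        by measurable
      have 2: "(\<lambda>q. indicator B (fst (snd q)) :: ennreal) \<in> borel_measurable ((borel \<Otimes>\<^sub>M ?c) \<Otimes>\<^sub>M ?c)"
        by (rule measurable_compose[OF measurable_compose[OF measurable_snd measurable_fst_config]]) simp
      have 3: "(\<lambda>q. config_step adj lam tie (snd q)) \<in> borel \<Otimes>\<^sub>M ?c \<rightarrow>\<^sub>M subprob_algebra ?c"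
        by (rule measurable_compose[OF measurable_snd measurable_config_step[OF lam]])
      show ?thesis
        unfolding g'_def split_beta'
        by (rule nn_integral_measurable_subprob_algebra2[OF _ 3])
           (use measurable_compose[OF 1 Suc.prems] 2 in \<open>simp add: split_beta'\<close>)
    qed
    have mean: "fresh_mean lam g' = jump_op adj lam tie B (fresh_mean lam g)"
      by (intro ext) (simp only: fresh_mean_def[of lam g'] g'_def fresh_config_step[OF lam Suc.prems])
    have hS: "history B (Suc m) g \<in> borel_measurable (Pi\<^sub>M {0..<Suc (Suc m)} (\<lambda>_. ?c))"
      by (intro measurable_history Suc.prems) auto
    have "(\<integral>\<^sup>+ \<omega>. history B (Suc m) g \<omega> \<partial>IT.C 0 (Suc (Suc m)) ?u) =
        (\<integral>\<^sup>+ \<omega>. \<integral>\<^sup>+ \<omega>'. history B (Suc m) g \<omega>' \<partial>IT.eP (Suc m) \<omega> \<partial>IT.C 0 (Suc m) ?u)"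
      unfolding IT.C.simps(2)[of 0 "Suc m"]
      by (subst nn_integral_bind[where B="Pi\<^sub>M {0..<Suc (Suc m)} (\<lambda>_. ?c)"])
         (use hS IT.measurable_eP[of "Suc m"] in \<open>auto simp: measurable_cong_sets[OF IT.sets_C[OF u] refl] simp del: IT.C.simps\<close>)
    also have "\<dots> = (\<integral>\<^sup>+ \<omega>. history B m g' \<omega> \<partial>IT.C 0 (Suc m) ?u)"
    proof (rule nn_integral_cong)
      fix \<omega> assume "\<omega> \<in> space (IT.C 0 (Suc m) ?u)"
      then have \<omega>: "\<omega> \<in> space (Pi\<^sub>M {0..<Suc m} (\<lambda>_. ?c))" using IT.space_C[OF u, of "Suc m"] by simp
      have gz: "(\<lambda>z'. indicator B (fst z') * g t z') \<in> borel_measurable ?c" for t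
      proof -
        have "(\<lambda>z. indicator B (fst z) :: ennreal) \<in> borel_measurable ?c"
          by (rule measurable_compose[OF measurable_fst_config]) simp
        then show ?thesis using measurable_Pair2[OF Suc.prems, of t] by simp
      qed
      have "(\<integral>\<^sup>+ \<omega>'. history B (Suc m) g \<omega>' \<partial>IT.eP (Suc m) \<omega>) =
          (\<integral>\<^sup>+ z. history B (Suc m) g (fun_upd \<omega> (Suc m) z) \<partial>config_step adj lam tie (\<omega> m))"
        using IT.nn_integral_eP[OF \<omega> hS] by (simp add: config_kernel_def)
      also have "\<dots> = history B m g' \<omega>"
        unfolding history_Suc using gz measurable_config_step[OF lam, of adj tie]
        by (subst nn_integral_cmult)
           (auto simp: history_def g'_def subprob_measurableD(2)[OF measurable_config_step[OF lam]] cong: measurable_cong_sets)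
      finally show "(\<integral>\<^sup>+ \<omega>'. history B (Suc m) g \<omega>' \<partial>IT.eP (Suc m) \<omega>) = history B m g' \<omega>" .
    qed
    also have "\<dots> = (\<integral>\<^sup>+ x. (jump_op adj lam tie B ^^ m) (fresh_mean lam g') 0 x \<partial>measure_pmf \<mu>)"
      by (rule Suc.IH[OF g'])
    finally show ?case unfolding mean funpow_Suc_right by simp
  qed
  finally show ?thesis .
qed

section \<open>Averages over a Poisson variable\<close>

text \<open>
  The mean of \<open>a\<close> at a Poisson variable with parameter \<open>r\<close>, written as a power series so that it can
  be differentiated in \<open>r\<close>.
\<close>

definition poisson_mean :: "(nat \<Rightarrow> real) \<Rightarrow> real \<Rightarrow> real" where
  "poisson_mean a r = exp (- r) * (\<Sum>m. a m / fact m * r ^ m)"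

lemma summable_poisson:
  assumes "\<And>m. \<bar>a m\<bar> \<le> (b::real)" shows "summable (\<lambda>m. a m / fact m * r ^ m)"
proof (rule summable_comparison_test')
  show "summable (\<lambda>m. b * (inverse (fact m) * \<bar>r\<bar> ^ m))"
    by (intro summable_mult summable_exp)
  show "norm (a m / fact m * r ^ m) \<le> b * (inverse (fact m) * \<bar>r\<bar> ^ m)" if "0 \<le> m" for m
    using mult_right_mono[OF assms[of m], of "inverse (fact m) * \<bar>r\<bar> ^ m"]
    by (simp add: abs_mult power_abs divide_inverse mult.assoc)
qed

lemma poisson_mean_0 [simp]: "poisson_mean a 0 = a 0"
  using powser_zero[of "\<lambda>m. a m / fact m"] by (simp add: poisson_mean_def)

lemma poisson_mean_const: "poisson_mean (\<lambda>_. c) r = c"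
proof -
  have "(\<lambda>m. c * (r ^ m /\<^sub>R fact m)) sums (c * exp r)"
    by (intro sums_mult exp_converges)
  then have "(\<Sum>m. c / fact m * r ^ m) = c * exp r"
    by (simp add: sums_iff divide_inverse mult_ac)
  then show ?thesis by (simp add: poisson_mean_def exp_minus)
qed

lemma poisson_mean_nonneg:
  assumes "\<And>m. 0 \<le> a m" "\<And>m. \<bar>a m\<bar> \<le> b" "0 \<le> r"
  shows "0 \<le> poisson_mean a r"
  unfolding poisson_mean_def
  by (intro mult_nonneg_nonneg suminf_nonneg summable_poisson[OF assms(2)]) (use assms in auto)

lemma poisson_mean_linear:
  assumes a: "\<And>m. \<bar>a m\<bar> \<le> A" and b: "\<And>m. \<bar>b m\<bar> \<le> B"
  shows "poisson_mean (\<lambda>m. x * a m + y * b m) r = x * poisson_mean a r + y * poisson_mean b r"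
proof -
  note sa = summable_poisson[of a A r, OF a] and sb = summable_poisson[of b B r, OF b]
  have "(\<Sum>m. (x * a m + y * b m) / fact m * r ^ m) =
      (\<Sum>m. x * (a m / fact m * r ^ m) + y * (b m / fact m * r ^ m))"
    by (simp add: add_divide_distrib distrib_right mult.assoc)
  also have "\<dots> = x * (\<Sum>m. a m / fact m * r ^ m) + y * (\<Sum>m. b m / fact m * r ^ m)"
    using sa sb by (simp only: suminf_add[symmetric] summable_mult suminf_mult)
  finally show ?thesis by (simp add: poisson_mean_def algebra_simps)
qed

lemma poisson_mean_sum:
  assumes "finite I" and a: "\<And>i m. \<bar>a i m\<bar> \<le> (A::real)"
  shows "poisson_mean (\<lambda>m. \<Sum>i\<in>I. c i * a i m) r = (\<Sum>i\<in>I. c i * poisson_mean (a i) r)"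
  using assms(1)
proof (induction I)
  case (insert j I)
  have "\<bar>\<Sum>i\<in>I. c i * a i m\<bar> \<le> (\<Sum>i\<in>I. \<bar>c i\<bar> * A)" for m
    by (rule order_trans[OF sum_abs]) (auto intro!: sum_mono mult_left_mono a simp: abs_mult)
  from poisson_mean_linear[of "a j" A "\<lambda>m. \<Sum>i\<in>I. c i * a i m" _ "c j" 1 r, OF a this] insert show ?case by simp
qed (simp add: poisson_mean_def)

lemma poisson_mean_deriv:
  assumes a: "\<And>m. \<bar>a m\<bar> \<le> (A::real)"
  shows "(poisson_mean a has_real_derivative (poisson_mean (\<lambda>m. a (Suc m)) r - poisson_mean a r)) (at r)"
proof -
  have "diffs (\<lambda>m. a m / fact m) = (\<lambda>m. a (Suc m) / fact m)"
    by (simp add: diffs_def fun_eq_iff field_simps del: of_nat_Suc)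
  then have "((\<lambda>r. \<Sum>m. a m / fact m * r ^ m) has_real_derivative (\<Sum>m. a (Suc m) / fact m * r ^ m)) (at r)"
    using termdiffs_strong_converges_everywhere[of "\<lambda>m. a m / fact m" r, OF summable_poisson[OF a]] by simp
  then show ?thesis
    unfolding poisson_mean_def[abs_def]
    by (auto intro!: derivative_eq_intros simp: algebra_simps)
qed

lemma expectation_poisson_pmf:
  assumes r: "0 < r" and a: "\<And>m. \<bar>a m\<bar> \<le> A"
  shows "expect (poisson_pmf r) a = poisson_mean a r"
proof -
  have int: "integrable (measure_pmf (poisson_pmf r)) a" by (rule integrable_pmf_bounded[OF a])
  have "expect (poisson_pmf r) a = (\<integral>m. pmf (poisson_pmf r) m * a m \<partial>count_space UNIV)"
    unfolding measure_pmf_eq_density by (subst integral_density) auto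
  also have "\<dots> = (\<Sum>m. pmf (poisson_pmf r) m * a m)"
    using int unfolding measure_pmf_eq_density
    by (intro integral_count_space_nat) (simp add: integrable_density)
  also have "\<dots> = (\<Sum>m. exp (- r) * (a m / fact m * r ^ m))"
    using r by (simp add: pmf_poisson field_simps)
  also have "\<dots> = poisson_mean a r"
    unfolding poisson_mean_def by (intro suminf_mult summable_poisson[OF a])
  finally show ?thesis .
qed

text \<open>
  A Poisson variable with a large parameter is unlikely to be below any given \<open>N\<close>.
\<close>

lemma poisson_mean_tendsto:
  assumes a: "\<And>m. \<bar>a m\<bar> \<le> A" and lim: "a \<longlonglongrightarrow> l"
  shows "(poisson_mean a \<longlongrightarrow> l) at_top"
proof -
  have A: "0 \<le> A" using order_trans[OF abs_ge_zero a] .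
  have l: "\<bar>l\<bar> \<le> A"
    by (rule LIMSEQ_le_const2[OF tendsto_rabs[OF lim]]) (use a in blast)
  show ?thesis
  proof (rule tendstoI)
    fix e :: real assume e: "0 < e"
    then obtain N where N: "\<And>m. N \<le> m \<Longrightarrow> \<bar>a m - l\<bar> < e / 2"
      using LIMSEQ_D[OF lim, of "e / 2"] by auto
    have "((\<lambda>r. \<Sum>m<N. (2 * A) * (r ^ m / exp r / fact m)) \<longlongrightarrow> (\<Sum>m<N. (2 * A) * (0 / fact m))) at_top"
      by (intro tendsto_intros tendsto_power_div_exp_0) auto
    then have "\<forall>\<^sub>F r in at_top. (\<Sum>m<N. (2 * A) * (r ^ m / exp r / fact m)) < e / 2"
      by (rule order_tendstoD) (use e in auto)
    then show "\<forall>\<^sub>F r in at_top. dist (poisson_mean a r) l < e"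
      using eventually_gt_at_top[of 0]
    proof eventually_elim
      case (elim r)
      let ?p = "poisson_pmf r"
      have bd: "\<bar>\<bar>a m - l\<bar>\<bar> \<le> 2 * A" for m using a[of m] l by linarith
      have "\<bar>poisson_mean a r - l\<bar> = \<bar>expect ?p (\<lambda>m. a m - l)\<bar>"
        using elim(2) expectation_poisson_pmf[of r a A, OF _ a] integrable_pmf_bounded[of a A, OF a] by simp
      also have "\<dots> \<le> expect ?p (\<lambda>m. \<bar>a m - l\<bar>)" by (rule integral_abs_bound)
      also have "\<dots> \<le> expect ?p (\<lambda>m. e / 2 + (2 * A) * indicator {..<N} m)"
      proof (rule integral_mono)
        show "integrable (measure_pmf ?p) (\<lambda>m. \<bar>a m - l\<bar>)" by (rule integrable_pmf_bounded[OF bd])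
        show "integrable (measure_pmf ?p) (\<lambda>m. e / 2 + (2 * A) * indicator {..<N} m)"
          using A e by (intro integrable_pmf_bounded[where B="e / 2 + 2 * A"]) (auto simp: indicator_def)
        show "\<bar>a m - l\<bar> \<le> e / 2 + (2 * A) * indicator {..<N} m" for m
          using bd[of m] N[of m] e by (auto simp: indicator_def not_less)
      qed
      also have "\<dots> = e / 2 + (2 * A) * measure_pmf.prob ?p {..<N}"
      proof -
        have "integrable (measure_pmf ?p) (\<lambda>m. (2 * A) * indicator {..<N} m)"
          using A by (intro integrable_pmf_bounded[where B="2 * A"]) (auto simp: indicator_def)
        then show ?thesis by simp
      qed
      also have "measure_pmf.prob ?p {..<N} = (\<Sum>i<N. pmf ?p i)" by (rule measure_measure_pmf_finite) simp
      also have "(2 * A) * \<dots> < e / 2"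
        using elim by (simp add: pmf_poisson exp_minus field_simps sum_distrib_left)
      finally show ?case by (simp add: dist_real_def)
    qed
  qed
qed

section \<open>The jump operator\<close>

lemma nn_integral_exponential_density:
  assumes "0 < R" shows "(\<integral>\<^sup>+ r. ennreal (exponential_density R r) \<partial>lborel) = 1"
  using prob_space.emeasure_space_1[OF prob_space_exponential_density[OF assms]]
  by (simp add: emeasure_density)

text \<open>
  The uniform bound \<open>C\<close> of the jump rates depends on nothing but \<open>lam\<close> and the number of servers. It
  is a parameter of the locale to spare a type argument.
\<close>

locale queue_process =
  fixes adj :: "'v::finite \<Rightarrow> 'v \<Rightarrow> bool" and lam :: real and tie :: "('v, 'd::finite) state \<Rightarrow> 'v pmf" and C :: real
  assumes lam: "0 < lam" and C: "C = (\<Sum>e\<in>(UNIV :: 'v option set). clock_rate lam e)"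
begin

abbreviation "K \<equiv> jump_kernel adj lam tie"
abbreviation "U \<equiv> uniform_kernel adj lam tie"
abbreviation "R \<equiv> total_rate lam :: ('v, 'd) state \<Rightarrow> real"
abbreviation "J \<equiv> jump_op adj lam tie"
abbreviation "M \<equiv> path_measure adj lam tie"

lemma R_pos: "0 < R x"
  by (rule total_rate_pos[OF lam])

lemma R_le: "R x \<le> C"
  unfolding total_rate_def C by (intro sum_mono2) (auto intro: less_imp_le[OF clock_rate_pos[OF lam]])

lemma C_pos: "0 < C"
  using R_pos R_le by (rule less_le_trans)

lemma finite_K: "finite (set_pmf (K x))"
  by (simp add: jump_kernel_def)

lemma prob_M: "prob_space (M \<mu>)"
  by (rule prob_space_path_measure[OF lam])

lemma sets_M: "sets (M \<mu>) = sets (Pi\<^sub>M UNIV (\<lambda>_. config_space))"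
proof -
  interpret IT: Ionescu_Tulcea "config_kernel adj lam tie \<mu>" "\<lambda>_. config_space"
    by (rule Ionescu_Tulcea_config_kernel[OF lam])
  show ?thesis unfolding path_measure_def by (rule IT.PF.sets_lim)
qed

lemma space_M: "space (M \<mu>) = UNIV"
  using sets_eq_imp_space_eq[OF sets_M[of \<mu>]] by (simp add: space_PiM)

lemma history_measurable:
  "case_prod g \<in> borel_measurable (borel \<Otimes>\<^sub>M config_space) \<Longrightarrow> history B m g \<in> borel_measurable (M \<mu>)"
  using measurable_history[of g m UNIV B] by (simp add: measurable_cong_sets[OF sets_M refl])

lemma J_mono:
  assumes "\<And>s y. h s y \<le> h' s y" shows "J B h s x \<le> J B h' s x"
  unfolding jump_op_def by (intro nn_integral_mono mult_left_mono assms) auto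

lemma J_const: "J B (\<lambda>_. f) s x = (\<integral>\<^sup>+ y. indicator B y * f y \<partial>measure_pmf (K x))"
  unfolding jump_op_def
  by (simp add: nn_integral_multc nn_integral_exponential_density[OF R_pos])

lemma J_taboo: "(J (- {z}) ^^ m) (\<lambda>_. f) = (\<lambda>_. (taboo K z ^^ m) f)"
proof (induction m)
  case (Suc m)
  show ?case by (rule ext)+ (simp add: Suc J_const taboo_def[of K z "(taboo K z ^^ m) f"])
qed simp

lemma J_zero: "(J B ^^ m) (\<lambda>_ _. 0) = (\<lambda>_ _. 0)"
proof (induction m)
  case (Suc m)
  show ?case by (rule ext)+ (simp add: Suc J_const)
qed simp

text \<open>
  The space of states is countable, so that joint measurability reduces to measurability in time.
\<close>

definition time_measurable :: "(real \<Rightarrow> ('v, 'd) state \<Rightarrow> ennreal) \<Rightarrow> bool" where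
  "time_measurable h \<longleftrightarrow> (\<forall>y. (\<lambda>s. h s y) \<in> borel_measurable borel)"

lemma time_measurableD: "time_measurable h \<Longrightarrow> (\<lambda>s. h s y) \<in> borel_measurable borel"
  unfolding time_measurable_def by blast

lemma time_measurableI: "(\<And>y. (\<lambda>s. h s y) \<in> borel_measurable borel) \<Longrightarrow> time_measurable h"
  unfolding time_measurable_def by blast

lemma time_measurable_J:
  assumes h: "time_measurable h" shows "time_measurable (J B h)"
  unfolding time_measurable_def
proof
  fix x
  have "(\<lambda>p. h (fst p + snd p) y) \<in> borel_measurable (borel \<Otimes>\<^sub>M borel)" for y
    by (rule measurable_compose[OF _ time_measurableD[OF h]]) measurable
  then show "(\<lambda>s. J B h s x) \<in> borel_measurable borel"
    unfolding jump_op_def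
    by (intro lborel.borel_measurable_nn_integral) (simp add: nn_integral_measure_pmf_finite[OF finite_K] split_beta')
qed

lemma J_add:
  assumes "time_measurable h" "time_measurable h'"
  shows "J B (\<lambda>s y. h s y + h' s y) s x = J B h s x + J B h' s x"
proof -
  have m: "(\<lambda>r. f (s + r) y) \<in> borel_measurable borel" if "time_measurable f" for f y
    by (rule measurable_compose[OF _ time_measurableD[OF that]]) measurable
  have mi: "(\<lambda>r. \<integral>\<^sup>+ y. indicator B y * f (s + r) y \<partial>measure_pmf (K x)) \<in> borel_measurable lborel"
    if f: "time_measurable f" for f
    using m[OF f] by (simp add: nn_integral_measure_pmf_finite[OF finite_K])
  have ed: "(\<lambda>r. ennreal (exponential_density (R x) r)) \<in> borel_measurable lborel" by measurable
  have "J B (\<lambda>s y. h s y + h' s y) s x = (\<integral>\<^sup>+ r.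
      ennreal (exponential_density (R x) r) * (\<integral>\<^sup>+ y. indicator B y * h (s + r) y \<partial>measure_pmf (K x)) +
      ennreal (exponential_density (R x) r) * (\<integral>\<^sup>+ y. indicator B y * h' (s + r) y \<partial>measure_pmf (K x)) \<partial>lborel)"
    unfolding jump_op_def
  proof (intro nn_integral_cong)
    fix r :: real
    have "(\<integral>\<^sup>+ y. indicator B y * (h (s + r) y + h' (s + r) y) \<partial>measure_pmf (K x)) =
        (\<integral>\<^sup>+ y. indicator B y * h (s + r) y \<partial>measure_pmf (K x)) + (\<integral>\<^sup>+ y. indicator B y * h' (s + r) y \<partial>measure_pmf (K x))"
      unfolding distrib_left by (rule nn_integral_add) auto
    then show "ennreal (exponential_density (R x) r) * (\<integral>\<^sup>+ y. indicator B y * (h (s + r) y + h' (s + r) y) \<partial>measure_pmf (K x)) =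
      ennreal (exponential_density (R x) r) * (\<integral>\<^sup>+ y. indicator B y * h (s + r) y \<partial>measure_pmf (K x)) +
      ennreal (exponential_density (R x) r) * (\<integral>\<^sup>+ y. indicator B y * h' (s + r) y \<partial>measure_pmf (K x))"
      by (simp only: distrib_left)
  qed
  also have "\<dots> = J B h s x + J B h' s x"
  proof -
    have "(\<lambda>r. ennreal (exponential_density (R x) r) * (\<integral>\<^sup>+ y. indicator B y * f (s + r) y \<partial>measure_pmf (K x)))
        \<in> borel_measurable lborel" if f: "time_measurable f" for f
      using borel_measurable_times_ennreal[OF ed mi[OF f]] .
    from this[OF assms(1)] this[OF assms(2)] show ?thesis
      unfolding jump_op_def by (rule nn_integral_add)
  qed
  finally show ?thesis .
qed

lemma time_measurable_iterate: "time_measurable h \<Longrightarrow> time_measurable ((J B ^^ m) h)"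
  by (induction m) (auto intro: time_measurable_J)

lemma time_measurable_sum: "(\<And>i. i \<in> I \<Longrightarrow> time_measurable (h i)) \<Longrightarrow> time_measurable (\<lambda>s y. \<Sum>i\<in>I. h i s y)"
  by (rule time_measurableI) (intro borel_measurable_sum time_measurableD)

lemma J_sum:
  assumes "finite I" "\<And>i. i \<in> I \<Longrightarrow> time_measurable (h i)"
  shows "J B (\<lambda>s y. \<Sum>i\<in>I. h i s y) s x = (\<Sum>i\<in>I. J B (h i) s x)"
  using assms
proof (induction I)
  case empty
  then show ?case by (simp add: J_const)
next
  case (insert i I)
  then show ?case by (simp add: J_add time_measurable_sum)
qed

text \<open>
  The partial sums satisfy \<open>S\<^sub>m\<^sub>+\<^sub>1 = g + J S\<^sub>m\<close>, so by induction they stay below every \<open>\<Psi>\<close> with \<open>g + J \<Psi> \<le> \<Psi>\<close>.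
\<close>

lemma J_supersolution:
  assumes g: "time_measurable g" and sup: "\<And>s y. g s y + J B \<Psi> s y \<le> \<Psi> s y"
  shows "(\<Sum>i<m. (J B ^^ i) g s x) \<le> \<Psi> s x"
proof (induction m arbitrary: s x)
  case (Suc m)
  have "(\<Sum>i<Suc m. (J B ^^ i) g s x) = g s x + (\<Sum>i<m. J B ((J B ^^ i) g) s x)"
    unfolding sum.lessThan_Suc_shift by simp
  also have "(\<Sum>i<m. J B ((J B ^^ i) g) s x) = J B (\<lambda>s y. \<Sum>i<m. (J B ^^ i) g s y) s x"
    by (intro J_sum[symmetric] time_measurable_iterate g) auto
  also have "\<dots> \<le> J B \<Psi> s x" by (intro J_mono Suc.IH)
  finally show ?case using sup[of s x] by (meson add_left_mono order_trans)
qed simp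

section \<open>Waiting times and absence of explosion\<close>

lemma running_None: "None \<in> running x"
  by (simp add: running_def)

lemma AE_clocks_pos: "AE c in fresh_clocks lam. \<forall>e :: 'v option. 0 < c e"
proof -
  have "AE c in fresh_clocks lam. 0 < c e" for e :: "'v option"
  proof (rule AE_PiM_component)
    have "AE r in lborel. 0 < exponential_density (clock_rate lam e) r \<longrightarrow> 0 < r"
      using AE_lborel_singleton[of 0] by eventually_elim (auto simp: exponential_density_def split: if_splits)
    then show "AE r in clock_law lam e. 0 < r"
      unfolding clock_law_eq by (subst AE_density) auto
  qed (auto intro: prob_space_clock_law lam)
  then show ?thesis by (simp add: AE_all_countable)
qed

lemma waiting_pos: "(\<And>e. 0 < c e) \<Longrightarrow> 0 < waiting_time (x, c)"
  by (simp add: waiting_time_def)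

lemma fresh_mean_time: "fresh_mean lam (\<lambda>s z. f s (fst z)) = f"
  for f :: "real \<Rightarrow> ('v, 'd) state \<Rightarrow> ennreal"
  by (intro ext) (simp add: fresh_mean_def prob_space.emeasure_space_1[OF prob_space_fresh_clocks[OF lam]])

lemma AE_waiting_pos: "AE \<omega> in M \<mu>. \<forall>m. 0 < waiting_time (\<omega> m)"
proof -
  have "AE \<omega> in M \<mu>. 0 < waiting_time (\<omega> m)" for m
  proof -
    let ?g = "\<lambda>(s::real) (z :: ('v, 'd) config). indicator {..0} (waiting_time z) :: ennreal"
    have g: "case_prod ?g \<in> borel_measurable (borel \<Otimes>\<^sub>M config_space)"
      unfolding split_beta' by (rule measurable_compose[OF measurable_compose[OF measurable_snd measurable_waiting_time]]) simp
    have "fresh_mean lam ?g = (\<lambda>_ _. 0)"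
    proof (intro ext)
      fix s x
      have "AE c in fresh_clocks lam. ?g s (x, c) = 0"
        using AE_clocks_pos by eventually_elim (use waiting_pos[of _ x] in \<open>auto simp: indicator_def not_le\<close>)
      then show "fresh_mean lam ?g s x = 0"
        unfolding fresh_mean_def by (subst nn_integral_cong_AE) auto
    qed
    then have "(\<integral>\<^sup>+ \<omega>. history UNIV m ?g \<omega> \<partial>M \<mu>) = 0"
      by (simp add: path_nn_integral[OF lam g] J_zero)
    then have "AE \<omega> in M \<mu>. history UNIV m ?g \<omega> = 0"
      by (subst (asm) nn_integral_0_iff_AE) (auto intro: history_measurable g)
    then show ?thesis by eventually_elim (auto simp: history_def indicator_def split: if_splits)
  qed
  then show ?thesis by (simp add: AE_all_countable)
qed

lemma J_exp:
  assumes "0 \<le> a"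
  shows "J UNIV (\<lambda>s y. ennreal (a * exp (- s))) s x \<le> ennreal (C / (C + 1) * a * exp (- s))"
proof -
  have R: "0 < R x" by (rule R_pos)
  have "J UNIV (\<lambda>s y. ennreal (a * exp (- s))) s x =
      (\<integral>\<^sup>+ r. ennreal (R x / (R x + 1) * a * exp (- s)) * ennreal (exponential_density (R x + 1) r) \<partial>lborel)"
    unfolding jump_op_def
  proof (intro nn_integral_cong)
    fix r :: real
    have "exponential_density (R x) r * (a * exp (- (s + r))) = R x / (R x + 1) * a * exp (- s) * exponential_density (R x + 1) r"
    proof (cases "0 \<le> r")
      case True
      have "exp (- (r * R x)) * exp (- (s + r)) = exp (- s) * exp (- (r * (R x + 1)))"
        by (simp add: exp_add[symmetric] algebra_simps)
      then show ?thesis using True R by (simp add: exponential_density_def field_simps)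
    qed (simp add: exponential_density_def)
    then show "ennreal (exponential_density (R x) r) * (\<integral>\<^sup>+ y. indicator UNIV y * ennreal (a * exp (- (s + r))) \<partial>measure_pmf (K x)) =
        ennreal (R x / (R x + 1) * a * exp (- s)) * ennreal (exponential_density (R x + 1) r)"
      using R assms by (simp add: ennreal_mult'[symmetric] ennreal_mult''[symmetric] exponential_density_nonneg)
  qed
  also have "\<dots> = ennreal (R x / (R x + 1) * a * exp (- s))"
    using R by (simp add: nn_integral_cmult nn_integral_exponential_density)
  also have "\<dots> \<le> ennreal (C / (C + 1) * a * exp (- s))"
    using R R_le[of x] C_pos assms by (intro ennreal_leI mult_right_mono) (auto simp: field_simps)
  finally show ?thesis .
qed

lemma J_exp_iterate: "(J UNIV ^^ m) (\<lambda>s y. ennreal (exp (- s))) s x \<le> ennreal ((C / (C + 1)) ^ m * exp (- s))"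
proof (induction m arbitrary: s x)
  case (Suc m)
  have "(J UNIV ^^ Suc m) (\<lambda>s y. ennreal (exp (- s))) s x \<le>
      J UNIV (\<lambda>s y. ennreal ((C / (C + 1)) ^ m * exp (- s))) s x"
    using Suc by (simp add: J_mono)
  also have "\<dots> \<le> ennreal (C / (C + 1) * (C / (C + 1)) ^ m * exp (- s))"
    using C_pos by (intro J_exp) simp
  finally show ?case by simp
qed simp

text \<open>
  Each event multiplies the mean of \<open>exp (- s)\<close> at the event time \<open>s\<close> by at most \<open>C/(C + 1)\<close>. Hence the
  infimum of \<open>exp (- s)\<close> over all event times vanishes almost surely.
\<close>

lemma AE_no_explosion: "AE \<omega> in M \<mu>. \<forall>t. \<exists>m. t < event_time m \<omega>"
proof -
  let ?q = "C / (C + 1)"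
  let ?g = "\<lambda>s (z :: ('v, 'd) config). ennreal (exp (- s))"
  have g: "case_prod ?g \<in> borel_measurable (borel \<Otimes>\<^sub>M config_space)"
    unfolding split_beta' by measurable
  have hist: "history UNIV m ?g \<omega> = ennreal (exp (- event_time m \<omega>))" for m \<omega>
    by (simp add: history_def)
  have meas: "(\<lambda>\<omega>. ennreal (exp (- event_time m \<omega>))) \<in> borel_measurable (M \<mu>)" for m
    using history_measurable[OF g, of UNIV m \<mu>] by (simp add: hist[abs_def])
  have le: "(\<integral>\<^sup>+ \<omega>. (INF m. ennreal (exp (- event_time m \<omega>))) \<partial>M \<mu>) \<le> ennreal (?q ^ m)" for m
  proof -
    have "(\<integral>\<^sup>+ \<omega>. (INF m. ennreal (exp (- event_time m \<omega>))) \<partial>M \<mu>) \<le> (\<integral>\<^sup>+ \<omega>. history UNIV m ?g \<omega> \<partial>M \<mu>)"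
      unfolding hist by (intro nn_integral_mono INF_lower) auto
    also have "\<dots> = (\<integral>\<^sup>+ x. (J UNIV ^^ m) (\<lambda>s y. ennreal (exp (- s))) 0 x \<partial>measure_pmf \<mu>)"
      unfolding path_nn_integral[OF lam g] using fresh_mean_time[of "\<lambda>s x. ennreal (exp (- s))"] by simp
    also have "\<dots> \<le> (\<integral>\<^sup>+ x. ennreal (?q ^ m * exp (- 0)) \<partial>measure_pmf \<mu>)"
      by (intro nn_integral_mono J_exp_iterate)
    finally show ?thesis by simp
  qed
  have "(\<lambda>m. ?q ^ m) \<longlonglongrightarrow> 0" using C_pos by (intro LIMSEQ_power_zero) simp
  then have "(\<lambda>m. ennreal (?q ^ m)) \<longlonglongrightarrow> ennreal 0" by (rule tendsto_ennrealI)
  then have "(\<integral>\<^sup>+ \<omega>. (INF m. ennreal (exp (- event_time m \<omega>))) \<partial>M \<mu>) \<le> 0"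
    using le by (intro LIMSEQ_le_const) auto
  then have "AE \<omega> in M \<mu>. (INF m. ennreal (exp (- event_time m \<omega>))) = 0"
    using meas by (subst nn_integral_0_iff_AE[symmetric]) auto
  then show ?thesis
  proof eventually_elim
    case (elim \<omega>)
    show ?case
    proof
      fix t
      have "(INF m. ennreal (exp (- event_time m \<omega>))) < ennreal (exp (- t))" by (simp add: elim)
      then obtain m where "ennreal (exp (- event_time m \<omega>)) < ennreal (exp (- t))" by (auto simp: INF_less_iff)
      then show "\<exists>m. t < event_time m \<omega>" by (auto simp: ennreal_less_iff)
    qed
  qed
qed

section \<open>The state at a fixed time\<close>

lemma event_time_strict_mono:
  assumes "\<And>m. 0 < waiting_time (\<omega> m)" shows "strict_mono (\<lambda>m. event_time m \<omega>)"
  unfolding strict_mono_Suc_iff by (simp add: event_time_def assms)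

lemma state_at_eq:
  assumes w: "\<And>m. 0 < waiting_time (\<omega> m)" and t: "event_time m \<omega> \<le> t" "t < event_time (Suc m) \<omega>"
  shows "state_at t \<omega> = fst (\<omega> m)"
proof -
  note mono = event_time_strict_mono[OF w]
  have "(LEAST m. t < event_time (Suc m) \<omega>) = m"
  proof (rule Least_equality)
    show "t < event_time (Suc m) \<omega>" by (rule t(2))
    fix j assume "t < event_time (Suc j) \<omega>"
    then have "event_time m \<omega> < event_time (Suc j) \<omega>" using t(1) by simp
    then show "m \<le> j" using strict_mono_less[OF mono] by (simp add: less_Suc_eq_le)
  qed
  then show ?thesis by (simp add: state_at_def)
qed

lemma current_event:
  assumes w: "\<And>m. 0 < waiting_time (\<omega> m)" and ub: "\<exists>m. t < event_time m \<omega>" and t: "0 \<le> t"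
  shows "\<exists>m. event_time m \<omega> \<le> t \<and> t < event_time (Suc m) \<omega>"
proof -
  define N where "N = (LEAST m. t < event_time m \<omega>)"
  have N: "t < event_time N \<omega>" unfolding N_def using ub by (rule LeastI_ex)
  then have "N \<noteq> 0" using t by (auto simp: event_time_def intro: ccontr)
  then obtain m where m: "N = Suc m" by (cases N) auto
  then have "\<not> t < event_time m \<omega>" unfolding N_def using not_less_Least[of m] by (metis lessI)
  then show ?thesis using N m by (auto simp: not_less)
qed

lemma state_at_measurable: "state_at t \<in> M \<mu> \<rightarrow>\<^sub>M count_space UNIV"
proof -
  have et: "event_time m \<in> borel_measurable (Pi\<^sub>M UNIV (\<lambda>_. config_space :: ('v, 'd) config measure))" for m
    by (rule measurable_event_time) simp
  have "(\<lambda>\<omega>. LEAST m. t < event_time (Suc m) \<omega>) \<in>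
      Pi\<^sub>M UNIV (\<lambda>_. config_space :: ('v, 'd) config measure) \<rightarrow>\<^sub>M count_space UNIV"
    using et by measurable
  moreover have "(\<lambda>\<omega>. fst (\<omega> m)) \<in> Pi\<^sub>M UNIV (\<lambda>_. config_space :: ('v, 'd) config measure) \<rightarrow>\<^sub>M count_space UNIV" for m
    by (rule measurable_compose[OF measurable_component_config measurable_fst_config]) simp
  ultimately have "state_at t \<in> Pi\<^sub>M UNIV (\<lambda>_. config_space :: ('v, 'd) config measure) \<rightarrow>\<^sub>M count_space UNIV"
    unfolding state_at_def[abs_def] by (rule measurable_compose_countable[rotated])
  then show ?thesis by (simp add: measurable_cong_sets[OF sets_M refl])
qed

section \<open>Uniformisation\<close>

text \<open>
  At a configuration reached at time \<open>s\<close>, this indicates that it is the current one at time \<open>t\<close> and has its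
  state in \<open>A\<close>.
\<close>

definition in_epoch :: "real \<Rightarrow> ('v, 'd) state set \<Rightarrow> real \<Rightarrow> ('v, 'd) config \<Rightarrow> ennreal" where
  "in_epoch t A s z = indicator {..t} s * indicator {t - s<..} (waiting_time z) * indicator A (fst z)"

lemma in_epoch_measurable: "case_prod (in_epoch t A) \<in> borel_measurable (borel \<Otimes>\<^sub>M config_space)"
proof -
  have 1: "(\<lambda>p. indicator A (fst (snd p)) :: ennreal) \<in> borel_measurable (borel \<Otimes>\<^sub>M config_space)"
    by (rule measurable_compose[OF measurable_compose[OF measurable_snd measurable_fst_config]]) simp
  have 2: "(\<lambda>p. waiting_time (snd p)) \<in> borel_measurable (borel \<Otimes>\<^sub>M (config_space :: ('v, 'd) config measure))"
    by (rule measurable_compose[OF measurable_snd measurable_waiting_time])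
  have "(\<lambda>p. indicator {0<..} (waiting_time (snd p) - (t - fst p)) :: ennreal)
      \<in> borel_measurable (borel \<Otimes>\<^sub>M (config_space :: ('v, 'd) config measure))"
    using 2 by measurable
  then show ?thesis
    using 1 unfolding in_epoch_def[abs_def] split_beta'
    by (simp add: indicator_def[of "{_<..}"] algebra_simps)
qed

lemma fresh_mean_in_epoch:
  "fresh_mean lam (in_epoch t A) s x = indicator {..t} s * ennreal (exp (- (R x * (t - s)))) * indicator A x"
proof (cases "s \<le> t")
  case True
  have "waiting_time (x, c) > t - s \<longleftrightarrow> (\<forall>i\<in>running x. t - s < c i)" for c
    using next_event_running(1)[where x=x and c=c] next_event_running(2)[where x=x and c=c] unfolding waiting_time_def
    by (metis fst_conv less_le_trans snd_conv)
  then have "fresh_mean lam (in_epoch t A) s x =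
      (\<integral>\<^sup>+ c. indicator {c. \<forall>i\<in>running x. t - s < c i} c * indicator A x \<partial>fresh_clocks lam)"
    unfolding fresh_mean_def using True by (intro nn_integral_cong) (auto simp: in_epoch_def indicator_def)
  also have "\<dots> = ennreal (exp (- (R x * (t - s)))) * (\<integral>\<^sup>+ c. indicator A x \<partial>(fresh_clocks lam :: ('v option \<Rightarrow> real) measure))"
    using shift_fresh_clocks[OF lam, of "t - s" "\<lambda>_. indicator A x" "running x"] True
    by (simp add: total_rate_def)
  finally show ?thesis
    using True by (simp add: prob_space.emeasure_space_1[OF prob_space_fresh_clocks[OF lam]])
qed (simp add: fresh_mean_def in_epoch_def)

definition uprob :: "('v, 'd) state set \<Rightarrow> nat \<Rightarrow> ('v, 'd) state \<Rightarrow> real" where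
  "uprob A m x = measure_pmf.prob (kpow U m x) A"

lemma uprob_bound: "\<bar>uprob A m x\<bar> \<le> 1"
  by (simp add: uprob_def)

lemma uprob_0: "uprob A 0 x = indicator A x"
  by (simp add: uprob_def)

lemma uprob_Suc: "uprob A (Suc m) x = expect (U x) (uprob A m)"
  unfolding uprob_def using expectation_bind_bounded[of "indicator A" 1 "U x" "kpow U m"] by simp

text \<open>
  Both sides are the generator applied to \<open>f\<close>.
\<close>

lemma rate_identity:
  "C * (expect (U x) f - f x) = R x * (expect (K x) f - f x)"
  for f :: "('v, 'd) state \<Rightarrow> real"
  unfolding C total_rate_def uniform_kernel_def jump_kernel_def
  using expectation_event_kernel[OF lam, of x UNIV adj tie f] expectation_event_kernel[OF lam, of x "running x" adj tie f]
  by simp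

text \<open>
  The candidate for the transition probability from \<open>x\<close> into \<open>A\<close> in time \<open>t\<close>: the uniformised
  chain after a Poisson(\<open>C t\<close>) number of steps.
\<close>

abbreviation "trprob A t x \<equiv> poisson_mean (\<lambda>m. uprob A m x) (C * t)"

lemma trprob_K: "(\<Sum>y\<in>set_pmf (K x). pmf (K x) y * trprob A t y) =
    poisson_mean (\<lambda>m. expect (K x) (uprob A m)) (C * t)"
proof -
  have "expect (K x) (uprob A m) = (\<Sum>y\<in>set_pmf (K x). pmf (K x) y * uprob A m y)" for m
    by (subst integral_measure_pmf[of "set_pmf (K x)"]) (auto simp: finite_K)
  then show ?thesis
    by (simp add: poisson_mean_sum[OF finite_K, where a="\<lambda>y m. uprob A m y" and A=1, OF uprob_bound])
qed

text \<open>
  The backward equation of the chain, written in terms of the jump chain.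
\<close>

lemma trprob_deriv:
  "((\<lambda>t. trprob A t x) has_real_derivative
     R x * ((\<Sum>y\<in>set_pmf (K x). pmf (K x) y * trprob A t y) - trprob A t x)) (at t)"
proof -
  let ?a = "\<lambda>m. uprob A m x" and ?b = "\<lambda>m. expect (K x) (uprob A m)"
  have b: "\<bar>?b m\<bar> \<le> 1" for m by (intro abs_expectation_le uprob_bound)
  have aS: "?a (Suc m) = R x / C * ?b m + (1 - R x / C) * ?a m" for m
    using rate_identity[of x "uprob A m"] C_pos unfolding uprob_Suc by (simp add: field_simps)
  have "poisson_mean (\<lambda>m. ?a (Suc m)) (C * t) = R x / C * poisson_mean ?b (C * t) + (1 - R x / C) * poisson_mean ?a (C * t)"
    unfolding aS by (rule poisson_mean_linear[OF b uprob_bound])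
  then have "C * (poisson_mean (\<lambda>m. ?a (Suc m)) (C * t) - poisson_mean ?a (C * t)) =
      R x * (poisson_mean ?b (C * t) - poisson_mean ?a (C * t))"
    using C_pos by (simp add: field_simps)
  moreover have "((\<lambda>t. trprob A t x) has_real_derivative
      (poisson_mean (\<lambda>m. ?a (Suc m)) (C * t) - poisson_mean ?a (C * t)) * C) (at t)"
    by (rule DERIV_chain2[OF poisson_mean_deriv[of ?a 1, OF uprob_bound]]) (auto intro!: derivative_eq_intros)
  ultimately show ?thesis unfolding trprob_K by (simp add: mult.commute)
qed

lemma trprob_nonneg: "0 \<le> t \<Longrightarrow> 0 \<le> trprob A t x"
  by (rule poisson_mean_nonneg[OF _ uprob_bound]) (use C_pos in \<open>auto simp: uprob_def\<close>)

lemma trprob_continuous: "continuous_on UNIV (\<lambda>t. trprob A t x)"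
  using trprob_deriv DERIV_isCont by (intro continuous_at_imp_continuous_on) blast

lemma trprob_add: "trprob A t x + trprob (- A) t x = 1"
proof -
  have "uprob (- A) m x = 1 - uprob A m x" for m
    unfolding uprob_def using measure_pmf.prob_compl[of A "kpow U m x"] by (simp add: Compl_eq_Diff_UNIV)
  then have "trprob A t x + trprob (- A) t x = poisson_mean (\<lambda>m. 1 * uprob A m x + 1 * uprob (- A) m x) (C * t)"
    by (subst poisson_mean_linear[OF uprob_bound uprob_bound]) simp
  also have "\<dots> = 1" using \<open>\<And>m. uprob (- A) m x = _\<close> by (simp add: poisson_mean_const)
  finally show ?thesis .
qed

lemma
  assumes t: "0 \<le> t"
  shows renewal_equation: "(\<integral>\<^sup>+ r. ennreal (exponential_density (R x) r) *
      (\<integral>\<^sup>+ y. indicator {..t} r * ennreal (trprob A (t - r) y) \<partial>measure_pmf (K x)) \<partial>lborel) =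
    ennreal (trprob A t x - exp (- (R x * t)) * indicator A x)" (is ?eq)
  and no_event_le_trprob: "exp (- (R x * t)) * indicator A x \<le> trprob A t x" (is ?le)
proof -
  let ?k = "\<lambda>r. \<Sum>y\<in>set_pmf (K x). pmf (K x) y * trprob A r y"
  let ?F = "\<lambda>r. - exp (- (R x * r)) * trprob A (t - r) x"
  have cont: "continuous_on UNIV ?k"
    by (intro continuous_intros trprob_continuous)
  have k: "(\<integral>\<^sup>+ y. ennreal (trprob A r y) \<partial>measure_pmf (K x)) = ennreal (?k r)" if "0 \<le> r" for r
  proof -
    have "ennreal (trprob A r y) * ennreal (pmf (K x) y) = ennreal (pmf (K x) y * trprob A r y)" for y
      by (simp only: ennreal_mult[OF pmf_nonneg trprob_nonneg[OF that]] mult.commute)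
    then show ?thesis
      using trprob_nonneg[OF that] by (simp add: nn_integral_measure_pmf_finite[OF finite_K] sum_ennreal)
  qed
  have k_nonneg: "0 \<le> ?k r" if "0 \<le> r" for r
    using that by (intro sum_nonneg mult_nonneg_nonneg trprob_nonneg) auto
  have deriv: "(?F has_real_derivative R x * exp (- (R x * r)) * ?k (t - r)) (at r)" for r
  proof -
    have D: "((\<lambda>r. trprob A (t - r) x) has_real_derivative (R x * (?k (t - r) - trprob A (t - r) x)) * (- 1)) (at r)"
      by (rule DERIV_chain2[OF trprob_deriv]) (auto intro!: derivative_eq_intros)
    have E: "((\<lambda>r. - exp (- (R x * r))) has_real_derivative R x * exp (- (R x * r))) (at r)"
      by (auto intro!: derivative_eq_intros)
    show ?thesis by (rule DERIV_cong[OF DERIV_mult[OF E D]]) (simp add: algebra_simps)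
  qed
  have nonneg: "0 \<le> R x * exp (- (R x * r)) * ?k (t - r)" if "r \<le> t" for r
    using that R_pos[of x] k_nonneg[of "t - r"] by (intro mult_nonneg_nonneg) auto
  \<comment> \<open>The function \<open>?F\<close> is an antiderivative of the integrand; its monotonicity gives the second claim.\<close>
  have "?F 0 \<le> ?F t"
    by (rule DERIV_nonneg_imp_nondecreasing[OF t]) (use deriv nonneg in blast)
  then show ?le by (simp add: uprob_0)
  have "(\<integral>\<^sup>+ r. ennreal (exponential_density (R x) r) *
      (\<integral>\<^sup>+ y. indicator {..t} r * ennreal (trprob A (t - r) y) \<partial>measure_pmf (K x)) \<partial>lborel) =
    (\<integral>\<^sup>+ r. ennreal (R x * exp (- (R x * r)) * ?k (t - r)) * indicator {0..t} r \<partial>lborel)"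
  proof (intro nn_integral_cong)
    fix r :: real
    show "ennreal (exponential_density (R x) r) * (\<integral>\<^sup>+ y. indicator {..t} r * ennreal (trprob A (t - r) y) \<partial>measure_pmf (K x)) =
      ennreal (R x * exp (- (R x * r)) * ?k (t - r)) * indicator {0..t} r"
    proof (cases "0 \<le> r \<and> r \<le> t")
      case True
      then show ?thesis
        using k_nonneg[of "t - r"] R_pos[of x] k[of "t - r"]
        by (simp add: exponential_density_def ennreal_mult[symmetric] mult.commute)
    qed (auto simp: exponential_density_def)
  qed
  also have "\<dots> = ennreal (?F t - ?F 0)"
  proof (rule nn_integral_FTC_Icc)
    have "continuous_on UNIV (\<lambda>r. R x * exp (- (R x * r)) * ?k (t - r))"
      by (intro continuous_intros continuous_on_compose2[OF cont]) auto
    then show "(\<lambda>r. R x * exp (- (R x * r)) * ?k (t - r)) \<in> borel_measurable borel"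
      by (rule borel_measurable_continuous_onI)
  qed (use t deriv nonneg in auto)
  finally show ?eq by (simp add: uprob_0)
qed

text \<open>
  By the renewal equation, which decomposes at the first event, the transition
  probabilities of the uniformised chain are a solution of \<open>\<Psi> = g + J \<Psi>\<close>.
\<close>

lemma sum_epochs_le:
  assumes t: "0 \<le> t"
  shows "(\<Sum>i<m. (J UNIV ^^ i) (fresh_mean lam (in_epoch t A)) 0 x) \<le> ennreal (trprob A t x)"
proof -
  \<comment> \<open>No event after time \<open>t\<close> matters, so \<open>\<Psi>\<close> vanishes there.\<close>
  define \<Psi> where "\<Psi> s y = indicator {..t} s * ennreal (trprob A (t - s) y)" for s y
  have "(\<Sum>i<m. (J UNIV ^^ i) (fresh_mean lam (in_epoch t A)) 0 x) \<le> \<Psi> 0 x"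
  proof (rule J_supersolution)
    show "time_measurable (fresh_mean lam (in_epoch t A))"
      unfolding time_measurable_def fresh_mean_in_epoch by measurable
    fix s y
    show "fresh_mean lam (in_epoch t A) s y + J UNIV \<Psi> s y \<le> \<Psi> s y"
    proof (cases "s \<le> t")
      case True
      then have s: "0 \<le> t - s" by simp
      have "J UNIV \<Psi> s y = (\<integral>\<^sup>+ r. ennreal (exponential_density (R y) r) *
          (\<integral>\<^sup>+ z. indicator {..t - s} r * ennreal (trprob A (t - s - r) z) \<partial>measure_pmf (K y)) \<partial>lborel)"
        unfolding jump_op_def \<Psi>_def
        by (simp add: indicator_def le_diff_eq diff_diff_eq add.commute)
      also have "\<dots> = ennreal (trprob A (t - s) y - exp (- (R y * (t - s))) * indicator A y)"
        by (rule renewal_equation[OF s])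
      finally have eq: "J UNIV \<Psi> s y = ennreal (trprob A (t - s) y - exp (- (R y * (t - s))) * indicator A y)" .
      note mono = no_event_le_trprob[OF s, of y A]
      have "fresh_mean lam (in_epoch t A) s y = ennreal (exp (- (R y * (t - s))) * indicator A y)"
        using True by (simp add: fresh_mean_in_epoch indicator_def)
      then show ?thesis
        using True mono trprob_nonneg[OF s, of A y] unfolding eq \<Psi>_def
        by (simp add: ennreal_plus[symmetric] indicator_def del: ennreal_plus)
    next
      case False
      have "J UNIV \<Psi> s y = (\<integral>\<^sup>+ r. 0 \<partial>(lborel :: real measure))"
        unfolding jump_op_def
      proof (intro nn_integral_cong)
        fix r :: real
        show "ennreal (exponential_density (R y) r) * (\<integral>\<^sup>+ z. indicator UNIV z * \<Psi> (s + r) z \<partial>measure_pmf (K y)) = 0"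
          using False by (cases "r < 0") (auto simp: exponential_density_def \<Psi>_def)
      qed
      then show ?thesis using False by (simp add: fresh_mean_in_epoch \<Psi>_def)
    qed
  qed
  then show ?thesis using t by (simp add: \<Psi>_def)
qed

lemma sum_history_in_epoch:
  assumes w: "\<And>m. 0 < waiting_time (\<omega> m)" and ub: "\<exists>m. t < event_time m \<omega>" and t: "0 \<le> t"
  shows "(\<Sum>m. history UNIV m (in_epoch t A) \<omega>) = indicator A (state_at t \<omega>)"
proof -
  obtain N where N: "event_time N \<omega> \<le> t" "t < event_time (Suc N) \<omega>"
    using current_event[OF w ub t] by blast
  note mono = strict_mono_less_eq[OF event_time_strict_mono[OF w]]
  have zero: "history UNIV m (in_epoch t A) \<omega> = 0" if "m \<noteq> N" for m
  proof (cases "m < N")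
    case True
    then have "event_time (Suc m) \<omega> \<le> event_time N \<omega>" using mono by simp
    then have "event_time m \<omega> + waiting_time (\<omega> m) \<le> t" using N by (simp add: event_time_def)
    then show ?thesis by (simp add: history_def in_epoch_def indicator_def)
  next
    case False
    then have "event_time (Suc N) \<omega> \<le> event_time m \<omega>" using mono that by simp
    then show ?thesis using N by (simp add: history_def in_epoch_def indicator_def)
  qed
  have "(\<Sum>m. history UNIV m (in_epoch t A) \<omega>) = history UNIV N (in_epoch t A) \<omega>"
    using zero by (subst suminf_finite[of "{N}"]) auto
  also have "\<dots> = indicator A (fst (\<omega> N))"
    using N by (simp add: history_def in_epoch_def indicator_def event_time_def)
  finally show ?thesis by (simp add: state_at_eq[OF w N])
qed

lemma emeasure_state_at_le:
  assumes t: "0 \<le> t"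
  shows "emeasure (M \<mu>) {\<omega>. state_at t \<omega> \<in> A} \<le> (\<integral>\<^sup>+ x. ennreal (trprob A t x) \<partial>measure_pmf \<mu>)"
proof -
  have set: "{\<omega>. state_at t \<omega> \<in> A} \<in> sets (M \<mu>)"
    using measurable_sets[OF state_at_measurable, of A t \<mu>] by (simp add: space_M vimage_def)
  have "emeasure (M \<mu>) {\<omega>. state_at t \<omega> \<in> A} = (\<integral>\<^sup>+ \<omega>. indicator A (state_at t \<omega>) \<partial>M \<mu>)"
    using set by (simp add: nn_integral_indicator[symmetric] indicator_def del: nn_integral_indicator)
  also have "\<dots> = (\<integral>\<^sup>+ \<omega>. (\<Sum>m. history UNIV m (in_epoch t A) \<omega>) \<partial>M \<mu>)"
  proof (rule nn_integral_cong_AE)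
    show "AE \<omega> in M \<mu>. indicator A (state_at t \<omega>) = (\<Sum>m. history UNIV m (in_epoch t A) \<omega>)"
      using AE_waiting_pos AE_no_explosion
      by eventually_elim (use sum_history_in_epoch t in auto)
  qed
  also have "\<dots> = (\<Sum>m. \<integral>\<^sup>+ \<omega>. history UNIV m (in_epoch t A) \<omega> \<partial>M \<mu>)"
    by (intro nn_integral_suminf history_measurable in_epoch_measurable)
  also have "\<dots> = (\<integral>\<^sup>+ x. (\<Sum>m. (J UNIV ^^ m) (fresh_mean lam (in_epoch t A)) 0 x) \<partial>measure_pmf \<mu>)"
    by (simp add: path_nn_integral[OF lam in_epoch_measurable] nn_integral_suminf)
  also have "\<dots> \<le> (\<integral>\<^sup>+ x. ennreal (trprob A t x) \<partial>measure_pmf \<mu>)"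
    by (intro nn_integral_mono suminf_le_const sum_epochs_le t) auto
  finally show ?thesis .
qed

text \<open>
  The upper bounds for \<open>A\<close> and for its complement sum to 1, and so do the probabilities, so that both
  bounds are attained.
\<close>

theorem emeasure_state_at:
  assumes t: "0 \<le> t"
  shows "emeasure (M \<mu>) {\<omega>. state_at t \<omega> \<in> A} = (\<integral>\<^sup>+ x. ennreal (trprob A t x) \<partial>measure_pmf \<mu>)"
proof (rule antisym[OF emeasure_state_at_le[OF t]])
  let ?e = "\<lambda>A. emeasure (M \<mu>) {\<omega>. state_at t \<omega> \<in> A}" and ?a = "\<lambda>A. \<integral>\<^sup>+ x. ennreal (trprob A t x) \<partial>measure_pmf \<mu>"
  interpret prob_space "M \<mu>" by (rule prob_M)
  have set: "{\<omega>. state_at t \<omega> \<in> A} \<in> sets (M \<mu>)" for A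
    using measurable_sets[OF state_at_measurable, of A t \<mu>] by (simp add: space_M vimage_def)
  have "?a A + ?a (- A) = (\<integral>\<^sup>+ x. ennreal (trprob A t x) + ennreal (trprob (- A) t x) \<partial>measure_pmf \<mu>)"
    by (simp add: nn_integral_add)
  also have "\<dots> = (\<integral>\<^sup>+ x. 1 \<partial>measure_pmf \<mu>)"
    using trprob_nonneg[OF t] trprob_add by (intro nn_integral_cong) (simp add: ennreal_plus[symmetric] del: ennreal_plus)
  finally have a: "?a A + ?a (- A) = 1" by simp
  have "?e A + ?e (- A) = emeasure (M \<mu>) ({\<omega>. state_at t \<omega> \<in> A} \<union> {\<omega>. state_at t \<omega> \<in> - A})"
    by (rule plus_emeasure[OF set set]) auto
  also have "{\<omega>. state_at t \<omega> \<in> A} \<union> {\<omega>. state_at t \<omega> \<in> - A} = space (M \<mu>)" by (auto simp: space_M)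
  finally have "?a (- A) + ?a A = ?e A + ?e (- A)" using a by (simp add: emeasure_space_1 add.commute)
  also have "\<dots> \<le> ?a (- A) + ?e A"
    unfolding add.commute[of "?e A"] by (intro add_right_mono emeasure_state_at_le t)
  finally show "?a A \<le> ?e A"
    using a by (subst (asm) ennreal_add_left_cancel_le) (auto simp: top_unique)
qed

text \<open>
  The law of the state at time \<open>t > 0\<close>, by \<^emph>\<open>distr_state_at\<close> below.
\<close>

definition law :: "('v, 'd) state pmf \<Rightarrow> real \<Rightarrow> ('v, 'd) state pmf" where
  "law \<mu> t = bind_pmf \<mu> (\<lambda>x. bind_pmf (poisson_pmf (C * t)) (\<lambda>m. kpow U m x))"

theorem distr_state_at:
  assumes t: "0 < t"
  shows "distr (M \<mu>) (count_space UNIV) (state_at t) = measure_pmf (law \<mu> t)"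
proof (rule measure_eqI)
  fix A assume "A \<in> sets (distr (M \<mu>) (count_space UNIV) (state_at t))"
  have Ct: "0 < C * t" using C_pos t by simp
  have "emeasure (measure_pmf (law \<mu> t)) A =
      (\<integral>\<^sup>+ x. \<integral>\<^sup>+ m. ennreal (uprob A m x) \<partial>measure_pmf (poisson_pmf (C * t)) \<partial>measure_pmf \<mu>)"
    unfolding law_def uprob_def measure_pmf.emeasure_eq_measure[symmetric] by simp
  also have "\<dots> = (\<integral>\<^sup>+ x. ennreal (trprob A t x) \<partial>measure_pmf \<mu>)"
  proof (rule nn_integral_cong)
    fix x
    have "(\<integral>\<^sup>+ m. ennreal (uprob A m x) \<partial>measure_pmf (poisson_pmf (C * t))) =
        ennreal (expect (poisson_pmf (C * t)) (\<lambda>m. uprob A m x))"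
      by (intro nn_integral_eq_integral integrable_pmf_bounded[OF uprob_bound]) (simp add: uprob_def)
    then show "(\<integral>\<^sup>+ m. ennreal (uprob A m x) \<partial>measure_pmf (poisson_pmf (C * t))) = ennreal (trprob A t x)"
      by (simp add: expectation_poisson_pmf[OF Ct uprob_bound])
  qed
  also have "\<dots> = emeasure (distr (M \<mu>) (count_space UNIV) (state_at t)) A"
    using t by (subst emeasure_distr[OF state_at_measurable]) (simp_all add: emeasure_state_at[symmetric] space_M vimage_def)
  finally show "emeasure (distr (M \<mu>) (count_space UNIV) (state_at t)) A = emeasure (measure_pmf (law \<mu> t)) A" ..
qed simp

lemma visits_reachable:
  assumes "y \<in> set_pmf (kpow U m x)"
  shows "0 < measure (M (return_pmf x)) {\<omega> \<in> space (M (return_pmf x)). state_at 1 \<omega> = y}"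
proof -
  have "0 < C * 1" using C_pos by simp
  then have "y \<in> set_pmf (law (return_pmf x) 1)"
    using assms by (auto simp: law_def bind_return_pmf set_pmf_poisson)
  then have "0 < measure (measure_pmf (law (return_pmf x) 1)) {y}"
    by (simp add: measure_pmf_single pmf_positive_iff)
  also have "measure (measure_pmf (law (return_pmf x) 1)) {y} =
      measure (M (return_pmf x)) {\<omega> \<in> space (M (return_pmf x)). state_at 1 \<omega> = y}"
    unfolding distr_state_at[of 1, OF zero_less_one, symmetric]
    by (subst measure_distr[OF state_at_measurable]) (auto simp: vimage_def Int_def conj_commute)
  finally show ?thesis .
qed

section \<open>Mean return times\<close>

lemma jump_changes_state: "x \<notin> set_pmf (K x)"
proof
  assume "x \<in> set_pmf (K x)"
  then obtain e where e: "e \<in> running x" "x \<in> set_pmf (event_step adj tie x e)"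
    by (auto simp: jump_kernel_def event_kernel_def set_event_pmf[OF lam running_nonempty])
  obtain q w where x: "x = (q, w)" by (cases x)
  show False
  proof (cases e)
    case None
    then obtain v where "q = q(v := q v + 1)" using e(2) by (auto simp: x event_step_def)
    then have "q v = q v + 1" by (metis fun_upd_same)
    then show False by simp
  next
    case (Some v)
    then have "0 < q v" "q = q(v := q v - 1)" using e by (auto simp: x event_step_def running_def)
    then have "q v = q v - 1" by (metis fun_upd_same)
    then show False using \<open>0 < q v\<close> by simp
  qed
qed

lemma AE_start: "AE \<omega> in M (return_pmf x). fst (\<omega> 0) = x"
proof -
  let ?g = "\<lambda>(s::real) (z :: ('v, 'd) config). indicator (- {x}) (fst z) :: ennreal"
  have g: "case_prod ?g \<in> borel_measurable (borel \<Otimes>\<^sub>M config_space)"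
    unfolding split_beta' by (rule measurable_compose[OF measurable_compose[OF measurable_snd measurable_fst_config]]) simp
  have "(\<integral>\<^sup>+ \<omega>. history UNIV 0 ?g \<omega> \<partial>M (return_pmf x)) = 0"
    unfolding path_nn_integral[OF lam g] using fresh_mean_time[of "\<lambda>s y. indicator (- {x}) y"] by simp
  then have "AE \<omega> in M (return_pmf x). history UNIV 0 ?g \<omega> = 0"
    by (subst (asm) nn_integral_0_iff_AE) (auto intro: history_measurable g)
  then show ?thesis by eventually_elim (auto simp: history_def indicator_def split: if_splits)
qed

lemma AE_first_jump: "AE \<omega> in M (return_pmf x). fst (\<omega> 1) \<noteq> x"
proof -
  let ?g = "\<lambda>(s::real) (z :: ('v, 'd) config). 1 :: ennreal"
  have g: "case_prod ?g \<in> borel_measurable (borel \<Otimes>\<^sub>M config_space)" by simp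
  have "(\<integral>\<^sup>+ \<omega>. history {x} 1 ?g \<omega> \<partial>M (return_pmf x)) = J {x} (\<lambda>_ _. 1) 0 x"
    unfolding path_nn_integral[OF lam g] using fresh_mean_time[of "\<lambda>_ _. 1"] by simp
  also have "\<dots> = 0"
    using jump_changes_state[of x] by (simp add: J_const emeasure_pmf_single set_pmf_iff)
  finally have "AE \<omega> in M (return_pmf x). history {x} 1 ?g \<omega> = 0"
    by (subst (asm) nn_integral_0_iff_AE) (auto intro: history_measurable g)
  then show ?thesis by eventually_elim (auto simp: history_def indicator_def split: if_splits)
qed

text \<open>
  The arrival clock always runs, so the waiting time is at most the time until the next arrival.
\<close>

lemma mean_waiting_time:
  "fresh_mean lam (\<lambda>s z. ennreal (waiting_time z)) s x \<le> ennreal (1 / clock_rate lam (None :: 'v option))"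
  for x :: "('v, 'd) state"
proof -
  let ?l = "clock_rate lam (None :: 'v option)"
  have l: "0 < ?l" by (rule clock_rate_pos[OF lam])
  have m: "(\<lambda>c. ennreal (c None)) \<in> borel_measurable (clock_space :: ('v option \<Rightarrow> real) measure)"
    by (rule measurable_compose[OF measurable_component_singleton]) auto
  have "fresh_mean lam (\<lambda>s z. ennreal (waiting_time z)) s x \<le>
      (\<integral>\<^sup>+ c. ennreal (c None) \<partial>(fresh_clocks lam :: ('v option \<Rightarrow> real) measure))"
    unfolding fresh_mean_def waiting_time_def
    by (intro nn_integral_mono ennreal_leI) (simp add: next_event_running(2)[OF running_None])
  also have "\<dots> = (\<integral>\<^sup>+ r. ennreal r \<partial>clock_law lam (None :: 'v option))"
    by (subst resample_clock[OF lam m, of None])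
       (simp add: prob_space.emeasure_space_1[OF prob_space_fresh_clocks[OF lam]])
  also have "\<dots> = (\<integral>\<^sup>+ r. ennreal (erlang_density 0 ?l r * r ^ 1) \<partial>lborel)"
    unfolding clock_law_eq
    by (subst nn_integral_density)
       (auto intro!: nn_integral_cong simp: ennreal_mult'[symmetric] exponential_density_def erlang_density_def ennreal_mult''[symmetric])
  also have "\<dots> = ennreal (1 / ?l)"
    unfolding nn_integral_erlang_ith_moment[OF l] by simp
  finally show ?thesis .
qed

text \<open>
  If the jump chain returns to \<open>x\<close>, the process is back at the time of that event, after having
  left with the first event; that time is the sum of the waiting times before. If it does not
  return, the sum contains all waiting times and is infinite because there is no explosion.
\<close>

lemma return_time_le:
  assumes w: "\<And>m. 0 < waiting_time (\<omega> m)" and ub: "\<And>t. \<exists>m. t < event_time m \<omega>"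
    and x: "fst (\<omega> 0) = x" "fst (\<omega> 1) \<noteq> x"
  shows "return_time state_at \<omega> \<le> (\<Sum>m. history (- {x}) m (\<lambda>s z. ennreal (waiting_time z)) \<omega>)"
proof -
  let ?h = "\<lambda>m. history (- {x}) m (\<lambda>s z. ennreal (waiting_time z)) \<omega>"
  have partial: "ennreal (event_time N \<omega>) \<le> (\<Sum>m. ?h m)" if N: "\<And>i. 1 \<le> i \<Longrightarrow> i < N \<Longrightarrow> fst (\<omega> i) \<noteq> x" for N
  proof -
    have "?h m = ennreal (waiting_time (\<omega> m))" if "m < N" for m
      using N that by (auto simp: history_def intro!: prod.neutral)
    then have "ennreal (event_time N \<omega>) = (\<Sum>m<N. ?h m)"
      using w by (simp add: event_time_def sum_ennreal less_imp_le)
    also have "\<dots> \<le> (\<Sum>m. ?h m)" by (intro sum_le_suminf) auto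
    finally show ?thesis .
  qed
  note mono = event_time_strict_mono[OF w]
  have st: "state_at (event_time m \<omega>) \<omega> = fst (\<omega> m)" for m
    by (rule state_at_eq[OF w]) (simp_all add: event_time_def w)
  have t0: "event_time 0 \<omega> = 0" by (simp add: event_time_def)
  show ?thesis
  proof (cases "\<exists>i\<ge>1. fst (\<omega> i) = x")
    case True
    define N where "N = (LEAST i. 1 \<le> i \<and> fst (\<omega> i) = x)"
    have N: "1 \<le> N" "fst (\<omega> N) = x"
      using LeastI_ex[of "\<lambda>i. 1 \<le> i \<and> fst (\<omega> i) = x"] True unfolding N_def by auto
    have before: "fst (\<omega> i) \<noteq> x" if "1 \<le> i" "i < N" for i
      using not_less_Least[of i "\<lambda>i. 1 \<le> i \<and> fst (\<omega> i) = x"] that unfolding N_def by auto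
    have "1 < N" using N x by (cases "N = 1") auto
    then have "event_time 0 \<omega> < event_time 1 \<omega>" "event_time 1 \<omega> < event_time N \<omega>"
      using mono by (auto simp: strict_mono_def)
    moreover have "state_at 0 \<omega> = x" using st[of 0] x(1) by (simp add: t0)
    ultimately have "event_time N \<omega> \<in> {t. state_at t \<omega> = state_at 0 \<omega> \<and> (\<exists>s. 0 \<le> s \<and> s < t \<and> state_at s \<omega> \<noteq> state_at 0 \<omega>)}"
      using st[of N] st[of 1] N x t0 by (auto intro!: exI[of _ "event_time 1 \<omega>"])
    then have "return_time state_at \<omega> \<le> ennreal (event_time N \<omega>)"
      unfolding return_time_def by (rule INF_lower)
    also have "\<dots> \<le> (\<Sum>m. ?h m)" by (rule partial[OF before])
    finally show ?thesis .
  next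
    case False
    have "(\<Sum>m. ?h m) = top"
    proof (rule ccontr)
      assume "(\<Sum>m. ?h m) \<noteq> top"
      then obtain b where b: "(\<Sum>m. ?h m) = ennreal b" "0 \<le> b" by (cases "\<Sum>m. ?h m") auto
      obtain m where "b < event_time m \<omega>" using ub by blast
      moreover have "ennreal (event_time m \<omega>) \<le> ennreal b"
        unfolding b(1)[symmetric] by (rule partial) (use False in auto)
      ultimately show False using b(2) by (simp add: ennreal_le_iff)
    qed
    then show ?thesis by simp
  qed
qed

text \<open>
  Given the states, each waiting time has a mean bounded by that of an interarrival time, so the mean
  return time is at most a constant times that of the jump chain.
\<close>

theorem mean_return_time_finite:
  assumes fin: "(\<Sum>m. avoid K x m x) < \<infinity>"
  shows "(\<integral>\<^sup>+ \<omega>. return_time state_at \<omega> \<partial>M (return_pmf x)) < \<infinity>"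
proof -
  let ?g = "\<lambda>(s::real) (z :: ('v, 'd) config). ennreal (waiting_time z)"
  let ?b = "ennreal (1 / clock_rate lam (None :: 'v option))"
  have g: "case_prod ?g \<in> borel_measurable (borel \<Otimes>\<^sub>M config_space)"
    unfolding split_beta' by (rule measurable_compose[OF measurable_compose[OF measurable_snd measurable_waiting_time]]) simp
  have J_mono_iterate: "(J B ^^ m) h s y \<le> (J B ^^ m) h' s y" if "\<And>s y. h s y \<le> h' s y" for B m h h' s y
    by (induction m arbitrary: s y) (auto intro: that J_mono)
  have cmult: "(taboo K x ^^ m) (\<lambda>_. c) = (\<lambda>y. c * avoid K x m y)" for m c
  proof (induction m)
    case (Suc m)
    show ?case by (rule ext) (simp add: Suc taboo_cmult)
  qed simp
  have "(\<integral>\<^sup>+ \<omega>. return_time state_at \<omega> \<partial>M (return_pmf x)) \<le>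
      (\<integral>\<^sup>+ \<omega>. (\<Sum>m. history (- {x}) m ?g \<omega>) \<partial>M (return_pmf x))"
  proof (rule nn_integral_mono_AE)
    show "AE \<omega> in M (return_pmf x). return_time state_at \<omega> \<le> (\<Sum>m. history (- {x}) m ?g \<omega>)"
      using AE_waiting_pos AE_no_explosion AE_start AE_first_jump
      by eventually_elim (rule return_time_le, auto)
  qed
  also have "\<dots> = (\<Sum>m. \<integral>\<^sup>+ \<omega>. history (- {x}) m ?g \<omega> \<partial>M (return_pmf x))"
    by (intro nn_integral_suminf history_measurable g)
  also have "\<dots> = (\<Sum>m. (J (- {x}) ^^ m) (fresh_mean lam ?g) 0 x)"
    by (simp add: path_nn_integral[OF lam g])
  also have "\<dots> \<le> (\<Sum>m. ?b * avoid K x m x)"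
  proof (intro suminf_le)
    fix m
    have "(J (- {x}) ^^ m) (fresh_mean lam ?g) 0 x \<le> (J (- {x}) ^^ m) (\<lambda>_ _. ?b) 0 x"
      by (intro J_mono_iterate mean_waiting_time)
    then show "(J (- {x}) ^^ m) (fresh_mean lam ?g) 0 x \<le> ?b * avoid K x m x"
      by (simp only: J_taboo cmult[of m ?b])
  qed auto
  also have "\<dots> = ?b * (\<Sum>m. avoid K x m x)" by (rule ennreal_suminf_cmult)
  also have "\<dots> < \<infinity>" using fin by (simp add: ennreal_mult_less_top)
  finally show ?thesis .
qed

section \<open>Weak convergence of the queue lengths\<close>

text \<open>
  The number of steps of the uniformised chain up to time \<open>t\<close> tends to infinity, and dominated
  convergence handles the average over the initial distribution.
\<close>

theorem queues_converge_weakly: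
  assumes erg: "\<And>x f b. x \<in> S \<Longrightarrow> (\<And>z. \<bar>f z\<bar> \<le> (b::real)) \<Longrightarrow>
      (\<lambda>m. expect (kpow U m x) f) \<longlonglongrightarrow> expect p f"
    and \<mu>: "set_pmf \<mu> \<subseteq> S"
  shows "converges_weakly (\<lambda>t. distr (M \<mu>) borel (queues_at t)) (distr (measure_pmf p) borel fst) at_top"
  unfolding converges_weakly_def
proof (intro allI impI, elim conjE)
  fix f :: "('v \<Rightarrow> nat) \<Rightarrow> real" assume cont: "continuous_on UNIV f" and bd: "bounded (range f)"
  obtain b where b: "\<And>q. \<bar>f q\<bar> \<le> b" using bd by (auto simp: bounded_iff)
  have f: "f \<in> borel_measurable borel" by (rule borel_measurable_continuous_onI[OF cont])
  let ?a = "\<lambda>x m. expect (kpow U m x) (\<lambda>z. f (fst z))"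
  have a: "\<bar>?a x m\<bar> \<le> b" for x m by (intro abs_expectation_le b)
  have eq: "(\<integral>q. f q \<partial>distr (M \<mu>) borel (queues_at t)) = expect \<mu> (\<lambda>x. poisson_mean (?a x) (C * t))"
    if t: "0 < t" for t
  proof -
    have qm: "queues_at t \<in> M \<mu> \<rightarrow>\<^sub>M borel"
      unfolding queues_at_def[abs_def] by (rule measurable_compose[OF state_at_measurable]) simp
    have "(\<integral>q. f q \<partial>distr (M \<mu>) borel (queues_at t)) = (\<integral>\<omega>. f (fst (state_at t \<omega>)) \<partial>M \<mu>)"
      by (subst integral_distr[OF qm f]) (simp add: queues_at_def)
    also have "\<dots> = (\<integral>z. f (fst z) \<partial>distr (M \<mu>) (count_space UNIV) (state_at t))"
      by (rule integral_distr[OF state_at_measurable, symmetric]) simp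
    also have "\<dots> = expect \<mu> (\<lambda>x. expect (poisson_pmf (C * t)) (?a x))"
      unfolding distr_state_at[OF t] law_def
      by (simp add: expectation_bind_bounded[where B=b] b)
    also have "\<dots> = expect \<mu> (\<lambda>x. poisson_mean (?a x) (C * t))"
      using C_pos t by (simp add: expectation_poisson_pmf[OF _ a])
    finally show ?thesis .
  qed
  have "((\<lambda>t. expect \<mu> (\<lambda>x. poisson_mean (?a x) (C * t))) \<longlongrightarrow>
      expect \<mu> (\<lambda>x. expect p (\<lambda>z. f (fst z)))) at_top"
  proof (rule integral_dominated_convergence_at_top[where w="\<lambda>_. b"])
    show "AE x in measure_pmf \<mu>. ((\<lambda>t. poisson_mean (?a x) (C * t)) \<longlongrightarrow> expect p (\<lambda>z. f (fst z))) at_top"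
    proof (rule AE_pmfI)
      fix x assume "x \<in> set_pmf \<mu>"
      then have "?a x \<longlonglongrightarrow> expect p (\<lambda>z. f (fst z))"
        using \<mu> by (intro erg[where b=b] b) auto
      from filterlim_compose[OF poisson_mean_tendsto[OF a this]
          filterlim_tendsto_pos_mult_at_top[OF tendsto_const C_pos filterlim_ident]]
      show "((\<lambda>t. poisson_mean (?a x) (C * t)) \<longlongrightarrow> expect p (\<lambda>z. f (fst z))) at_top" .
    qed
    show "\<forall>\<^sub>F t in at_top. AE x in measure_pmf \<mu>. norm (poisson_mean (?a x) (C * t)) \<le> b"
      using eventually_gt_at_top[of 0]
    proof eventually_elim
      case (elim t)
      have "\<bar>poisson_mean (?a x) (C * t)\<bar> \<le> b" for x
        using abs_expectation_le[of "?a x" b "poisson_pmf (C * t)", OF a] expectation_poisson_pmf[of "C * t" "?a x" b, OF _ a] C_pos elim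
        by simp
      then show ?case by simp
    qed
  qed auto
  moreover have "(\<integral>q. f q \<partial>distr (measure_pmf p) borel fst) = expect p (\<lambda>z. f (fst z))"
    by (rule integral_distr[OF _ f]) simp
  moreover have "\<forall>\<^sub>F t in at_top. (\<integral>q. f q \<partial>distr (M \<mu>) borel (queues_at t)) =
      expect \<mu> (\<lambda>x. poisson_mean (?a x) (C * t))"
    using eventually_gt_at_top[of 0] by eventually_elim (rule eq)
  ultimately show "((\<lambda>t. \<integral>q. f q \<partial>distr (M \<mu>) borel (queues_at t)) \<longlongrightarrow>
      (\<integral>q. f q \<partial>distr (measure_pmf p) borel fst)) at_top"
    by (simp add: filterlim_cong[OF refl refl])
qed

end

section \<open>Irreducibility, positive recurrence and convergence\<close>

theorem theorem2:
  fixes adj :: "'v::finite \<Rightarrow> 'v \<Rightarrow> bool"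
    and lam :: real
    and k :: nat
    and tie :: "('v, 'd::finite) state \<Rightarrow> 'v pmf"
  assumes "0 < lam" and "lam < 1"
    and "CARD('d) \<ge> 2"
    and "k \<ge> 3"
    and "simple_graph adj"
    and "regular_graph adj k"
    and "connected_graph adj"
    and "aperiodic_graph adj"
    and "tie_breaking_rule adj tie"
  shows "irreducible_process (states adj) (\<lambda>x. path_measure adj lam tie (return_pmf x)) state_at \<and>
         positive_recurrent_process (states adj)
           (\<lambda>x. path_measure adj lam tie (return_pmf x)) state_at \<and>
         (\<exists>\<nu> :: ('v \<Rightarrow> nat) measure. prob_space \<nu> \<and> sets \<nu> = sets borel \<and>
           (\<forall>\<mu>. set_pmf \<mu> \<subseteq> states adj \<longrightarrow>
              converges_weakly
                (\<lambda>t. distr (path_measure adj lam tie \<mu>) borel (queues_at t)) \<nu> at_top))"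
proof -
  interpret Q: nbrw_queue adj k lam tie
    using assms by unfold_locales auto
  interpret P: queue_process adj lam tie "\<Sum>e\<in>(UNIV :: 'v option set). clock_rate lam e"
    by unfold_locales (use assms in auto)
  obtain p where p: "\<And>x f b. x \<in> states adj \<Longrightarrow> (\<And>z. \<bar>f z\<bar> \<le> (b::real)) \<Longrightarrow>
      (\<lambda>m. expect (kpow (uniform_kernel adj lam tie) m x) f) \<longlonglongrightarrow> expect p f"
    using Q.uniform_kernel_ergodic by metis
  have "irreducible_process (states adj) (\<lambda>x. path_measure adj lam tie (return_pmf x)) state_at"
    unfolding irreducible_process_def
  proof (intro ballI)
    fix x y :: "('v, 'd) state" assume "x \<in> states adj" "y \<in> states adj"
    then obtain m where "y \<in> set_pmf (kpow (uniform_kernel adj lam tie) m x)" using Q.reach_uniform by blast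
    from P.visits_reachable[OF this]
    show "\<exists>t\<ge>0. 0 < measure (path_measure adj lam tie (return_pmf x))
        {\<omega> \<in> space (path_measure adj lam tie (return_pmf x)). state_at t \<omega> = y}"
      by (intro exI[of _ 1]) simp
  qed
  moreover have "positive_recurrent_process (states adj) (\<lambda>x. path_measure adj lam tie (return_pmf x)) state_at"
    unfolding positive_recurrent_process_def
    using P.mean_return_time_finite Q.jump_return_finite by blast
  moreover have "prob_space (distr (measure_pmf p) borel fst :: ('v \<Rightarrow> nat) measure)"
    by (intro measure_pmf.prob_space_distr) simp
  moreover have "converges_weakly (\<lambda>t. distr (path_measure adj lam tie \<mu>) borel (queues_at t))
      (distr (measure_pmf p) borel fst) at_top" if "set_pmf \<mu> \<subseteq> states adj" for \<mu>
    by (rule P.queues_converge_weakly[OF _ that]) (rule p)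
  ultimately show ?thesis
    by (intro conjI exI[of _ "distr (measure_pmf p) borel fst"] allI impI) auto
qed

end
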